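(* A map $Z\colon \mathcal S_0^n\to M(S^{n-1})_+$ is a weak$^*$ continuous valuation satisfying $Z(\{0\})=0$ if and only if there exist $\mu\in M(S^{n-1})_+$ and a $\mu$-strong Carathéodory and uniformly controlled map $U\colon \mathbb R_+\times S^{n-1}\to M(S^{n-1})_+$ such that $U(0,s)=0$ for $\mu$-almost every $s$ and $$\langle Z(L),g\rangle=\int_{S^{n-1}}\langle U(\rho_L(s),s),g\rangle\,\mathrm d\mu(s)$$ for every $L\in\mathcal S_0^n$ and $g\in C(S^{n-1})$.
   Context: $\mathbb R_+=[0,\infty)$; $S^{n-1}$ is the unit sphere of $\mathbb R^n$; $C(S^{n-1})$ is the space of real continuous functions on $S^{n-1}$ with the supremum norm $\|\cdot\|_\infty$. $M(S^{n-1})_+$ is the space of non-negative Radon measures on $S^{n-1}$, and $\langle\mu,g\rangle=\int_{S^{n-1}}g\,\mathrm d\mu$. Star bodies: a set $L\subset\mathbb R^n$ is a star set if $\{\lambda x:0\le\lambda\le1\}\subset L$ for every $x\in L$. Its radial function is $\rho_L(s)=\sup\{\lambda\ge0:\lambda s\in L\}$, $s\in S^{n-1}$. A star set $L$ is a star body if $\rho_L$ is a non-negative continuous function on $S^{n-1}$; $\mathcal S_0^n$ is the set of star bodies in $\mathbb R^n$. Star bodies are identified with their radial functions: every non-negative $f\in C(S^{n-1})$ is the radial function of a star body $L_f$, and $\rho_{K\cup L}=\max\{\rho_K,\rho_L\}$, $\rho_{K\cap L}=\min\{\rho_K,\rho_L\}$. $\mathcal S_0^n$ carries the topology of the radial metric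 $\delta(K,L)=\|\rho_K-\rho_L\|_\infty$. $Z$ is a valuation if $Z(K\cup L)+Z(K\cap L)=Z(K)+Z(L)$ for all $K,L\in\mathcal S_0^n$. $Z$ is weak$^*$ continuous if $L\mapsto\langle Z(L),g\rangle$ is continuous on $\mathcal S_0^n$ for every $g\in C(S^{n-1})$. A map $K\colon\mathbb R_+\times S^{n-1}\to\mathbb R$ is $\mu$-strong Carathéodory if $s\mapsto K(\lambda,s)$ is Borel measurable on $S^{n-1}$ for every $\lambda\in\mathbb R_+$ and there is a Borel set $S_0\subset S^{n-1}$ with $\mu(S_0)=\mu(S^{n-1})$ such that $\lambda\mapsto K(\lambda,s)$ is continuous on $\mathbb R_+$ for every $s\in S_0$. A map $U\colon\mathbb R_+\times S^{n-1}\to M(S^{n-1})_+$ is $\mu$-strong Carathéodory if $(\lambda,s)\mapsto\langle U(\lambda,s),g\rangle$ is $\mu$-strong Carathéodory for every $g\in C(S^{n-1})$. $U$ is uniformly controlled if there is a function $\zeta\colon\mathbb R_+\to\mathbb R_+$ such that $|\langle U(\lambda,s),g\rangle|\le\|g\|_\infty\,\zeta(\lambda)$ for every $\lambda\in\mathbb R_+$, every $s\in S^{n-1}$ and every $g\in C(S^{n-1})$. *)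

theory Defs
  imports "HOL-Analysis.Analysis"
begin

abbreviation usphere :: "(real ^ 'n) set" where
  "usphere \<equiv> sphere 0 1"

text \<open>The Borel \<open>\<sigma>\<close>-algebra of the unit sphere; only the \<open>\<sigma>\<close>-algebra of this measure is used.\<close>

abbreviation sphere_borel :: "(real ^ 'n) measure" where
  "sphere_borel \<equiv> restrict_space borel usphere"

text \<open>Elements of \<open>C(S)\<close> are functions on the whole space of which only the restriction to the
  sphere matters. On such functions the supremum below is a maximum over a compact nonempty set.\<close>

definition sup_norm :: "(real ^ 'n \<Rightarrow> real) \<Rightarrow> real" where
  "sup_norm g = (SUP s\<in>usphere. \<bar>g s\<bar>)"

text \<open>Non-negative Radon measures on the sphere. The sphere being compact, finiteness on compact
  sets is finiteness.\<close>

definition radon_measures :: "(real ^ 'n) measure set" where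
  "radon_measures = {M. sets M = sets sphere_borel \<and> finite_measure M \<and>
     (\<forall>A\<in>sets M. emeasure M A = (SUP C\<in>{C. C \<subseteq> A \<and> compact C}. emeasure M C))}"

definition pairing :: "(real ^ 'n) measure \<Rightarrow> (real ^ 'n \<Rightarrow> real) \<Rightarrow> real" where
  "pairing M g = (\<integral>x. g x \<partial>M)"

definition star_set :: "(real ^ 'n) set \<Rightarrow> bool" where
  "star_set L \<longleftrightarrow> (\<forall>x\<in>L. {l *\<^sub>R x | l. 0 \<le> l \<and> l \<le> 1} \<subseteq> L)"

text \<open>The supremum is taken in the extended reals, so that it is \<open>\<infinity>\<close> in directions in which \<open>L\<close> is
  unbounded, and \<open>- \<infinity>\<close> for the empty set, which is therefore not a star body.\<close>

definition radial_ext :: "(real ^ 'n) set \<Rightarrow> real ^ 'n \<Rightarrow> ereal" where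
  "radial_ext L s = Sup {ereal l | l. 0 \<le> l \<and> l *\<^sub>R s \<in> L}"

definition radial :: "(real ^ 'n) set \<Rightarrow> real ^ 'n \<Rightarrow> real" where
  "radial L s = real_of_ereal (radial_ext L s)"

definition star_body :: "(real ^ 'n) set \<Rightarrow> bool" where
  "star_body L \<longleftrightarrow> star_set L \<and>
     (\<forall>s\<in>usphere. 0 \<le> radial_ext L s \<and> radial_ext L s < \<infinity>) \<and>
     continuous_on usphere (radial L)"

text \<open>Star bodies are identified when their radial functions agree. On sets, \<open>radial_dist\<close> is only
  a pseudometric, and a map that is weak* continuous for it is constant on classes of identified
  star bodies (a Radon measure being determined by its integrals of continuous functions), so that
  no quotient is needed.\<close>

definition radial_dist :: "(real ^ 'n) set \<Rightarrow> (real ^ 'n) set \<Rightarrow> real" where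
  "radial_dist K L = sup_norm (\<lambda>s. radial K s - radial L s)"

text \<open>The equation between sums of measures, evaluated on Borel sets.\<close>

definition valuation :: "((real ^ 'n) set \<Rightarrow> (real ^ 'n) measure) \<Rightarrow> bool" where
  "valuation Z \<longleftrightarrow> (\<forall>K L. star_body K \<longrightarrow> star_body L \<longrightarrow>
     (\<forall>A\<in>sets sphere_borel.
        emeasure (Z (K \<union> L)) A + emeasure (Z (K \<inter> L)) A = emeasure (Z K) A + emeasure (Z L) A))"

definition weak_star_continuous :: "((real ^ 'n) set \<Rightarrow> (real ^ 'n) measure) \<Rightarrow> bool" where
  "weak_star_continuous Z \<longleftrightarrow> (\<forall>g. continuous_on usphere g \<longrightarrow>
     (\<forall>L. star_body L \<longrightarrow> (\<forall>e>0. \<exists>d>0. \<forall>K. star_body K \<longrightarrow> radial_dist K L < d \<longrightarrow>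
        \<bar>pairing (Z K) g - pairing (Z L) g\<bar> < e)))"

definition strong_caratheodory_real ::
  "(real ^ 'n) measure \<Rightarrow> (real \<Rightarrow> real ^ 'n \<Rightarrow> real) \<Rightarrow> bool" where
  "strong_caratheodory_real \<mu> k \<longleftrightarrow>
     (\<forall>l\<ge>0. k l \<in> borel_measurable sphere_borel) \<and>
     (\<exists>S0\<in>sets sphere_borel. emeasure \<mu> S0 = emeasure \<mu> usphere \<and>
        (\<forall>s\<in>S0. continuous_on {0..} (\<lambda>l. k l s)))"

definition strong_caratheodory ::
  "(real ^ 'n) measure \<Rightarrow> (real \<Rightarrow> real ^ 'n \<Rightarrow> (real ^ 'n) measure) \<Rightarrow> bool" where
  "strong_caratheodory \<mu> U \<longleftrightarrow> (\<forall>g. continuous_on usphere g \<longrightarrow>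
     strong_caratheodory_real \<mu> (\<lambda>l s. pairing (U l s) g))"

definition uniformly_controlled :: "(real \<Rightarrow> real ^ 'n \<Rightarrow> (real ^ 'n) measure) \<Rightarrow> bool" where
  "uniformly_controlled U \<longleftrightarrow> (\<exists>\<zeta>::real \<Rightarrow> real. (\<forall>l\<ge>0. 0 \<le> \<zeta> l) \<and>
     (\<forall>l\<ge>0. \<forall>s\<in>usphere. \<forall>g. continuous_on usphere g \<longrightarrow>
        \<bar>pairing (U l s) g\<bar> \<le> sup_norm g * \<zeta> l))"

text \<open>The map \<open>s \<mapsto> \<langle>U(\<rho>(s), s), g\<rangle>\<close> need only be Borel outside a \<open>\<mu>\<close>-null set, because the
  continuity in a strong Caratheodory map may fail on a null set, where no joint
  measurability is available. Hence its integral is taken with respect to the completion of \<open>\<mu>\<close>;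
  with respect to \<open>\<mu>\<close> itself the Bochner integral of a non-Borel function would be the default
  value 0. For the same reason \<open>has_bochner_integral\<close> is used, which says that the
  integral exists and has the stated value.\<close>

definition represents ::
  "(real ^ 'n) measure \<Rightarrow> (real \<Rightarrow> real ^ 'n \<Rightarrow> (real ^ 'n) measure) \<Rightarrow>
    ((real ^ 'n) set \<Rightarrow> (real ^ 'n) measure) \<Rightarrow> bool" where
  "represents \<mu> U Z \<longleftrightarrow> (\<forall>L g. star_body L \<longrightarrow> continuous_on usphere g \<longrightarrow>
     has_bochner_integral (completion \<mu>) (\<lambda>s. pairing (U (radial L s) s) g) (pairing (Z L) g))"

end

theory Submission
  imports Defs
begin

text \<open>For each continuous \<open>g \<ge> 0\<close> the map \<open>f \<mapsto> \<langle>Z(L\<^sub>f), g\<rangle>\<close> is a non-negative continuous valuation \<open>V\<close>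
  on the non-negative continuous functions. The suprema of \<open>V\<close> over functions \<open>f \<le> B\<close> that vanish
  off an open set define a finite Borel measure (Caratheodory), and all these measures, for \<open>g = 1\<close>,
  are dominated by one measure \<open>\<mu>\<close>. Then \<open>\<bar>V(f) - V(h)\<bar>\<close> is at most a multiple of \<open>\<mu>(f \<noteq> h)\<close>, so that by
  Lusin's theorem \<open>V\<close> extends to bounded Borel functions, continuously for uniform convergence. The
  measure \<open>A \<mapsto> V(q 1\<^sub>A)\<close> has a density \<open>K(q, \<cdot>)\<close> with respect to \<open>\<mu>\<close>, and for almost every \<open>s\<close> the map
  \<open>q \<mapsto> K(q, s)\<close> is uniformly continuous on bounded sets of rationals. Doing this for a countable
  dense cone of functions \<open>g\<close> gives, at almost every \<open>s\<close>, an additive functional in \<open>g\<close>, represented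
  by a measure \<open>U(\<lambda>, s)\<close> through Riesz' theorem.

  Conversely, a superposition operator \<open>f \<mapsto> k(f(\<cdot>), \<cdot>)\<close> with a non-negative Caratheodory kernel that
  maps all continuous functions into \<open>L\<^sup>1\<close> is automatically continuous, because along a uniformly
  convergent sequence it is dominated by an integrable function. This is needed because uniform
  control bounds the kernel only for each \<open>\<lambda>\<close> separately, not locally uniformly in \<open>\<lambda>\<close>.\<close>

section \<open>Measures from contents on open sets\<close>

text \<open>The obstacle is that a valuation \<open>V\<close> is neither additive nor monotone, and
  that its continuity is given at each function separately: bounded sets of continuous functions are
  not compact, so neither a bound nor a modulus of continuity on them comes for free. Bounds come
  from the compactness of the interval \<open>[0,B]\<close> of levels. Locality comes from one
  exchange: if \<open>max f q = max g q\<close>, then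
  \<open>V f - V g = V (min f q) - V (min g q)\<close>, and the right side only sees where
  \<open>q > 0\<close>. Total mass, the case \<open>g = 1\<close>, suffices for the control because
  the functional of \<open>g\<close> is at most \<open>max g\<close> times that of \<open>1\<close>.
  Each density \<open>K(q, .)\<close> is determined only up to a null set depending on
  \<open>q\<close> and \<open>g\<close>. Regularity in \<open>q\<close> and additivity in
  \<open>g\<close> can thus hold at almost every point only for countably many of them: rational
  levels, and rational polynomials non-negative on the sphere, a set closed under sums and under
  those differences that stay non-negative. Real levels and general \<open>g\<close> are reached by
  limits.\<close>

lemma ennreal_add_le_of_less:
  fixes x y z :: ennreal
  assumes "y \<le> z" "\<And>c. c < x \<Longrightarrow> c + y \<le> z"
  shows "x + y \<le> z"
\<comment> \<open>For \<open>x = 0\<close> there is no \<open>c < x\<close>; that case is the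
  hypothesis \<open>y \<le> z\<close>.\<close>
proof (cases "x = 0")
  case False
  then have ne: "{..<x} \<noteq> {}"
    using not_gr_zero[of x] by blast
  have "x + y = (SUP c\<in>{..<x}. c) + y"
    by simp
  also have "\<dots> = (SUP c\<in>{..<x}. c + y)"
    by (rule ennreal_SUP_add_left[symmetric, OF ne])
  also have "\<dots> \<le> z"
    using assms(2) by (intro SUP_least) auto
  finally show ?thesis .
qed (use assms in auto)

text \<open>\<open>m\<close> is meaningful on open sets only, so \<open>inner\<close> measures a
  compact set through its open neighbourhoods. It is the source both of countable subadditivity and
  of the splitting of sets by open sets.\<close>

locale open_content =
  fixes m :: "'a::euclidean_space set \<Rightarrow> ennreal"
  assumes empty: "m {} = 0"
    and mono: "open G \<Longrightarrow> open H \<Longrightarrow> G \<subseteq> H \<Longrightarrow> m G \<le> m H"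
    and subadd: "open G \<Longrightarrow> open H \<Longrightarrow> m (G \<union> H) \<le> m G + m H"
    and superadd: "open G \<Longrightarrow> open H \<Longrightarrow> G \<inter> H = {} \<Longrightarrow> m G + m H \<le> m (G \<union> H)"
    and inner: "open G \<Longrightarrow> c < m G \<Longrightarrow> \<exists>C. compact C \<and> C \<subseteq> G \<and> (\<forall>H. open H \<and> C \<subseteq> H \<longrightarrow> c < m H)"
begin

definition outer :: "'a set \<Rightarrow> ennreal" where
  "outer A = (INF G\<in>{G. open G \<and> A \<subseteq> G}. m G)"

lemma outer_open: "open G \<Longrightarrow> outer G = m G"
  unfolding outer_def by (intro antisym INF_lower INF_greatest) (auto intro: mono)

lemma outer_mono: "A \<subseteq> B \<Longrightarrow> outer A \<le> outer B"
  unfolding outer_def by (rule INF_superset_mono) auto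

lemma content_finite_Union:
  assumes "finite I" "\<And>i. i \<in> I \<Longrightarrow> open (G i)"
  shows "m (\<Union>i\<in>I. G i) \<le> (\<Sum>i\<in>I. m (G i))"
  using assms
proof (induction I rule: finite_induct)
  case (insert i I)
  have "m (G i \<union> (\<Union>i\<in>I. G i)) \<le> m (G i) + m (\<Union>i\<in>I. G i)"
    using insert by (intro subadd) auto
  also have "\<dots> \<le> m (G i) + (\<Sum>i\<in>I. m (G i))"
    using insert by (intro add_left_mono) auto
  finally show ?case using insert by simp
qed (simp add: empty)

text \<open>Compactness makes the countable cover finite: the compact set that \<open>inner\<close>
  supplies for a value below \<open>m\<close> of the union already lies in finitely many
  \<open>G i\<close>.\<close>

lemma content_countable_Union:
  fixes G :: "nat \<Rightarrow> 'a set"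
  assumes "\<And>i. open (G i)"
  shows "m (\<Union>i. G i) \<le> (\<Sum>i. m (G i))"
proof (rule dense_le)
  fix c assume "c < m (\<Union>i. G i)"
  then obtain C where C: "compact C" "C \<subseteq> (\<Union>i. G i)" "\<And>H. open H \<Longrightarrow> C \<subseteq> H \<Longrightarrow> c < m H"
    using inner[OF open_UN[of UNIV G], of c] assms by metis
  obtain I where I: "finite I" "C \<subseteq> (\<Union>i\<in>I. G i)"
    using compactE_image[OF C(1), of UNIV G] C(2) assms by auto
  have "c \<le> m (\<Union>i\<in>I. G i)"
    using C(3)[of "\<Union>i\<in>I. G i"] I assms by (intro less_imp_le) auto
  also have "\<dots> \<le> (\<Sum>i\<in>I. m (G i))"
    by (rule content_finite_Union) (use I assms in auto)
  also have "\<dots> \<le> (\<Sum>i. m (G i))"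
    by (rule sum_le_suminf) (use I in auto)
  finally show "c \<le> (\<Sum>i. m (G i))" .
qed

lemma outer_measure_space_outer: "outer_measure_space (Pow UNIV) outer"
  unfolding outer_measure_space_def
proof (intro conjI)
  show "positive (Pow UNIV) outer"
    unfolding positive_def using outer_open[of "{}"] empty by simp
  show "increasing (Pow UNIV) outer"
    unfolding increasing_def using outer_mono by auto
  show "countably_subadditive (Pow UNIV) outer"
    unfolding countably_subadditive_def
  proof (intro allI impI)
    fix A :: "nat \<Rightarrow> 'a set"
    show "outer (\<Union>i. A i) \<le> (\<Sum>i. outer (A i))"
    proof (rule ennreal_le_epsilon)
      fix e :: real assume fin: "(\<Sum>i. outer (A i)) < top" and e: "0 < e"
      have "\<exists>G. open G \<and> A i \<subseteq> G \<and> m G \<le> outer (A i) + ennreal (e * (1/2)^Suc i)" for i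
      proof -
        have le: "outer (A i) \<le> (\<Sum>i. outer (A i))"
          using sum_le_suminf[of "\<lambda>i. outer (A i)" "{i}"] by simp
        \<comment> \<open>Strict because finiteness of the whole sum makes each
          \<open>outer (A i)\<close> finite.\<close>
        have "outer (A i) < outer (A i) + ennreal (e * (1/2)^Suc i)"
          using ennreal_add_left_cancel_less[of "outer (A i)" 0 "ennreal (e * (1/2)^Suc i)"]
            order.strict_trans1[OF le fin] e by auto
        then obtain G where "open G" "A i \<subseteq> G" "m G < outer (A i) + ennreal (e * (1/2)^Suc i)"
          using INF_less_iff[of m "{G. open G \<and> A i \<subseteq> G}" "outer (A i) + ennreal (e * (1/2)^Suc i)"]
          unfolding outer_def[of "A i", symmetric] by blast
        then show ?thesis
          by (intro exI[of _ G]) (auto intro: less_imp_le)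
      qed
      then obtain G where G: "\<And>i. open (G i)" "\<And>i. A i \<subseteq> G i"
        "\<And>i. m (G i) \<le> outer (A i) + ennreal (e * (1/2)^Suc i)"
        by metis
      have "outer (\<Union>i. A i) \<le> m (\<Union>i. G i)"
        unfolding outer_def using G by (intro INF_lower) auto
      also have "\<dots> \<le> (\<Sum>i. m (G i))"
        by (rule content_countable_Union) (use G in auto)
      also have "\<dots> \<le> (\<Sum>i. outer (A i) + ennreal (e * (1/2)^Suc i))"
        by (intro suminf_le G) auto
      also have "\<dots> = (\<Sum>i. outer (A i)) + (\<Sum>i. ennreal (e * (1/2)^Suc i))"
        by (rule suminf_add[symmetric]) auto
      also have "(\<Sum>i. ennreal (e * (1/2)^Suc i)) = ennreal e"
        using sums_mult[OF power_half_series, of e] e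
        by (intro suminf_ennreal_eq) auto
      finally show "outer (\<Union>i. A i) \<le> (\<Sum>i. outer (A i)) + ennreal e" .
    qed
  qed
qed

text \<open>The substantial half of Caratheodory's criterion for open \<open>G\<close>. For open
  \<open>H\<close>, a compact subset of \<open>H \<inter> G\<close> carrying almost all its content
  is separated by disjoint open sets from the complement of \<open>H \<inter> G\<close>, which
  contains \<open>H - G\<close>; \<open>superadd\<close> then applies to these neighbourhoods inside
  \<open>H\<close>.\<close>

lemma outer_split:
  assumes G: "open G"
  shows "outer (A \<inter> G) + outer (A - G) \<le> outer A"
proof -
  have H: "outer (H \<inter> G) + outer (H - G) \<le> m H" if "open H" for H
  proof (rule ennreal_add_le_of_less)
    show "outer (H - G) \<le> m H"
      using outer_mono[of "H - G" H] outer_open[OF that] by simp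
  next
    fix c assume "c < outer (H \<inter> G)"
    then have "c < m (H \<inter> G)"
      using that G by (simp add: outer_open open_Int)
    then obtain C where C: "compact C" "C \<subseteq> H \<inter> G" "\<And>H. open H \<Longrightarrow> C \<subseteq> H \<Longrightarrow> c < m H"
      using inner[OF open_Int[OF \<open>open H\<close> G], of c] by metis
    have "closed (- (H \<inter> G))" "C \<inter> - (H \<inter> G) = {}"
      using that G C(2) by (auto intro: closed_Compl)
    then obtain O1 O2 where O: "open O1" "open O2" "C \<subseteq> O1" "- (H \<inter> G) \<subseteq> O2" "O1 \<inter> O2 = {}"
      using separation_normal[of C "- (H \<inter> G)"] C(1) compact_imp_closed by metis
    have "c + outer (H - G) \<le> m O1 + outer (H \<inter> O2)"
      using C(3)[OF O(1,3)] O by (intro add_mono outer_mono) auto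
    also have "\<dots> = m O1 + m (H \<inter> O2)"
      using O that by (simp add: outer_open open_Int)
    also have "\<dots> \<le> m (O1 \<union> H \<inter> O2)"
      using O that by (intro superadd) auto
    also have "\<dots> \<le> m H"
      using O that by (intro mono) auto
    finally show "c + outer (H - G) \<le> m H" .
  qed
  show ?thesis
    unfolding outer_def[of A]
  proof (rule INF_greatest)
    fix H assume "H \<in> {H. open H \<and> A \<subseteq> H}"
    then have "open H" "A \<subseteq> H" by auto
    then have "outer (A \<inter> G) + outer (A - G) \<le> outer (H \<inter> G) + outer (H - G)"
      by (intro add_mono outer_mono) auto
    with H[OF \<open>open H\<close>] show "outer (A \<inter> G) + outer (A - G) \<le> m H" by simp
  qed
qed

lemma ex_borel_measure:
  obtains M :: "'a measure" where "sets M = sets borel" "\<And>G. open G \<Longrightarrow> emeasure M G = m G"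
proof -
  interpret P: sigma_algebra UNIV "Pow (UNIV :: 'a set)"
    by (rule sigma_algebra_Pow)
  let ?L = "lambda_system UNIV (Pow UNIV) outer"
  have L: "measure_space UNIV ?L outer"
    by (rule P.caratheodory_lemma[OF outer_measure_space_outer])
  then have sL: "sigma_algebra UNIV ?L"
    by (simp add: measure_space_def)
  have op: "G \<in> ?L" if "open G" for G
  proof -
    have "outer (A \<inter> G) + outer (A - G) = outer A" for A
    proof (rule antisym[OF outer_split[OF that]])
      have "subadditive (Pow UNIV) outer"
        using outer_measure_space_outer unfolding outer_measure_space_def
        by (intro P.countably_subadditive_subadditive) auto
      then have "outer ((A \<inter> G) \<union> (A - G)) \<le> outer (A \<inter> G) + outer (A - G)"
        by (rule subadditiveD) auto
      then show "outer A \<le> outer (A \<inter> G) + outer (A - G)"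
        by (simp add: Int_Diff_Un)
    qed
    then show ?thesis
      unfolding P.lambda_system_eq by blast
  qed
  define M where "M = measure_of UNIV {G :: 'a set. open G} outer"
  have sets: "sets M = sets borel"
    unfolding M_def borel_def by simp
  have sub: "sigma_sets UNIV {G :: 'a set. open G} \<subseteq> ?L"
    by (rule sigma_algebra.sigma_sets_subset[OF sL]) (use op in auto)
  have "measure_space UNIV (sigma_sets UNIV {G :: 'a set. open G}) outer"
    by (rule measure_down[OF L _ sub]) (rule sigma_algebra_sigma_sets, auto)
  then have pos: "positive (sets M) outer" "countably_additive (sets M) outer"
    unfolding M_def by (auto simp: measure_space_def)
  have "emeasure M G = m G" if "open G" for G
    using emeasure_measure_of[OF M_def _ pos, of G] that outer_open[OF that]
    by (auto simp: sets)
  with sets that show ?thesis by blast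
qed

text \<open>Since \<open>G - S\<close> lies in the null open set \<open>- S\<close>, nothing is lost
  by restricting to \<open>S\<close>.\<close>

lemma ex_measure_on:
  assumes S: "closed S" "m (- S) = 0"
  obtains M where "sets M = sets (restrict_space borel S)"
    "\<And>G. open G \<Longrightarrow> emeasure M (G \<inter> S) = m G"
proof -
  obtain M where M: "sets M = sets borel" "\<And>G. open G \<Longrightarrow> emeasure M G = m G"
    using ex_borel_measure by blast
  have sp: "space M = UNIV"
    using sets_eq_imp_space_eq[OF M(1)] by simp
  show ?thesis
  proof (rule that[of "restrict_space M S"])
    show "sets (restrict_space M S) = sets (restrict_space borel S)"
      by (rule sets_restrict_space_cong[OF M(1)])
    fix G :: "'a set" assume G: "open G"
    have "emeasure (restrict_space M S) (G \<inter> S) = emeasure M (G \<inter> S)"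
      by (rule emeasure_restrict_space) (use S M(1) sp in auto)
    also have "\<dots> = emeasure M (G \<inter> S) + emeasure M (G - S)"
    proof -
      have "emeasure M (G - S) \<le> emeasure M (- S)"
        using S M(1) by (intro emeasure_mono) auto
      then show ?thesis using S M(2)[of "- S"] by (simp add: open_Compl)
    qed
    also have "\<dots> = emeasure M ((G \<inter> S) \<union> (G - S))"
      using S M(1) G by (intro plus_emeasure) auto
    also have "(G \<inter> S) \<union> (G - S) = G" by blast
    finally show "emeasure (restrict_space M S) (G \<inter> S) = m G"
      using M(2)[OF G] by simp
  qed
qed

end

section \<open>Non-negative continuous functions and separation of closed sets\<close>

definition cpos :: "'a::topological_space set \<Rightarrow> ('a \<Rightarrow> real) set" where
  "cpos S = {f. continuous_on S f \<and> (\<forall>x\<in>S. 0 \<le> f x)}"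

definition cpos_le :: "'a::topological_space set \<Rightarrow> real \<Rightarrow> ('a \<Rightarrow> real) set" where
  "cpos_le S B = {f. continuous_on S f \<and> (\<forall>x\<in>S. 0 \<le> f x \<and> f x \<le> B)}"

lemma cpos_le_imp_cpos: "f \<in> cpos_le S B \<Longrightarrow> f \<in> cpos S"
  by (auto simp: cpos_def cpos_le_def)

lemma cpos_imp_cpos_le:
  assumes "compact S" "f \<in> cpos S"
  obtains B where "0 < B" "f \<in> cpos_le S B"
proof -
  have "compact (f ` S)"
    using assms by (auto simp: cpos_def intro: compact_continuous_image)
  then obtain B where "0 < B" "\<forall>y\<in>f ` S. norm y \<le> B"
    using bounded_pos[of "f ` S"] compact_imp_bounded by blast
  with assms show ?thesis
    by (intro that[of B]) (auto simp: cpos_def cpos_le_def)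
qed

lemma open_superlevel:
  fixes f :: "'a::topological_space \<Rightarrow> real"
  assumes "continuous_on S f"
  obtains G where "open G" "G \<inter> S = {x\<in>S. c < f x}"
proof -
  obtain A where "open A" "A \<inter> S = f -` {c<..} \<inter> S"
    using assms open_greaterThan[of c] unfolding continuous_on_open_invariant by blast
  then show ?thesis
    by (intro that[of A]) auto
qed

lemma Urysohn_unit:
  assumes "closed A" "closed B" "A \<inter> B = {}"
  obtains f :: "'a::euclidean_space \<Rightarrow> real"
    where "continuous_on UNIV f" "\<And>x. 0 \<le> f x" "\<And>x. f x \<le> 1"
      "\<And>x. x \<in> A \<Longrightarrow> f x = 0" "\<And>x. x \<in> B \<Longrightarrow> f x = 1"
proof -
  obtain f :: "'a \<Rightarrow> real" where f: "continuous_on UNIV f" "\<And>x. f x \<in> closed_segment 0 1"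
    "\<And>x. x \<in> A \<Longrightarrow> f x = 0" "\<And>x. x \<in> B \<Longrightarrow> f x = 1"
    using Urysohn[OF assms, of 0 "1::real"] by blast
  then show ?thesis
    by (intro that[of f]) (auto simp: closed_segment_eq_real_ivl)
qed

section \<open>Regularity and Lusin's theorem\<close>

lemma sets_on_iff:
  assumes "sets M = sets (restrict_space borel S)" "closed (S :: 'a::topological_space set)"
  shows "A \<in> sets M \<longleftrightarrow> A \<in> sets borel \<and> A \<subseteq> S"
  using assms by (auto simp: sets_restrict_space_iff)

lemma
  fixes S :: "'a::euclidean_space set"
  assumes M: "sets M = sets (restrict_space borel S)" and S: "closed S" and fin: "finite_measure M"
    and A: "A \<in> sets M" and e: "0 < e"
  shows outer_regular_on: "\<exists>G. open G \<and> A \<subseteq> G \<and> measure M (G \<inter> S) < measure M A + e"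
    and inner_regular_on: "\<exists>C. compact C \<and> C \<subseteq> A \<and> measure M A < measure M C + e"
proof -
  interpret finite_measure M by fact
  have sp: "space M = S"
    using sets_eq_imp_space_eq[OF M] by (simp add: space_restrict_space)
  \<comment> \<open>The image of \<open>M\<close> under the inclusion is a finite measure on all
    Borel sets, to which the regularity theorems for \<open>borel\<close> apply.\<close>
  define N where "N = distr M borel (\<lambda>x. x)"
  have meas: "(\<lambda>x. x) \<in> measurable M borel"
    by (subst measurable_cong_sets[OF M refl], rule measurable_restrict_space1) auto
  have N: "sets N = sets borel" "emeasure N X = emeasure M (X \<inter> S)" if "X \<in> sets borel" for X
    unfolding N_def using that meas by (auto simp: emeasure_distr sp)
  have Nfin: "emeasure N (space N) \<noteq> \<infinity>"
    using N(2)[of UNIV] emeasure_finite sp by (simp add: N_def)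
  have AB: "A \<in> sets borel" "A \<subseteq> S"
    using A sets_on_iff[OF M S] by auto
  then have NA: "emeasure N A = ennreal (measure M A)"
    using N(2)[of A] by (simp add: Int_absorb2 emeasure_eq_measure)
  have GS: "G \<inter> S \<in> sets M" if "G \<in> sets borel" for G
    using that S unfolding sets_on_iff[OF M S] by auto
  have "emeasure N A < ennreal (measure M A + e)"
    using NA e by (simp add: ennreal_lessI)
  then have "(INF U\<in>{U. A \<subseteq> U \<and> open U}. emeasure N U) < ennreal (measure M A + e)"
    using outer_regular[OF _ Nfin AB(1)] N(1)[of "{}"] by simp
  then obtain G where "open G" "A \<subseteq> G" "emeasure N G < ennreal (measure M A + e)"
    unfolding INF_less_iff by blast
  then show "\<exists>G. open G \<and> A \<subseteq> G \<and> measure M (G \<inter> S) < measure M A + e"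
    using N(2)[of G] by (intro exI[of _ G]) (auto simp: emeasure_eq_measure ennreal_less_iff)
  show "\<exists>C. compact C \<and> C \<subseteq> A \<and> measure M A < measure M C + e"
  \<comment> \<open>For \<open>measure M A < e\<close>, \<open>ennreal\<close> would cut the
    negative number \<open>measure M A - e\<close> off at 0; the empty set is then a
    witness.\<close>
  proof (cases "measure M A < e")
    case True
    then show ?thesis by (intro exI[of _ "{}"]) auto
  next
    case False
    then have "ennreal (measure M A - e) < emeasure N A"
      using NA e by (simp add: ennreal_less_iff)
    then have "ennreal (measure M A - e) < (SUP K\<in>{K. K \<subseteq> A \<and> compact K}. emeasure N K)"
      using inner_regular[OF _ Nfin AB(1)] N(1)[of "{}"] by simp
    then obtain C where C: "compact C" "C \<subseteq> A" "ennreal (measure M A - e) < emeasure N C"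
      unfolding less_SUP_iff by blast
    then have "C \<in> sets borel" "C \<subseteq> S" using AB by (auto intro: borel_compact)
    then show ?thesis
      using N(2)[of C] C False
      by (intro exI[of _ C]) (auto simp: emeasure_eq_measure ennreal_less_iff Int_absorb2)
  qed
qed

text \<open>The preimages \<open>P j\<close> of rational intervals under all the \<open>F i\<close>
  are countably many. Each is enlarged to an open \<open>G j\<close> with little excess; off the
  union \<open>D\<close> of the excesses, \<open>P j\<close> and \<open>G j\<close> agree, so these
  preimages become relatively open. A whole sequence is treated at once because
  \<open>ext_uniform_limit\<close> needs a sequence and its limit continuous on one compact
  set.\<close>

lemma Lusin:
  fixes F :: "nat \<Rightarrow> 'a::euclidean_space \<Rightarrow> real"
  assumes M: "sets M = sets (restrict_space borel S)" and S: "closed S" and fin: "finite_measure M"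
    and F: "\<And>i. F i \<in> borel_measurable M" and e: "0 < e"
  obtains C where "compact C" "C \<subseteq> S" "\<And>i. continuous_on C (F i)" "measure M (S - C) < e"
proof -
  interpret finite_measure M by fact
  have sp: "space M = S"
    using sets_eq_imp_space_eq[OF M] by (simp add: space_restrict_space)
  define P where "P j = (case from_nat j of (i, q, r) \<Rightarrow> {x\<in>S. real_of_rat q < F i x \<and> F i x < real_of_rat r})"
    for j :: nat
  have P: "P j \<in> sets M" for j
  proof -
    obtain i q r where iqr: "from_nat j = (i :: nat, q :: rat, r :: rat)" by (metis prod_cases3)
    have "{x\<in>space M. real_of_rat q < F i x \<and> F i x < real_of_rat r} \<in> sets M"
      using F[of i] by measurable
    then show ?thesis unfolding P_def iqr sp by simp
  qed
  \<comment> \<open>The excesses add up to \<open>e / 2\<close>; the other half of \<open>e\<close>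
    pays for the compact set inside \<open>S - D\<close>.\<close>
  have "\<forall>j. \<exists>G. open G \<and> P j \<subseteq> G \<and> measure M (G \<inter> S) < measure M (P j) + e / 2 * (1/2) ^ Suc j"
    using outer_regular_on[OF M S fin P] e by simp
  then obtain G where G: "\<And>j. open (G j)" "\<And>j. P j \<subseteq> G j"
    "\<And>j. measure M (G j \<inter> S) < measure M (P j) + e / 2 * (1/2) ^ Suc j"
    by metis
  have GS: "G j \<inter> S \<in> sets M" for j
    using G(1) S unfolding sets_on_iff[OF M S] by auto
  define D where "D = (\<Union>j. G j \<inter> S - P j)"
  have DM: "D \<in> sets M" unfolding D_def using GS P by auto
  have m: "measure M (G j \<inter> S - P j) \<le> e / 2 * (1/2) ^ Suc j" for j
  proof -
    have "P j \<subseteq> G j \<inter> S" using G(2) P sets.sets_into_space sp by blast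
    then have "measure M (G j \<inter> S - P j) = measure M (G j \<inter> S) - measure M (P j)"
      using GS P by (intro finite_measure_Diff) auto
    with G(3)[of j] show ?thesis by linarith
  qed
  have sums: "(\<lambda>j. e / 2 * (1/2::real) ^ Suc j) sums (e / 2)"
    using sums_mult[OF power_half_series, of "e/2"] by simp
  have summ: "summable (\<lambda>j. measure M (G j \<inter> S - P j))"
    by (rule summable_comparison_test_ev[OF _ sums_summable[OF sums]]) (use m in auto)
  have "measure M D \<le> (\<Sum>j. measure M (G j \<inter> S - P j))"
    unfolding D_def using GS P summ by (intro finite_measure_subadditive_countably) auto
  also have "\<dots> \<le> (\<Sum>j. e / 2 * (1/2) ^ Suc j)"
    by (rule suminf_le[OF m summ sums_summable[OF sums]])
  finally have D: "measure M D \<le> e / 2"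
    using sums_unique[OF sums] by simp
  have SM: "S \<in> sets M" using sets.top[of M] sp by simp
  obtain C where C: "compact C" "C \<subseteq> S - D" "measure M (S - D) < measure M C + e / 2"
    using inner_regular_on[OF M S fin, of "S - D" "e / 2"] DM SM e by auto
  have CM: "C \<in> sets M" using C unfolding sets_on_iff[OF M S] by (auto intro: borel_compact)
  have "measure M (S - C) = measure M S - measure M C"
    using SM CM C(2) by (intro finite_measure_Diff) auto
  moreover have "measure M (S - D) = measure M S - measure M D"
    using SM DM sets.sets_into_space[OF DM] sp by (intro finite_measure_Diff) auto
  ultimately have mC: "measure M (S - C) < e" using C(3) D by linarith
  have cont: "continuous_on C (F i)" for i
    unfolding continuous_on_topological
  proof (intro ballI allI impI)
    fix x B assume x: "x \<in> C" "open B" "F i x \<in> B"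
    then obtain d where d: "0 < d" "ball (F i x) d \<subseteq> B" using openE by blast
    obtain q where q: "F i x - d < real_of_rat q" "real_of_rat q < F i x"
      using of_rat_dense[of "F i x - d" "F i x"] d by auto
    obtain r where r: "F i x < real_of_rat r" "real_of_rat r < F i x + d"
      using of_rat_dense[of "F i x" "F i x + d"] d by auto
    define j where "j = to_nat (i, q, r)"
    have Pj: "P j = {x\<in>S. real_of_rat q < F i x \<and> F i x < real_of_rat r}"
      unfolding P_def j_def by simp
    have xP: "x \<in> P j" using x C q r unfolding Pj by auto
    have "F i y \<in> B" if "y \<in> C" "y \<in> G j" for y
    proof -
      have "y \<in> P j" using that C(2) unfolding D_def by auto
      then have "F i y \<in> ball (F i x) d"
        unfolding Pj using q r by (auto simp: dist_real_def)
      with d show ?thesis by auto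
    qed
    with G(1,2)[of j] xP show "\<exists>A. open A \<and> x \<in> A \<and> (\<forall>y\<in>C. y \<in> A \<longrightarrow> F i y \<in> B)" by blast
  qed
  from that[OF C(1) _ cont mC] C(2) show ?thesis by blast
qed

section \<open>Measures generated by functionals on continuous functions\<close>

text \<open>The cap \<open>B\<close> keeps the supremum finite for a valuation, whose values over
  all heights are unbounded in general. \<open>G\<close> lives in the ambient space, and only its
  trace on \<open>S\<close> matters.\<close>

definition content_of :: "'a::topological_space set \<Rightarrow> (('a \<Rightarrow> real) \<Rightarrow> real) \<Rightarrow> real \<Rightarrow> 'a set \<Rightarrow> ennreal" where
  "content_of S \<Psi> B G = (SUP f\<in>{f \<in> cpos_le S B. \<forall>x\<in>S - G. f x = 0}. ennreal (\<Psi> f))"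

text \<open>What positive additive functionals, for Riesz' theorem, and valuations have in common.
  \<open>truncate\<close> allows supports to be shrunk to compact sets.\<close>

locale sup_functional =
  fixes S :: "'a::euclidean_space set" and \<Psi> :: "('a \<Rightarrow> real) \<Rightarrow> real"
  assumes compact: "compact S"
    and cong: "(\<And>x. x \<in> S \<Longrightarrow> f x = g x) \<Longrightarrow> \<Psi> f = \<Psi> g"
    and zero: "\<Psi> (\<lambda>x. 0) = 0"
    and nonneg: "f \<in> cpos S \<Longrightarrow> 0 \<le> \<Psi> f"
    and max_le: "f \<in> cpos S \<Longrightarrow> g \<in> cpos S \<Longrightarrow> \<Psi> (\<lambda>x. max (f x) (g x)) \<le> \<Psi> f + \<Psi> g"
    and disjoint: "f \<in> cpos S \<Longrightarrow> g \<in> cpos S \<Longrightarrow> (\<And>x. x \<in> S \<Longrightarrow> min (f x) (g x) = 0) \<Longrightarrow>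
      \<Psi> f + \<Psi> g \<le> \<Psi> (\<lambda>x. max (f x) (g x))"
    and truncate: "f \<in> cpos S \<Longrightarrow> 0 < e \<Longrightarrow> \<exists>d>0. \<Psi> f \<le> \<Psi> (\<lambda>x. max (f x - d) 0) + e"
begin

lemma content_upper:
  "f \<in> cpos_le S B \<Longrightarrow> (\<And>x. x \<in> S - G \<Longrightarrow> f x = 0) \<Longrightarrow> ennreal (\<Psi> f) \<le> content_of S \<Psi> B G"
  unfolding content_of_def by (rule SUP_upper) auto

lemma content_zero:
  assumes "G \<inter> S = {}"
  shows "content_of S \<Psi> B G = 0"
proof -
  have "\<Psi> f = 0" if "f \<in> cpos_le S B" "\<forall>x\<in>S - G. f x = 0" for f
    using cong[of f "\<lambda>x. 0"] that assms zero by auto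
  then show ?thesis
    unfolding content_of_def by (simp add: bot_ennreal[symmetric] SUP_eq_const)
qed

text \<open>A partition of unity with maxima in place of sums: cut-offs vanishing off
  \<open>G\<close> and off \<open>H\<close>, whose maximum is 1 on the set \<open>C\<close> outside
  which the truncated function vanishes. Then \<open>max_le\<close> splits its value.\<close>

lemma content_subadd:
  assumes G: "open G" and H: "open H"
  shows "content_of S \<Psi> B (G \<union> H) \<le> content_of S \<Psi> B G + content_of S \<Psi> B H"
  unfolding content_of_def[of S \<Psi> B "G \<union> H"]
proof (rule SUP_least)
  fix f assume "f \<in> {f \<in> cpos_le S B. \<forall>x\<in>S - (G \<union> H). f x = 0}"
  then have f: "f \<in> cpos_le S B" "\<And>x. x \<in> S - (G \<union> H) \<Longrightarrow> f x = 0" by auto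
  note fp = cpos_le_imp_cpos[OF f(1)]
  have fc: "continuous_on S f" using f(1) by (simp add: cpos_le_def)
  show "ennreal (\<Psi> f) \<le> content_of S \<Psi> B G + content_of S \<Psi> B H"
  proof (rule ennreal_le_epsilon)
    fix e :: real assume "0 < e"
    then obtain d where d: "0 < d" "\<Psi> f \<le> \<Psi> (\<lambda>x. max (f x - d) 0) + e"
      using truncate[OF fp] by blast
    define C where "C = {x\<in>S. d \<le> f x}"
    have Ccl: "closed C"
      unfolding C_def using compact_imp_closed[OF compact] fc
      by (intro continuous_on_closed_Collect_le) auto
    have C: "C \<subseteq> G \<union> H" "C \<subseteq> S" using f(2) d(1) unfolding C_def by force+
    obtain p :: "'a \<Rightarrow> real" where p: "continuous_on UNIV p" "\<And>x. 0 \<le> p x" "\<And>x. p x \<le> 1"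
      "\<And>x. x \<in> - G \<Longrightarrow> p x = 0" "\<And>x. x \<in> C - H \<Longrightarrow> p x = 1"
      using Urysohn_unit[of "- G" "C - H"] G H Ccl C by (metis Compl_disjoint2 Diff_subset_conv Int_commute closed_Compl closed_Diff disjoint_eq_subset_Compl sup_commute boolean_algebra_class.boolean_algebra.double_compl)
    \<comment> \<open>On \<open>C\<close>, the cut-off \<open>min 1 (2 * p x)\<close> is 1 where
      \<open>p x \<ge> 1/2\<close>. The part of \<open>C\<close> with \<open>p x \<le> 1/2\<close>
      avoids \<open>C - H\<close>, where \<open>p\<close> is 1, hence lies in \<open>H\<close>, and
      \<open>q\<close> is chosen to be 1 there.\<close>
    have "closed (C \<inter> {x. p x \<le> 1/2})"
      using p(1) Ccl by (intro closed_Int closed_Collect_le) auto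
    moreover have "- H \<inter> (C \<inter> {x. p x \<le> 1/2}) = {}" using p(5) by force
    ultimately obtain q :: "'a \<Rightarrow> real" where q: "continuous_on UNIV q" "\<And>x. 0 \<le> q x" "\<And>x. q x \<le> 1"
      "\<And>x. x \<in> - H \<Longrightarrow> q x = 0" "\<And>x. x \<in> C \<inter> {x. p x \<le> 1/2} \<Longrightarrow> q x = 1"
      using Urysohn_unit[of "- H" "C \<inter> {x. p x \<le> 1/2}"] H by auto
    define f1 where "f1 x = max (f x - d) 0 * min 1 (2 * p x)" for x
    define f2 where "f2 x = max (f x - d) 0 * q x" for x
    have cp: "continuous_on S p" "continuous_on S q"
      using p(1) q(1) continuous_on_subset by blast+
    have b: "0 \<le> max (f x - d) 0 * t \<and> max (f x - d) 0 * t \<le> B" if "x \<in> S" "0 \<le> t" "t \<le> 1" for x t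
    proof -
      have "0 \<le> f x" "f x \<le> B" using f(1) that by (auto simp: cpos_le_def)
      then have "max (f x - d) 0 * t \<le> B * 1" using d that by (intro mult_mono) auto
      with that show ?thesis by auto
    qed
    have f1: "f1 \<in> cpos_le S B"
      unfolding f1_def cpos_le_def using b p(2,3)
      by (auto intro!: continuous_intros fc cp)
    have f2: "f2 \<in> cpos_le S B"
      unfolding f2_def cpos_le_def using b q(2,3)
      by (auto intro!: continuous_intros fc cp)
    have "\<Psi> (\<lambda>x. max (f x - d) 0) = \<Psi> (\<lambda>x. max (f1 x) (f2 x))"
    proof (rule cong)
      fix x assume x: "x \<in> S"
      let ?t = "max (f x - d) 0"
      have le: "f1 x \<le> ?t" "f2 x \<le> ?t" unfolding f1_def f2_def
        using p(2)[of x] q(2,3)[of x] by (auto intro!: mult_left_le)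
      show "?t = max (f1 x) (f2 x)"
      proof (cases "x \<in> C")
        case True
        then show ?thesis using le q(5)[of x] unfolding f1_def f2_def
          by (cases "p x \<le> 1/2") (auto simp: min_def)
      next
        case False
        then show ?thesis using x unfolding C_def f1_def f2_def by auto
      qed
    qed
    also have "\<dots> \<le> \<Psi> f1 + \<Psi> f2"
      by (intro max_le cpos_le_imp_cpos[OF f1] cpos_le_imp_cpos[OF f2])
    finally have "\<Psi> f \<le> \<Psi> f1 + \<Psi> f2 + e" using d by linarith
    then have "ennreal (\<Psi> f) \<le> ennreal (\<Psi> f1 + \<Psi> f2 + e)" by (rule ennreal_leI)
    also have "\<dots> = ennreal (\<Psi> f1) + ennreal (\<Psi> f2) + ennreal e"
      using nonneg[OF cpos_le_imp_cpos[OF f1]] nonneg[OF cpos_le_imp_cpos[OF f2]] \<open>0 < e\<close>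
      by (simp add: ennreal_plus)
    also have "\<dots> \<le> content_of S \<Psi> B G + content_of S \<Psi> B H + ennreal e"
      using f1 f2 p(4) q(4) by (intro add_mono content_upper) (auto simp: f1_def f2_def)
    finally show "ennreal (\<Psi> f) \<le> content_of S \<Psi> B G + content_of S \<Psi> B H + ennreal e" .
  qed
qed

lemma content_superadd:
  assumes "G \<inter> H = {}"
  shows "content_of S \<Psi> B G + content_of S \<Psi> B H \<le> content_of S \<Psi> B (G \<union> H)"
\<comment> \<open>If no function is admissible, which happens for negative \<open>B\<close>, all
  contents are 0. Otherwise the index sets are nonempty, as needed to move sums through
  suprema.\<close>
proof (cases "\<exists>f. f \<in> cpos_le S B \<and> (\<forall>x\<in>S. f x = 0)")
  case False
  have E: "{f \<in> cpos_le S B. \<forall>x\<in>S - G. f x = 0} = {}" for G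
  proof -
    have "0 \<le> B" if "f \<in> cpos_le S B" "x \<in> S" for f x
      using that order_trans[of 0 "f x" B] by (auto simp: cpos_le_def)
    then have "(\<lambda>x. 0) \<in> cpos_le S B" if "f \<in> cpos_le S B" for f
      using that by (auto simp: cpos_le_def)
    with False show ?thesis by auto
  qed
  then show ?thesis by (simp only: content_of_def E) (simp add: bot_ennreal)
next
  case True
  then obtain z where z: "z \<in> cpos_le S B" "\<And>x. x \<in> S \<Longrightarrow> z x = 0" by blast
  then have ne: "{f \<in> cpos_le S B. \<forall>x\<in>S - G. f x = 0} \<noteq> {}" for G by auto
  have "ennreal (\<Psi> f) + ennreal (\<Psi> g) \<le> content_of S \<Psi> B (G \<union> H)"
    if f: "f \<in> cpos_le S B" "\<forall>x\<in>S - G. f x = 0" and g: "g \<in> cpos_le S B" "\<forall>x\<in>S - H. g x = 0" for f g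
  proof -
    note fp = cpos_le_imp_cpos[OF f(1)] and gp = cpos_le_imp_cpos[OF g(1)]
    have "min (f x) (g x) = 0" if "x \<in> S" for x
    proof -
      have "f x = 0 \<or> g x = 0" using that f(2) g(2) assms by blast
      moreover have "0 \<le> f x" "0 \<le> g x" using that fp gp by (auto simp: cpos_def)
      ultimately show ?thesis by auto
    qed
    then have "\<Psi> f + \<Psi> g \<le> \<Psi> (\<lambda>x. max (f x) (g x))"
      by (rule disjoint[OF fp gp])
    then have "ennreal (\<Psi> f) + ennreal (\<Psi> g) \<le> ennreal (\<Psi> (\<lambda>x. max (f x) (g x)))"
      unfolding ennreal_plus[OF nonneg[OF fp] nonneg[OF gp], symmetric] by (rule ennreal_leI)
    also have "\<dots> \<le> content_of S \<Psi> B (G \<union> H)"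
    proof (rule content_upper)
      show "(\<lambda>x. max (f x) (g x)) \<in> cpos_le S B"
        using f(1) g(1) by (auto simp: cpos_le_def le_max_iff_disj intro!: continuous_intros)
      show "max (f x) (g x) = 0" if "x \<in> S - (G \<union> H)" for x
        using f(2) g(2) that by auto
    qed
    finally show ?thesis .
  qed
  note * = this
  have "content_of S \<Psi> B G + content_of S \<Psi> B H =
    (SUP f\<in>{f \<in> cpos_le S B. \<forall>x\<in>S - G. f x = 0}. SUP g\<in>{g \<in> cpos_le S B. \<forall>x\<in>S - H. g x = 0}.
      ennreal (\<Psi> f) + ennreal (\<Psi> g))"
    unfolding content_of_def
    by (simp add: ennreal_SUP_add_left[OF ne, symmetric] ennreal_SUP_add_right[OF ne, symmetric])
  also have "\<dots> \<le> content_of S \<Psi> B (G \<union> H)"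
    by (intro SUP_least) (use * in auto)
  finally show ?thesis .
qed

text \<open>If \<open>f\<close> has a value above \<open>c\<close>, so has
  \<open>max (f - d) 0\<close> for some \<open>d > 0\<close>, and this function is admissible for
  every open set around the compact set \<open>{f \<ge> d}\<close>.\<close>

lemma content_inner:
  assumes G: "open G" and c: "c < content_of S \<Psi> B G"
  shows "\<exists>C. compact C \<and> C \<subseteq> G \<and> (\<forall>H. open H \<and> C \<subseteq> H \<longrightarrow> c < content_of S \<Psi> B H)"
proof -
  obtain f where f: "f \<in> cpos_le S B" "\<And>x. x \<in> S - G \<Longrightarrow> f x = 0" "c < ennreal (\<Psi> f)"
    using c unfolding content_of_def less_SUP_iff by auto
  note fp = cpos_le_imp_cpos[OF f(1)]
  have fc: "continuous_on S f" using f(1) by (simp add: cpos_le_def)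
  obtain c' where c': "c = ennreal c'" "0 \<le> c'"
    using f(3) by (cases c) auto
  then have "c' < \<Psi> f" using f(3) by (simp add: ennreal_less_iff)
  then obtain d where d: "0 < d" "\<Psi> f \<le> \<Psi> (\<lambda>x. max (f x - d) 0) + (\<Psi> f - c') / 2"
    using truncate[OF fp, of "(\<Psi> f - c') / 2"] by auto
  have lt: "c' < \<Psi> (\<lambda>x. max (f x - d) 0)"
    using d(2) \<open>c' < \<Psi> f\<close> by argo
  let ?C = "{x\<in>S. d \<le> f x}"
  have "closed ?C"
    using compact_imp_closed[OF compact] fc
    by (intro continuous_on_closed_Collect_le) auto
  then have "compact (S \<inter> ?C)"
    by (rule compact_Int_closed[OF compact])
  moreover have "S \<inter> ?C = ?C" by auto
  moreover have "?C \<subseteq> G" using f(2) d(1) by force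
  moreover have "c < content_of S \<Psi> B H" if "open H" "?C \<subseteq> H" for H
  proof -
    have "c < ennreal (\<Psi> (\<lambda>x. max (f x - d) 0))"
      using lt c' by (simp add: ennreal_less_iff)
    also have "\<dots> \<le> content_of S \<Psi> B H"
    proof (rule content_upper)
      show "(\<lambda>x. max (f x - d) 0) \<in> cpos_le S B"
        using f(1) d(1) unfolding cpos_le_def
        by (fastforce intro!: continuous_intros)
      show "max (f x - d) 0 = 0" if "x \<in> S - H" for x
        using that \<open>?C \<subseteq> H\<close> by auto
    qed
    finally show ?thesis .
  qed
  ultimately show ?thesis by (intro exI[of _ ?C]) auto
qed

lemma open_content: "open_content (content_of S \<Psi> B)"
proof
  show "content_of S \<Psi> B {} = 0" by (rule content_zero) simp
  show "content_of S \<Psi> B G \<le> content_of S \<Psi> B H" if "G \<subseteq> H" for G H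
    unfolding content_of_def using that by (intro SUP_subset_mono) auto
qed (use content_subadd content_superadd content_inner in auto)

lemma ex_measure:
  obtains M where "sets M = sets (restrict_space borel S)"
    "\<And>G. open G \<Longrightarrow> emeasure M (G \<inter> S) = content_of S \<Psi> B G"
proof -
  interpret open_content "content_of S \<Psi> B" by (rule open_content)
  show ?thesis
    using ex_measure_on[OF compact_imp_closed[OF compact] content_zero[of "- S"]] that by auto
qed

end

section \<open>The Riesz representation theorem\<close>

lemma ennreal_le_measure_iff: 
  assumes "finite_measure M" "0 \<le> a"
  shows "ennreal a \<le> emeasure M A \<longleftrightarrow> a \<le> measure M A"
proof -
  interpret finite_measure M by fact
  show ?thesis using assms(2) by (simp add: emeasure_eq_measure)
qed

text \<open>Slices of \<open>[0, x]\<close> of height 1, used to cut a function into horizontal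
  layers in the proof of Riesz' theorem.\<close>

lemma sum_clamp:
  fixes x :: real
  assumes "0 \<le> x"
  shows "(\<Sum>i<k. max 0 (min 1 (x - real i))) = min x (real k)"
proof (induction k)
  case (Suc k)
  then show ?case using assms by (auto simp: min_def max_def)
qed (use assms in simp)

text \<open>\<open>\<Phi>\<close> and the integral are compared layer by layer: for the unit layers
  \<open>u i\<close> of \<open>n f\<close> both values lie between the measures of
  \<open>{n f > i + 1}\<close> and \<open>{n f > i}\<close>. The differences telescope, so the error
  is at most \<open>measure M S / n\<close>.\<close>

lemma Riesz_representation_compact:
  fixes S :: "'a::euclidean_space set" and \<Phi> :: "('a \<Rightarrow> real) \<Rightarrow> real"
  assumes S: "compact S"
    and cong: "\<And>f g. (\<And>x. x \<in> S \<Longrightarrow> f x = g x) \<Longrightarrow> \<Phi> f = \<Phi> g"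
    and nonneg: "\<And>f. f \<in> cpos S \<Longrightarrow> 0 \<le> \<Phi> f"
    and add: "\<And>f g. f \<in> cpos S \<Longrightarrow> g \<in> cpos S \<Longrightarrow> \<Phi> (\<lambda>x. f x + g x) = \<Phi> f + \<Phi> g"
  obtains M where "sets M = sets (restrict_space borel S)" "finite_measure M"
    "\<And>f. f \<in> cpos S \<Longrightarrow> integral\<^sup>L M f = \<Phi> f"
proof -
  have zero: "\<Phi> (\<lambda>x. 0) = 0"
    using add[of "\<lambda>x. 0" "\<lambda>x. 0"] by (simp add: cpos_def)
  have mono: "\<Phi> f \<le> \<Phi> g" if f: "f \<in> cpos S" and g: "g \<in> cpos S" and le: "\<And>x. x \<in> S \<Longrightarrow> f x \<le> g x" for f g
  proof -
    have d: "(\<lambda>x. g x - f x) \<in> cpos S"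
      using f g le by (auto simp: cpos_def intro!: continuous_intros)
    have "\<Phi> g = \<Phi> (\<lambda>x. f x + (g x - f x))" by (rule cong) simp
    also have "\<dots> = \<Phi> f + \<Phi> (\<lambda>x. g x - f x)" by (rule add[OF f d])
    finally show ?thesis using nonneg[OF d] by simp
  qed
  have sum: "\<Phi> (\<lambda>x. \<Sum>i\<in>I. u i x) = (\<Sum>i\<in>I. \<Phi> (u i))" if "finite I" "\<And>i. i \<in> I \<Longrightarrow> u i \<in> cpos S"
    for I :: "nat set" and u
    using that
  proof (induction I rule: finite_induct)
    case (insert i I)
    have "(\<lambda>x. \<Sum>i\<in>I. u i x) \<in> cpos S"
      using insert(4) by (auto simp: cpos_def intro!: continuous_intros sum_nonneg)
    then show ?case using insert by (simp add: add)
  qed (simp add: zero)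
  \<comment> \<open>Additivity alone yields homogeneity for natural factors; it also makes
    \<open>\<Phi>\<close> small on small constants.\<close>
  have scale: "\<Phi> f = real n * \<Phi> (\<lambda>x. f x / real n)" if f: "f \<in> cpos S" and n: "0 < n" for f n
  proof -
    have "\<Phi> f = \<Phi> (\<lambda>x. \<Sum>i<n. f x / real n)" using n by (intro cong) simp
    also have "\<dots> = (\<Sum>i<n. \<Phi> (\<lambda>x. f x / real n))"
      using f by (intro sum) (auto simp: cpos_def intro!: continuous_intros)
    finally show ?thesis by simp
  qed
  interpret sup_functional S \<Phi>
  proof
    show "\<Phi> f = \<Phi> g" if "\<And>x. x \<in> S \<Longrightarrow> f x = g x" for f g using cong that by blast
    fix f g assume f: "f \<in> cpos S" and g: "g \<in> cpos S"
    have m: "(\<lambda>x. max (f x) (g x)) \<in> cpos S" "(\<lambda>x. f x + g x) \<in> cpos S"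
      using f g by (auto simp: cpos_def le_max_iff_disj intro!: continuous_intros)
    then have "\<Phi> (\<lambda>x. max (f x) (g x)) \<le> \<Phi> (\<lambda>x. f x + g x)"
      using f g by (intro mono) (auto simp: cpos_def)
    then show "\<Phi> (\<lambda>x. max (f x) (g x)) \<le> \<Phi> f + \<Phi> g" using add[OF f g] by simp
    assume "\<And>x. x \<in> S \<Longrightarrow> min (f x) (g x) = 0"
    then have "\<Phi> (\<lambda>x. f x + g x) = \<Phi> (\<lambda>x. max (f x) (g x))"
      by (intro cong) (metis add.commute add_0 max_def min_def)
    then show "\<Phi> f + \<Phi> g \<le> \<Phi> (\<lambda>x. max (f x) (g x))" using add[OF f g] by simp
  next
    fix f and e :: real assume f: "f \<in> cpos S" and e: "0 < e"
    have one: "(\<lambda>x. 1) \<in> cpos S" by (simp add: cpos_def)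
    \<comment> \<open>With this \<open>n\<close> the constant \<open>1 / n\<close> has a value of at
      most \<open>e\<close>, so cutting off \<open>1 / n\<close> costs at most
      \<open>e\<close>.\<close>
    obtain n :: nat where n: "\<Phi> (\<lambda>x. 1) / e < real n" using reals_Archimedean2 by blast
    moreover have "0 \<le> \<Phi> (\<lambda>x. 1) / e" using e nonneg[OF one] by simp
    ultimately have n0: "0 < n" by linarith
    let ?d = "1 / real n"
    have 1: "(\<lambda>x. max (f x - ?d) 0) \<in> cpos S" "(\<lambda>x. ?d) \<in> cpos S"
      using f by (auto simp: cpos_def intro!: continuous_intros)
    have "\<Phi> f \<le> \<Phi> (\<lambda>x. max (f x - ?d) 0 + ?d)"
      using f by (intro mono) (auto simp: cpos_def le_max_iff_disj intro!: continuous_intros)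
    also have "\<dots> = \<Phi> (\<lambda>x. max (f x - ?d) 0) + \<Phi> (\<lambda>x. ?d)" by (rule add[OF 1])
    also have "\<Phi> (\<lambda>x. ?d) \<le> e"
      using scale[OF one n0] n n0 e by (simp add: field_simps)
    finally show "\<exists>d>0. \<Phi> f \<le> \<Phi> (\<lambda>x. max (f x - d) 0) + e"
      using n0 by (intro exI[of _ ?d]) auto
  qed (use S zero nonneg in auto)
  obtain M where M: "sets M = sets (restrict_space borel S)"
    "\<And>G. open G \<Longrightarrow> emeasure M (G \<inter> S) = content_of S \<Phi> 1 G"
    using ex_measure by blast
  have sp: "space M = S"
    using sets_eq_imp_space_eq[OF M(1)] by (simp add: space_restrict_space)
  have one: "(\<lambda>x. 1) \<in> cpos S" by (simp add: cpos_def)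
  have "emeasure M (space M) = content_of S \<Phi> 1 UNIV"
    using M(2)[of UNIV] sp by simp
  also have "\<dots> \<le> ennreal (\<Phi> (\<lambda>x. 1))"
    unfolding content_of_def using one
    by (intro SUP_least ennreal_leI mono) (auto simp: cpos_le_def cpos_def)
  finally have fin: "finite_measure M"
    by (intro finite_measureI) (auto simp: top_unique)
  interpret finite_measure M by (rule fin)
  have upper: "\<Phi> u \<le> measure M {x\<in>S. c < v x}"
    if u: "u \<in> cpos_le S 1" and v: "continuous_on S v" and z: "\<And>x. x \<in> S \<Longrightarrow> v x \<le> c \<Longrightarrow> u x = 0" for u and v :: "'a \<Rightarrow> real" and c
  proof -
    obtain G where G: "open G" "G \<inter> S = {x\<in>S. c < v x}"
      by (rule open_superlevel[OF v])
    have "u x = 0" if "x \<in> S - G" for x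
    proof -
      have "x \<notin> {x\<in>S. c < v x}" using that G(2) by blast
      then show ?thesis using z that by auto
    qed
    then have "ennreal (\<Phi> u) \<le> emeasure M (G \<inter> S)"
      unfolding M(2)[OF G(1)] using u by (intro content_upper) auto
    then show ?thesis
      unfolding G(2) using ennreal_le_measure_iff[OF fin nonneg[OF cpos_le_imp_cpos[OF u]]] by blast
  qed
  have lower: "measure M {x\<in>S. c < v x} \<le> \<Phi> u"
    if u: "u \<in> cpos_le S 1" and v: "continuous_on S v" and z: "\<And>x. x \<in> S \<Longrightarrow> c < v x \<Longrightarrow> u x = 1" for u and v :: "'a \<Rightarrow> real" and c
  proof -
    obtain G where G: "open G" "G \<inter> S = {x\<in>S. c < v x}"
      by (rule open_superlevel[OF v])
    have "emeasure M (G \<inter> S) \<le> ennreal (\<Phi> u)"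
      unfolding M(2)[OF G(1)] content_of_def
    proof (rule SUP_least)
      fix f assume f: "f \<in> {f \<in> cpos_le S 1. \<forall>x\<in>S - G. f x = 0}"
      have "f x \<le> u x" if "x \<in> S" for x
      proof (cases "x \<in> G")
        case True
        then have "x \<in> {x\<in>S. c < v x}" using that G(2) by blast
        then show ?thesis using f z that by (auto simp: cpos_le_def)
      next
        case False
        then show ?thesis using f u that by (auto simp: cpos_le_def)
      qed
      then show "ennreal (\<Phi> f) \<le> ennreal (\<Phi> u)"
        using f u by (intro ennreal_leI mono) (auto intro: cpos_le_imp_cpos)
    qed
    then show ?thesis
      unfolding G(2) using nonneg[OF cpos_le_imp_cpos[OF u]] by (simp add: emeasure_eq_measure)
  qed
  have meas: "f \<in> borel_measurable M" if "continuous_on S f" for f :: "'a \<Rightarrow> real"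
    unfolding measurable_cong_sets[OF M(1) refl] by (rule borel_measurable_continuous_on_restrict[OF that])
  have "integral\<^sup>L M f = \<Phi> f" if f: "f \<in> cpos S" for f
  proof -
    have fc: "continuous_on S f" using f by (simp add: cpos_def)
    obtain B where B: "0 < B" "f \<in> cpos_le S B" using cpos_imp_cpos_le[OF S f] by blast
    \<comment> \<open>Since \<open>n f \<le> n N\<close>, the first \<open>n * N\<close> unit layers
      exhaust \<open>n f\<close>.\<close>
    obtain N :: nat where N: "B \<le> real N" using real_arch_simple by blast
    have est: "\<bar>\<Phi> f - integral\<^sup>L M f\<bar> \<le> measure M S / real n" if n: "0 < n" for n :: nat
    proof -
      define u where "u i x = max 0 (min 1 (real n * f x - real i))" for i x
      define a where "a i = measure M {x\<in>S. real i < real n * f x}" for i :: nat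
      have nf: "continuous_on S (\<lambda>x. real n * f x)" by (intro continuous_intros fc)
      have u: "u i \<in> cpos_le S 1" for i
        unfolding u_def cpos_le_def by (auto intro!: continuous_intros fc)
      note up = cpos_le_imp_cpos[OF u]
      have \<Phi>u: "a (Suc i) \<le> \<Phi> (u i)" "\<Phi> (u i) \<le> a i" for i
        unfolding a_def by (rule lower[OF u nf] upper[OF u nf]; simp add: u_def)+
      have um: "u i \<in> borel_measurable M" for i
        using u[of i] by (intro meas) (simp add: cpos_le_def)
      have ui: "integrable M (u i)" for i
        by (rule integrable_const_bound[of _ 1]) (use um u sp in \<open>auto simp: cpos_le_def\<close>)
      have am: "{x\<in>S. real i < real n * f x} \<in> sets M" for i
        using borel_measurable_less[OF borel_measurable_const meas[OF nf], of "real i"] sp by simp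
      have Iu: "a (Suc i) \<le> integral\<^sup>L M (u i)" "integral\<^sup>L M (u i) \<le> a i" for i
      proof -
        have "a (Suc i) = (\<integral>x. indicator {x\<in>S. real (Suc i) < real n * f x} x \<partial>M)"
          unfolding a_def using am[of "Suc i"] sp by (simp add: Int_absorb2 Collect_restrict)
        also have "\<dots> \<le> integral\<^sup>L M (u i)"
          by (intro integral_mono ui integrable_real_indicator am)
             (auto simp: u_def indicator_def emeasure_finite less_top[symmetric])
        finally show "a (Suc i) \<le> integral\<^sup>L M (u i)" .
        have "integral\<^sup>L M (u i) \<le> (\<integral>x. indicator {x\<in>S. real i < real n * f x} x \<partial>M)"
          by (intro integral_mono ui integrable_real_indicator am)
             (auto simp: u_def indicator_def emeasure_finite less_top[symmetric] sp)
        also have "\<dots> = a i"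
          unfolding a_def using am[of i] sp by (simp add: Int_absorb2 Collect_restrict)
        finally show "integral\<^sup>L M (u i) \<le> a i" .
      qed
      have fu: "real n * f x = (\<Sum>i<n * N. u i x)" if "x \<in> S" for x
      proof -
        have "0 \<le> f x" "f x \<le> real N" using B N that by (auto simp: cpos_le_def)
        then show ?thesis
          unfolding u_def using sum_clamp[of "real n * f x" "n * N"] by (simp add: mult_left_mono min_absorb1)
      qed
      have "real n * \<Phi> f = \<Phi> (\<lambda>x. real n * f x)"
        using scale[of "\<lambda>x. real n * f x" n] n f by (simp add: cpos_def continuous_intros)
      also have "\<dots> = \<Phi> (\<lambda>x. \<Sum>i<n * N. u i x)" by (rule cong) (rule fu)
      also have "\<dots> = (\<Sum>i<n * N. \<Phi> (u i))" by (rule sum) (use up in auto)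
      finally have 1: "real n * \<Phi> f = (\<Sum>i<n * N. \<Phi> (u i))" .
      have "real n * integral\<^sup>L M f = (\<integral>x. real n * f x \<partial>M)" by simp
      also have "\<dots> = (\<integral>x. (\<Sum>i<n * N. u i x) \<partial>M)"
        by (rule Bochner_Integration.integral_cong) (use fu sp in auto)
      also have "\<dots> = (\<Sum>i<n * N. integral\<^sup>L M (u i))" by (rule Bochner_Integration.integral_sum) (rule ui)
      finally have 2: "real n * integral\<^sup>L M f = (\<Sum>i<n * N. integral\<^sup>L M (u i))" .
      have "real n * \<bar>\<Phi> f - integral\<^sup>L M f\<bar> = \<bar>\<Sum>i<n * N. \<Phi> (u i) - integral\<^sup>L M (u i)\<bar>"
        unfolding sum_subtractf 1[symmetric] 2[symmetric] by (simp add: abs_mult flip: right_diff_distrib)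
      also have "\<dots> \<le> (\<Sum>i<n * N. \<bar>\<Phi> (u i) - integral\<^sup>L M (u i)\<bar>)" by (rule sum_abs)
      also have "\<dots> \<le> (\<Sum>i<n * N. a i - a (Suc i))"
        by (rule sum_mono) (use \<Phi>u Iu in \<open>smt (verit)\<close>)
      also have "\<dots> = a 0 - a (n * N)" by (rule sum_lessThan_telescope')
      also have "\<dots> \<le> measure M S"
        using bounded_measure[of "{x\<in>S. real 0 < real n * f x}"] sp unfolding a_def
        by (smt (verit) measure_nonneg)
      finally show ?thesis using n by (simp add: field_simps)
    qed
    have "(\<lambda>n. measure M S / real (Suc n)) \<longlonglongrightarrow> 0"
      using LIMSEQ_Suc[OF lim_const_over_n] by auto
    moreover have "\<forall>n. \<bar>\<Phi> f - integral\<^sup>L M f\<bar> \<le> measure M S / real (Suc n)" using est by blast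
    ultimately have "\<bar>\<Phi> f - integral\<^sup>L M f\<bar> \<le> 0"
      by (intro LIMSEQ_le_const) auto
    then show ?thesis by simp
  qed
  with that M(1) fin show ?thesis by blast
qed

section \<open>Continuous valuations on non-negative continuous functions\<close>

locale valuation_functional =
  fixes S :: "'a::euclidean_space set" and V :: "('a \<Rightarrow> real) \<Rightarrow> real"
  assumes compact: "compact S"
    and cong: "(\<And>x. x \<in> S \<Longrightarrow> f x = g x) \<Longrightarrow> V f = V g"
    and zero: "V (\<lambda>x. 0) = 0"
    and nonneg: "f \<in> cpos S \<Longrightarrow> 0 \<le> V f"
    and max_min: "f \<in> cpos S \<Longrightarrow> g \<in> cpos S \<Longrightarrow>
      V (\<lambda>x. max (f x) (g x)) + V (\<lambda>x. min (f x) (g x)) = V f + V g"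
    and cont: "f \<in> cpos S \<Longrightarrow> 0 < e \<Longrightarrow>
      \<exists>d>0. \<forall>g\<in>cpos S. (\<forall>x\<in>S. \<bar>g x - f x\<bar> < d) \<longrightarrow> \<bar>V g - V f\<bar> < e"
begin

sublocale sup_functional S V
proof
  fix f g assume fg: "f \<in> cpos S" "g \<in> cpos S"
  have "(\<lambda>x. min (f x) (g x)) \<in> cpos S"
    using fg by (auto simp: cpos_def intro!: continuous_intros)
  from nonneg[OF this] show "V (\<lambda>x. max (f x) (g x)) \<le> V f + V g"
    using max_min[OF fg] by linarith
  assume "\<And>x. x \<in> S \<Longrightarrow> min (f x) (g x) = 0"
  then have "V (\<lambda>x. min (f x) (g x)) = V (\<lambda>x. 0)" by (rule cong)
  then show "V f + V g \<le> V (\<lambda>x. max (f x) (g x))"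
    using max_min[OF fg] zero by linarith
next
  fix f and e :: real assume f: "f \<in> cpos S" and "0 < e"
  then obtain d where d: "0 < d" "\<And>g. g \<in> cpos S \<Longrightarrow> (\<forall>x\<in>S. \<bar>g x - f x\<bar> < d) \<Longrightarrow> \<bar>V g - V f\<bar> < e"
    using cont by metis
  have "\<bar>V (\<lambda>x. max (f x - d / 2) 0) - V f\<bar> < e"
  proof (rule d(2))
    show "(\<lambda>x. max (f x - d / 2) 0) \<in> cpos S"
      using f by (auto simp: cpos_def intro!: continuous_intros)
    show "\<forall>x\<in>S. \<bar>max (f x - d / 2) 0 - f x\<bar> < d"
      using f d(1) by (auto simp: cpos_def max_def)
  qed
  then show "\<exists>d>0. V f \<le> V (\<lambda>x. max (f x - d) 0) + e"
    using d(1) by (intro exI[of _ "d / 2"]) auto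
qed (use compact cong zero nonneg in blast)+

text \<open>Cutting a function at a level splits its value into two, so bounds on adjacent layers of
  functions add up; continuity at the constants bounds thin layers.\<close>

lemma bounded_on_layers:
  assumes "0 \<le> B"
  shows "\<exists>c. \<forall>f\<in>cpos_le S B. V f \<le> c"
proof -
  define P where "P a b \<longleftrightarrow> (\<exists>c. \<forall>f. continuous_on S f \<longrightarrow> (\<forall>x\<in>S. a \<le> f x \<and> f x \<le> b) \<longrightarrow> V f \<le> c)" for a b
  from assms have "0 \<le> (0::real) \<longrightarrow> P 0 B"
  \<comment> \<open>The local case of \<open>Bolzano\<close> also offers intervals reaching below 0,
    where \<open>P a b\<close> would concern functions with negative values; the guard
    \<open>0 \<le> a\<close> discards them.\<close>
  proof (induction rule: Bolzano[where P = "\<lambda>a b. 0 \<le> a \<longrightarrow> P a b"])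
    case (trans a b c)
    show ?case
    proof
      assume a: "0 \<le> a"
      with trans have "P a b" "P b c" by auto
      then obtain c1 c2 where
        c1: "\<And>f. continuous_on S f \<Longrightarrow> (\<forall>x\<in>S. a \<le> f x \<and> f x \<le> b) \<Longrightarrow> V f \<le> c1" and
        c2: "\<And>f. continuous_on S f \<Longrightarrow> (\<forall>x\<in>S. b \<le> f x \<and> f x \<le> c) \<Longrightarrow> V f \<le> c2"
        unfolding P_def by blast
      have "V f \<le> c1 + c2" if f: "continuous_on S f" "\<forall>x\<in>S. a \<le> f x \<and> f x \<le> c" for f
      proof -
        have "0 \<le> f x" if "x \<in> S" for x using f(2) a that by (meson order_trans)
        then have fb: "f \<in> cpos S" "(\<lambda>x. b) \<in> cpos S" using f(1) a trans(3) by (auto simp: cpos_def)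
        have "V (\<lambda>x. min (f x) b) \<le> c1"
          using f trans by (intro c1) (auto intro!: continuous_intros)
        moreover have "V (\<lambda>x. max (f x) b) \<le> c2"
          using f trans by (intro c2) (auto intro!: continuous_intros)
        ultimately show ?thesis using max_min[OF fb] nonneg[OF fb(2)] by linarith
      qed
      then show "P a c" unfolding P_def by blast
    qed
  next
    case (local t)
    then have t: "(\<lambda>x. t) \<in> cpos S" by (auto simp: cpos_def)
    obtain d where d: "0 < d" "\<And>g. g \<in> cpos S \<Longrightarrow> (\<forall>x\<in>S. \<bar>g x - t\<bar> < d) \<Longrightarrow> \<bar>V g - V (\<lambda>x. t)\<bar> < 1"
      using cont[OF t, of 1] by auto
    have "P a b" if "a \<le> t" "t \<le> b" "b - a < d" "0 \<le> a" for a b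
      unfolding P_def
    proof (intro exI allI impI)
      fix f assume f: "continuous_on S f" "\<forall>x\<in>S. a \<le> f x \<and> f x \<le> b"
      have "\<bar>f x - t\<bar> < d" if "x \<in> S" for x
        using f(2) that \<open>a \<le> t\<close> \<open>t \<le> b\<close> \<open>b - a < d\<close> by (smt (verit))
      moreover have "0 \<le> f x" if "x \<in> S" for x using f(2) \<open>0 \<le> a\<close> that by (meson order_trans)
      then have "f \<in> cpos S" using f(1) by (auto simp: cpos_def)
      ultimately show "V f \<le> V (\<lambda>x. t) + 1" using d(2)[of f] by (smt (verit))
    qed
    with d(1) show ?case by blast
  qed
  then show ?thesis unfolding P_def cpos_le_def by auto
qed

text \<open>Each height \<open>N\<close> has its own finite measure \<open>m N\<close>;
  \<open>\<mu>\<close> is their weighted sum, and dividing by the weight of the first natural height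
  above \<open>B\<close> leads to the factor \<open>b B\<close>.\<close>

lemma ex_control_measure:
  obtains \<mu> b where "sets \<mu> = sets (restrict_space borel S)" "finite_measure \<mu>"
    "\<And>B :: real. 0 \<le> b B" "mono b"
    "\<And>f B G. f \<in> cpos_le S B \<Longrightarrow> 0 \<le> B \<Longrightarrow> open G \<Longrightarrow> (\<And>x. x \<in> S - G \<Longrightarrow> f x = 0) \<Longrightarrow>
      V f \<le> b B * measure \<mu> (G \<inter> S)"
proof -
  have "\<exists>M. sets M = sets (restrict_space borel S) \<and>
      (\<forall>G. open G \<longrightarrow> emeasure M (G \<inter> S) = content_of S V (real N) G)" for N :: nat
    using ex_measure by metis
  then obtain m where m: "\<And>N. sets (m N) = sets (restrict_space borel S)"
    "\<And>N G. open G \<Longrightarrow> emeasure (m N) (G \<inter> S) = content_of S V (real N) G"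
    by metis
  have sp: "space (m N) = S" for N
    using sets_eq_imp_space_eq[OF m(1)] by (simp add: space_restrict_space)
  have fin: "finite_measure (m N)" for N
  proof -
    obtain c where c: "\<forall>f\<in>cpos_le S (real N). V f \<le> c" using bounded_on_layers[of "real N"] by auto
    have "emeasure (m N) (space (m N)) = content_of S V (real N) UNIV"
      using m(2)[of UNIV N] sp by simp
    also have "\<dots> \<le> ennreal c"
      unfolding content_of_def using c by (intro SUP_least ennreal_leI) auto
    finally show ?thesis by (intro finite_measureI) (auto simp: top_unique)
  qed
  \<comment> \<open>These weights give total mass at most 1; the summand 1 keeps the denominator
    positive.\<close>
  define w where "w N = (1/2) ^ Suc N / (1 + measure (m N) S)" for N
  have w: "0 < w N" "w N * measure (m N) S \<le> (1/2) ^ Suc N" for N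
  proof -
    have "0 \<le> measure (m N) S" by simp
    then have "0 < 1 + measure (m N) S" by linarith
    then show "0 < w N" unfolding w_def by (intro divide_pos_pos) auto
    show "w N * measure (m N) S \<le> (1/2) ^ Suc N"
      unfolding w_def using \<open>0 < 1 + measure (m N) S\<close>
      by (simp only: times_divide_eq_left pos_divide_le_eq) (simp add: field_simps)
  qed
  \<comment> \<open>The sum over \<open>N\<close> is written as an integral over counting measure,
    so that countable additivity is an interchange of a series with an integral.\<close>
  define E where "E A = (\<integral>\<^sup>+N. ennreal (w N) * emeasure (m N) A \<partial>count_space UNIV)" for A
  let ?B = "restrict_space borel S"
  define \<mu> where "\<mu> = measure_of S (sets ?B) E"
  have sB: "sets ?B \<subseteq> Pow S"
    by (metis sets.space_closed space_restrict_space2 space_restrict_space Int_UNIV_right Int_commute space_borel)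
  have spB: "space ?B = S" by (simp add: space_restrict_space)
  have sig: "sigma_algebra S (sets ?B)"
    using sets.sigma_algebra_axioms[of ?B] spB by simp
  have sets: "sets \<mu> = sets ?B"
    unfolding \<mu>_def using sB sig by (simp add: sigma_algebra.sigma_sets_eq)
  have emu: "emeasure \<mu> A = E A" if "A \<in> sets ?B" for A
    unfolding \<mu>_def
  proof (rule emeasure_measure_of_sigma[OF sig _ _ that])
    show "positive (sets ?B) E" by (auto simp: positive_def E_def)
    show "countably_additive (sets ?B) E"
    proof (rule countably_additiveI)
      fix A :: "nat \<Rightarrow> 'a set" assume A: "range A \<subseteq> sets ?B" "disjoint_family A"
      have "(\<Sum>i. E (A i)) = (\<integral>\<^sup>+N. (\<Sum>i. ennreal (w N) * emeasure (m N) (A i)) \<partial>count_space UNIV)"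
        unfolding E_def by (rule nn_integral_suminf[symmetric]) auto
      also have "\<dots> = E (\<Union>i. A i)"
        unfolding E_def using A m(1) by (simp add: ennreal_suminf_cmult suminf_emeasure)
      finally show "(\<Sum>i. E (A i)) = E (\<Union>i. A i)" .
    qed
  qed
  have SB: "S \<in> sets ?B" using sets.top[of ?B] spB by simp
  have "emeasure \<mu> S = (\<Sum>N. ennreal (w N) * emeasure (m N) S)"
    unfolding emu[OF SB] E_def by (rule nn_integral_count_space_nat)
  also have "\<dots> \<le> (\<Sum>N. ennreal ((1/2) ^ Suc N))"
  proof (intro suminf_le)
    fix N
    have "ennreal (w N) * emeasure (m N) S = ennreal (w N * measure (m N) S)"
      using w(1)[of N] finite_measure.emeasure_eq_measure[OF fin] by (simp add: ennreal_mult less_imp_le)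
    also have "\<dots> \<le> ennreal ((1/2) ^ Suc N)" by (intro ennreal_leI w)
    finally show "ennreal (w N) * emeasure (m N) S \<le> ennreal ((1/2) ^ Suc N)" .
  qed auto
  also have "\<dots> = ennreal 1"
    using power_half_series by (intro suminf_ennreal_eq) auto
  finally have fmu: "finite_measure \<mu>"
    using sets_eq_imp_space_eq[OF sets] spB by (intro finite_measureI) (auto simp: top_unique)
  interpret finite_measure \<mu> by (rule fmu)
  \<comment> \<open>Summing over all smaller heights, instead of taking the last term only, makes
    \<open>b\<close> monotone.\<close>
  define b where "b B = (\<Sum>i\<le>nat \<lceil>B\<rceil>. 1 / w i)" for B :: real
  have b: "0 \<le> b B" "1 / w (nat \<lceil>B\<rceil>) \<le> b B" for B
  proof -
    show "0 \<le> b B" unfolding b_def using w(1) by (auto intro!: sum_nonneg simp: less_imp_le)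
    show "1 / w (nat \<lceil>B\<rceil>) \<le> b B"
      unfolding b_def using w(1) by (intro member_le_sum) (auto simp: less_imp_le)
  qed
  have mono: "mono b"
  proof (rule monoI)
    fix x y :: real assume "x \<le> y"
    then have "{..nat \<lceil>x\<rceil>} \<subseteq> {..nat \<lceil>y\<rceil>}" by simp linarith
    then show "b x \<le> b y"
      unfolding b_def using w(1) by (intro sum_mono2) (auto simp: less_imp_le)
  qed
  have bound: "V f \<le> b B * measure \<mu> (G \<inter> S)"
    if f: "f \<in> cpos_le S B" and B: "0 \<le> B" and G: "open G" "\<And>x. x \<in> S - G \<Longrightarrow> f x = 0" for f B G
  proof -
    let ?N = "nat \<lceil>B\<rceil>"
    have GS: "G \<inter> S \<in> sets ?B" using G(1) by (auto simp: sets_restrict_space)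
    have "B \<le> real ?N" by linarith
    then have "f \<in> cpos_le S (real ?N)" using f unfolding cpos_le_def by (auto intro: order_trans)
    then have "ennreal (V f) \<le> emeasure (m ?N) (G \<inter> S)"
      unfolding m(2)[OF G(1)] by (rule content_upper) (rule G(2))
    then have "V f \<le> measure (m ?N) (G \<inter> S)"
      using ennreal_le_measure_iff[OF fin nonneg[OF cpos_le_imp_cpos[OF f]]] by blast
    moreover have "w ?N * measure (m ?N) (G \<inter> S) \<le> measure \<mu> (G \<inter> S)"
    proof -
      have "ennreal (w ?N * measure (m ?N) (G \<inter> S)) = ennreal (w ?N) * emeasure (m ?N) (G \<inter> S)"
        using w(1)[of ?N] finite_measure.emeasure_eq_measure[OF fin] by (simp add: ennreal_mult less_imp_le)
      also have "\<dots> \<le> emeasure \<mu> (G \<inter> S)"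
        unfolding emu[OF GS] E_def by (rule nn_integral_ge_point) simp
      finally show ?thesis
        by (simp add: emeasure_eq_measure)
    qed
    ultimately have "w ?N * V f \<le> measure \<mu> (G \<inter> S)"
      using w(1)[of ?N] by (meson less_imp_le mult_left_mono order_trans)
    then have "V f \<le> 1 / w ?N * measure \<mu> (G \<inter> S)"
      using w(1)[of ?N] by (simp add: pos_le_divide_eq mult.commute)
    also have "\<dots> \<le> b B * measure \<mu> (G \<inter> S)"
      by (intro mult_right_mono b) auto
    finally show ?thesis .
  qed
  show ?thesis by (rule that[of \<mu> b]) (fact sets fmu b(1) mono bound)+
qed

end

text \<open>\<open>\<mu>\<close> is a parameter so that the valuations of different \<open>g\<close>
  can share one control measure; only the factor \<open>b\<close> varies with
  \<open>g\<close>.\<close>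

locale controlled_valuation = valuation_functional S V
  for S :: "'a::euclidean_space set" and V :: "('a \<Rightarrow> real) \<Rightarrow> real" +
  fixes \<mu> :: "'a measure" and b :: "real \<Rightarrow> real"
  assumes sets: "sets \<mu> = sets (restrict_space borel S)"
    and fin: "finite_measure \<mu>"
    and b_nonneg: "0 \<le> b B" and b_mono: "mono b"
    and control: "f \<in> cpos_le S B \<Longrightarrow> 0 \<le> B \<Longrightarrow> open G \<Longrightarrow> (\<And>x. x \<in> S - G \<Longrightarrow> f x = 0) \<Longrightarrow>
      V f \<le> b B * measure \<mu> (G \<inter> S)"
begin

sublocale finite_measure \<mu> by (rule fin)

lemma closed: "closed S" by (rule compact_imp_closed[OF compact])

lemma space_eq [simp]: "space \<mu> = S"
  using sets_eq_imp_space_eq[OF sets] by (simp add: space_restrict_space)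

lemma S_sets [simp]: "S \<in> sets \<mu>"
  using sets.top[of \<mu>] by simp

lemma cont_measurable: "continuous_on S f \<Longrightarrow> f \<in> borel_measurable \<mu>" for f :: "'a \<Rightarrow> real"
  unfolding measurable_cong_sets[OF sets refl] by (rule borel_measurable_continuous_on_restrict)

text \<open>First \<open>h\<close> is moved to \<open>g\<close> by at most \<open>d / 2\<close>,
  which by continuity at \<open>h\<close> costs less than \<open>e1\<close>; now \<open>f\<close>
  and \<open>g\<close> differ only on a closed subset \<open>C\<close> of an open \<open>G\<close>
  slightly larger than \<open>A\<close>. With \<open>q = B\<close> on \<open>C\<close> and
  \<open>q = 0\<close> off \<open>G\<close>, \<open>max f q = max g q\<close>; hence
  \<open>V f - V g\<close> is a difference of two values in
  \<open>[0, b B * measure \<mu> (G \<inter> S)]\<close>.\<close>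

lemma V_diff_le:
  assumes f: "f \<in> cpos_le S B" and h: "h \<in> cpos_le S B" and B: "0 \<le> B"
    and A: "A \<in> sets \<mu>" "{x\<in>S. f x \<noteq> h x} \<subseteq> A"
  shows "\<bar>V f - V h\<bar> \<le> b B * measure \<mu> A"
proof (rule field_le_epsilon)
  fix e :: real assume e: "0 < e"
  define e1 where "e1 = e / (b B + 1)"
  have bB: "0 < b B + 1" using b_nonneg[of B] by linarith
  then have e1': "0 < e1" "(b B + 1) * e1 = e"
    unfolding e1_def using e by auto
  then have e1: "0 < e1" "b B * e1 + e1 = e"
    by (auto simp: algebra_simps)
  note fp = cpos_le_imp_cpos[OF f] and hp = cpos_le_imp_cpos[OF h]
  obtain G where G: "open G" "A \<subseteq> G" "measure \<mu> (G \<inter> S) < measure \<mu> A + e1"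
    using outer_regular_on[OF sets closed fin A(1) e1(1)] by blast
  obtain d where d: "0 < d" "\<And>g. g \<in> cpos S \<Longrightarrow> (\<forall>x\<in>S. \<bar>g x - h x\<bar> < d) \<Longrightarrow> \<bar>V g - V h\<bar> < e1"
    using cont[OF hp e1(1)] by metis
  define g where "g x = h x + max (- d / 2) (min (d / 2) (f x - h x))" for x
  have fc: "continuous_on S f" and hc: "continuous_on S h"
    using f h by (auto simp: cpos_le_def)
  have g: "g \<in> cpos_le S B"
    unfolding cpos_le_def
  proof safe
    show "continuous_on S g" unfolding g_def by (intro continuous_intros fc hc)
    fix x assume "x \<in> S"
    then have "0 \<le> f x" "f x \<le> B" "0 \<le> h x" "h x \<le> B" using f h by (auto simp: cpos_le_def)
    then show "0 \<le> g x" "g x \<le> B" unfolding g_def using d(1) by (auto simp: max_def min_def)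
  qed
  note gp = cpos_le_imp_cpos[OF g]
  have gh: "\<bar>V g - V h\<bar> < e1"
    using d(1) by (intro d(2)[OF gp]) (auto simp: g_def max_def min_def abs_if)
  define C where "C = {x\<in>S. d / 2 \<le> \<bar>f x - h x\<bar>}"
  have "closed C"
    unfolding C_def using closed by (intro continuous_on_closed_Collect_le continuous_intros fc hc)
  moreover have "C \<subseteq> G" using A(2) G(2) d(1) unfolding C_def by force
  ultimately obtain p :: "'a \<Rightarrow> real" where p: "continuous_on UNIV p" "\<And>x. 0 \<le> p x" "\<And>x. p x \<le> 1"
      "\<And>x. x \<in> - G \<Longrightarrow> p x = 0" "\<And>x. x \<in> C \<Longrightarrow> p x = 1"
    using Urysohn_unit[of "- G" C] G(1) by blast
  define q where "q x = B * p x" for x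
  have qc: "continuous_on S q"
    unfolding q_def by (intro continuous_on_mult_left continuous_on_subset[OF p(1)]) simp
  have q: "q \<in> cpos S" using qc p(2) B by (auto simp: cpos_def q_def)
  have "V (\<lambda>x. max (f x) (q x)) = V (\<lambda>x. max (g x) (q x))"
  proof (rule cong)
    fix x assume x: "x \<in> S"
    show "max (f x) (q x) = max (g x) (q x)"
    proof (cases "x \<in> C")
      case True
      then have "q x = B" using p(5) by (simp add: q_def)
      with f g x show ?thesis by (auto simp: cpos_le_def)
    next
      case False
      then have "f x = g x" using x unfolding g_def C_def by (auto simp: max_def min_def abs_if split: if_splits)
      then show ?thesis by simp
    qed
  qed
  then have eq: "V f - V g = V (\<lambda>x. min (f x) (q x)) - V (\<lambda>x. min (g x) (q x))"
    using max_min[OF fp q] max_min[OF gp q] by linarith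
  have mb: "0 \<le> V (\<lambda>x. min (u x) (q x)) \<and> V (\<lambda>x. min (u x) (q x)) \<le> b B * measure \<mu> (G \<inter> S)"
    if u: "u \<in> cpos_le S B" for u
  proof -
    have m: "(\<lambda>x. min (u x) (q x)) \<in> cpos_le S B"
      using u q by (auto simp: cpos_le_def cpos_def min_le_iff_disj intro!: continuous_intros)
    have z: "min (u x) (q x) = 0" if "x \<in> S - G" for x
      using that p(4)[of x] u by (auto simp: q_def cpos_le_def)
    from nonneg[OF cpos_le_imp_cpos[OF m]] control[OF m B G(1) z] show ?thesis by auto
  qed
  have "\<bar>V f - V g\<bar> \<le> b B * measure \<mu> (G \<inter> S)"
    using mb[OF f] mb[OF g] eq by linarith
  also have "\<dots> \<le> b B * (measure \<mu> A + e1)"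
    using G(3) b_nonneg by (intro mult_left_mono) auto
  finally have "\<bar>V f - V h\<bar> \<le> b B * (measure \<mu> A + e1) + e1"
    using gh by linarith
  with e1(2) show "\<bar>V f - V h\<bar> \<le> b B * measure \<mu> A + e"
    by (simp add: algebra_simps)
qed

end

lemma tendsto_one_over_Suc:
  fixes X :: "nat \<Rightarrow> real"
  assumes "\<And>j. \<bar>X j - a\<bar> \<le> 1 / real (Suc j) * c"
  shows "X \<longlonglongrightarrow> a"
proof -
  have "(\<lambda>j. \<bar>X j - a\<bar>) \<longlonglongrightarrow> 0"
    by (rule tendsto_sandwich[OF _ _ tendsto_const tendsto_mult_left_zero[OF LIMSEQ_Suc[OF lim_1_over_n]]])
       (use assms in \<open>auto intro!: always_eventually simp del: of_nat_Suc\<close>)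
  then show ?thesis by (simp add: LIM_zero_iff tendsto_rabs_zero_iff)
qed

lemma small_factor:
  fixes c e :: real
  assumes "0 \<le> c" "0 < e"
  shows "0 < e / (c + 1)" "(c + 1) * (e / (c + 1)) = e"
  using assms by auto

context controlled_valuation
begin

section \<open>Extension to bounded Borel functions\<close>

definition bor :: "real \<Rightarrow> ('a \<Rightarrow> real) set" where
  "bor B = {F \<in> borel_measurable \<mu>. \<forall>x\<in>S. 0 \<le> F x \<and> F x \<le> B}"

text \<open>The size of the set of disagreement, regardless of how far the values are apart. On
  continuous functions with values in \<open>[0,B]\<close>, \<open>V\<close> is Lipschitz for
  it.\<close>

definition dev :: "('a \<Rightarrow> real) \<Rightarrow> ('a \<Rightarrow> real) \<Rightarrow> real" where
  "dev F H = measure \<mu> {x\<in>S. F x \<noteq> H x}"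

lemma cpos_le_bor: "f \<in> cpos_le S B \<Longrightarrow> f \<in> bor B"
  by (auto simp: bor_def cpos_le_def intro: cont_measurable)

lemma borD: "F \<in> bor B \<Longrightarrow> F \<in> borel_measurable \<mu>"
  by (simp add: bor_def)

lemma cpos_le_mono: "f \<in> cpos_le S B \<Longrightarrow> B \<le> C \<Longrightarrow> f \<in> cpos_le S C"
  by (auto simp: cpos_le_def intro: order_trans)

lemma neq_sets:
  fixes F H :: "'a \<Rightarrow> real"
  assumes "F \<in> borel_measurable \<mu>" "H \<in> borel_measurable \<mu>"
  shows "{x\<in>S. F x \<noteq> H x} \<in> sets \<mu>"
proof -
  have "{x\<in>space \<mu>. F x \<noteq> H x} \<in> sets \<mu>"
    by (rule borel_measurable_neq[OF assms])
  then show ?thesis by simp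
qed

lemma dev_nonneg: "0 \<le> dev F H"
  by (simp add: dev_def)

lemma dev_commute: "dev F H = dev H F"
  by (simp add: dev_def eq_commute)

lemma dev_triangle:
  assumes "F \<in> borel_measurable \<mu>" "G \<in> borel_measurable \<mu>" "H \<in> borel_measurable \<mu>"
  shows "dev F H \<le> dev F G + dev G H"
proof -
  have "dev F H \<le> measure \<mu> ({x\<in>S. F x \<noteq> G x} \<union> {x\<in>S. G x \<noteq> H x})"
    unfolding dev_def by (intro finite_measure_mono sets.Un neq_sets assms) auto
  also have "\<dots> \<le> dev F G + dev G H"
    unfolding dev_def by (intro measure_Un_le neq_sets assms)
  finally show ?thesis .
qed

lemma V_dev:
  assumes "f \<in> cpos_le S B" "h \<in> cpos_le S B" "0 \<le> B"
  shows "\<bar>V f - V h\<bar> \<le> b B * dev f h"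
  unfolding dev_def using assms
  by (intro V_diff_le neq_sets cont_measurable) (auto simp: cpos_le_def)

text \<open>Lusin's theorem followed by Tietze's, in the version that keeps values in
  \<open>[0,B]\<close>.\<close>

lemma ex_continuous_approx:
  assumes F: "F \<in> bor B" and B: "0 \<le> B" and e: "0 < e"
  obtains f where "f \<in> cpos_le S B" "dev f F < e"
proof -
  obtain C where C: "compact C" "C \<subseteq> S" "continuous_on C F" "measure \<mu> (S - C) < e"
    using Lusin[OF sets closed fin borD[OF F] e] by metis
  have "closedin (top_of_set S) C"
    using C by (simp add: compact_imp_closed closed_subset)
  moreover have F01: "F x \<in> cbox 0 B" if "x \<in> C" for x
    using F C(2) that by (auto simp: bor_def)
  ultimately obtain f where f: "continuous_on S f" "\<And>x. x \<in> C \<Longrightarrow> f x = F x"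
    "\<And>x. x \<in> S \<Longrightarrow> f x \<in> cbox 0 B"
    using Tietze_closed_interval_1[OF C(3) _ B F01] by metis
  have fB: "f \<in> cpos_le S B" using f by (auto simp: cpos_le_def)
  have "C \<in> sets \<mu>" unfolding sets_on_iff[OF sets closed] using C by (auto intro: borel_compact)
  then have "dev f F \<le> measure \<mu> (S - C)"
    unfolding dev_def using f(2) by (intro finite_measure_mono) auto
  with C(4) that[OF fB] show ?thesis by linarith
qed

text \<open>\<open>V\<close> is Cauchy along continuous approximations. The bound in the conclusion
  is quantified anew, so that a single \<open>v\<close> serves every height: for another bound
  \<open>C\<close> of \<open>F\<close> the approximations are truncated at \<open>C\<close>, which
  does not increase their deviation from \<open>F\<close>.\<close>

lemma ex_extension:
  assumes F: "F \<in> bor B" and B: "0 \<le> B"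
  shows "\<exists>v. \<forall>B f. 0 \<le> B \<longrightarrow> F \<in> bor B \<longrightarrow> f \<in> cpos_le S B \<longrightarrow> \<bar>V f - v\<bar> \<le> b B * dev f F"
proof -
  have "\<exists>f. f \<in> cpos_le S B \<and> dev f F < 1 / real (Suc n)" for n
    using ex_continuous_approx[OF F B, of "1 / real (Suc n)"] by (metis of_nat_0_less_iff zero_less_Suc zero_less_divide_1_iff)
  then obtain f where f: "\<And>n. f n \<in> cpos_le S B" "\<And>n. dev (f n) F < 1 / real (Suc n)" by metis
  have fm: "f n \<in> borel_measurable \<mu>" for n using f(1) cpos_le_bor borD by blast
  have d0: "(\<lambda>n. dev (f n) F) \<longlonglongrightarrow> 0"
    by (rule tendsto_one_over_Suc[where c = 1])
       (use f(2) dev_nonneg in \<open>auto simp: less_imp_le simp del: of_nat_Suc\<close>)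
  have "Cauchy (\<lambda>n. V (f n))"
  proof (rule metric_CauchyI)
    fix e :: real assume "0 < e"
    have "(\<lambda>n. b B * dev (f n) F) \<longlonglongrightarrow> b B * 0" by (intro tendsto_intros d0)
    then obtain N where N: "\<And>n. N \<le> n \<Longrightarrow> b B * dev (f n) F < e / 2"
      using order_tendstoD(2)[of _ _ sequentially "e / 2"] \<open>0 < e\<close> unfolding eventually_sequentially
      by (metis half_gt_zero mult_zero_right)
    have "dist (V (f m)) (V (f n)) < e" if "N \<le> m" "N \<le> n" for m n
    proof -
      have "\<bar>V (f m) - V (f n)\<bar> \<le> b B * dev (f m) (f n)" by (rule V_dev[OF f(1) f(1) B])
      also have "\<dots> \<le> b B * (dev (f m) F + dev (f n) F)"
        using dev_triangle[OF fm borD[OF F] fm, of m n] dev_commute[of F "f n"]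
        by (intro mult_left_mono b_nonneg) auto
      finally show ?thesis using N[OF that(1)] N[OF that(2)] by (simp add: dist_real_def distrib_left)
    qed
    then show "\<exists>N. \<forall>m\<ge>N. \<forall>n\<ge>N. dist (V (f m)) (V (f n)) < e" by blast
  qed
  then obtain v where v: "(\<lambda>n. V (f n)) \<longlonglongrightarrow> v" using Cauchy_convergent_iff convergent_def by blast
  have "\<bar>V g - v\<bar> \<le> b C * dev g F" if C: "0 \<le> C" "F \<in> bor C" and g: "g \<in> cpos_le S C" for C g
  proof -
    define h where "h n x = min (f n x) C" for n x
    let ?D = "max B C"
    have h: "h n \<in> cpos_le S C" for n
      using f(1)[of n] C(1) by (auto simp: h_def cpos_le_def min_le_iff_disj intro!: continuous_intros)
    have hm: "h n \<in> borel_measurable \<mu>" for n using h cpos_le_bor borD by blast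
    have gm: "g \<in> borel_measurable \<mu>" using g cpos_le_bor borD by blast
    have hF: "dev (h n) F \<le> dev (f n) F" for n
      unfolding dev_def using C(2)
      by (intro finite_measure_mono neq_sets fm borD[OF F]) (auto simp: h_def bor_def)
    have est: "\<bar>V g - V (f n)\<bar> \<le> b C * (dev g F + dev (f n) F) + b ?D * (2 * dev (f n) F)" for n
    proof -
      have "\<bar>V g - V (h n)\<bar> \<le> b C * dev g (h n)" by (rule V_dev[OF g h C(1)])
      also have "\<dots> \<le> b C * (dev g F + dev (f n) F)"
        using dev_triangle[OF gm borD[OF F] hm, of n] dev_commute[of F "h n"] hF[of n]
        by (intro mult_left_mono b_nonneg) auto
      finally have 1: "\<bar>V g - V (h n)\<bar> \<le> b C * (dev g F + dev (f n) F)" .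
      have "\<bar>V (h n) - V (f n)\<bar> \<le> b ?D * dev (h n) (f n)"
        using B by (intro V_dev cpos_le_mono[OF h] cpos_le_mono[OF f(1)]) auto
      also have "\<dots> \<le> b ?D * (2 * dev (f n) F)"
        using dev_triangle[OF hm borD[OF F] fm, of n n] dev_commute[of F "f n"] hF[of n]
        by (intro mult_left_mono b_nonneg) auto
      finally show ?thesis using 1 by linarith
    qed
    have "(\<lambda>n. b C * (dev g F + dev (f n) F) + b ?D * (2 * dev (f n) F)) \<longlonglongrightarrow> b C * (dev g F + 0) + b ?D * (2 * 0)"
      by (intro tendsto_intros d0)
    moreover have "(\<lambda>n. \<bar>V g - V (f n)\<bar>) \<longlonglongrightarrow> \<bar>V g - v\<bar>"
      by (intro tendsto_intros v)
    ultimately have "\<bar>V g - v\<bar> \<le> b C * (dev g F + 0) + b ?D * (2 * 0)"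
      by (intro LIMSEQ_le) (use est in auto)
    then show ?thesis by simp
  qed
  then show ?thesis by blast
qed

definition ext :: "('a \<Rightarrow> real) \<Rightarrow> real" where
  "ext F = (SOME v. \<forall>B f. 0 \<le> B \<longrightarrow> F \<in> bor B \<longrightarrow> f \<in> cpos_le S B \<longrightarrow> \<bar>V f - v\<bar> \<le> b B * dev f F)"

lemma ext_approx:
  assumes "F \<in> bor B" "0 \<le> B" "f \<in> cpos_le S B"
  shows "\<bar>V f - ext F\<bar> \<le> b B * dev f F"
  using someI_ex[OF ex_extension[OF assms(1,2)]] assms unfolding ext_def[symmetric] by blast

lemma ext_dev:
  assumes F: "F \<in> bor B" and H: "H \<in> bor B" and B: "0 \<le> B"
  shows "\<bar>ext F - ext H\<bar> \<le> b B * dev F H"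
proof (rule field_le_epsilon)
  fix e :: real assume e: "0 < e"
  define e1 where "e1 = e / 4 / (b B + 1)"
  have "0 < e / 4" using e by simp
  note e1 = small_factor[OF b_nonneg[of B] this, folded e1_def]
  obtain f where f: "f \<in> cpos_le S B" "dev f F < e1" by (rule ex_continuous_approx[OF F B e1(1)])
  obtain h where h: "h \<in> cpos_le S B" "dev h H < e1" by (rule ex_continuous_approx[OF H B e1(1)])
  have fm: "f \<in> borel_measurable \<mu>" and hm: "h \<in> borel_measurable \<mu>"
    using f h cpos_le_bor borD by blast+
  have "\<bar>ext F - ext H\<bar> \<le> \<bar>V f - ext F\<bar> + \<bar>V f - V h\<bar> + \<bar>V h - ext H\<bar>" by linarith
  also have "\<dots> \<le> b B * dev f F + b B * dev f h + b B * dev h H"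
    by (intro add_mono ext_approx V_dev F H B f h)
  also have "\<dots> = b B * (dev f F + dev f h + dev h H)" by (simp add: algebra_simps)
  \<comment> \<open>Two of the four \<open>e1\<close> are for \<open>dev f F\<close> and
    \<open>dev h H\<close>, two for the triangle inequality applied to
    \<open>dev f h\<close>.\<close>
  also have "\<dots> \<le> b B * (dev F H + 4 * e1)"
    using f(2) h(2) dev_triangle[OF fm borD[OF F] hm] dev_triangle[OF borD[OF F] borD[OF H] hm]
      dev_commute[of H h]
    by (intro mult_left_mono b_nonneg) auto
  also have "\<dots> \<le> b B * dev F H + e"
    using e1 by (simp add: algebra_simps)
  finally show "\<bar>ext F - ext H\<bar> \<le> b B * dev F H + e" .
qed

lemma ext_cong:
  assumes F: "F \<in> bor B" and B: "0 \<le> B" and eq: "\<And>x. x \<in> S \<Longrightarrow> F x = H x"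
  shows "ext F = ext H"
proof -
  have "H \<in> bor B"
    using F eq measurable_cong[of \<mu> F H borel] by (auto simp: bor_def)
  moreover have "dev F H = 0"
  proof -
    have "{x\<in>S. F x \<noteq> H x} = {}" using eq by auto
    then show ?thesis unfolding dev_def by (simp only: measure_empty)
  qed
  ultimately show ?thesis using ext_dev[OF F _ B, of H] by simp
qed

lemma ext_cont:
  assumes "f \<in> cpos_le S B" "0 \<le> B"
  shows "ext f = V f"
  using ext_approx[OF cpos_le_bor[OF assms(1)] assms(2,1)] by (simp add: dev_def)

lemma ext_max_min:
  assumes F: "F \<in> bor B" and H: "H \<in> bor B" and B: "0 \<le> B"
  shows "ext (\<lambda>x. max (F x) (H x)) + ext (\<lambda>x. min (F x) (H x)) = ext F + ext H"
proof -
  let ?M = "\<lambda>F H x. max (F x) (H x :: real)" and ?m = "\<lambda>F H x. min (F x) (H x :: real)"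
  have M: "?M F H \<in> bor B" "?m F H \<in> bor B"
    using F H by (auto simp: bor_def le_max_iff_disj min_le_iff_disj)
  have "\<bar>ext (?M F H) + ext (?m F H) - (ext F + ext H)\<bar> \<le> 0 + e" if e: "0 < e" for e
  proof -
    define e1 where "e1 = e / 6 / (b B + 1)"
    have "0 < e / 6" using e by simp
    note e1 = small_factor[OF b_nonneg[of B] this, folded e1_def]
    obtain f where f: "f \<in> cpos_le S B" "dev f F < e1" by (rule ex_continuous_approx[OF F B e1(1)])
    obtain h where h: "h \<in> cpos_le S B" "dev h H < e1" by (rule ex_continuous_approx[OF H B e1(1)])
    have fm: "f \<in> borel_measurable \<mu>" and hm: "h \<in> borel_measurable \<mu>"
      using f h cpos_le_bor borD by blast+
    have m: "?M f h \<in> cpos_le S B" "?m f h \<in> cpos_le S B"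
      using f(1) h(1) by (auto simp: cpos_le_def le_max_iff_disj min_le_iff_disj intro!: continuous_intros)
    have le: "dev k K \<le> dev f F + dev h H" if "{x\<in>S. k x \<noteq> K x} \<subseteq> {x\<in>S. f x \<noteq> F x} \<union> {x\<in>S. h x \<noteq> H x}" for k K
    proof -
      have "dev k K \<le> measure \<mu> ({x\<in>S. f x \<noteq> F x} \<union> {x\<in>S. h x \<noteq> H x})"
        unfolding dev_def using that
        by (intro finite_measure_mono sets.Un neq_sets fm hm borD[OF F] borD[OF H])
      also have "\<dots> \<le> dev f F + dev h H"
        unfolding dev_def by (intro measure_Un_le neq_sets fm hm borD[OF F] borD[OF H])
      finally show ?thesis .
    qed
    have dM: "dev (?M f h) (?M F H) \<le> 2 * e1" "dev (?m f h) (?m F H) \<le> 2 * e1"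
      using le[of "?M f h" "?M F H"] le[of "?m f h" "?m F H"] f(2) h(2) by force+
    have vv: "V (?M f h) + V (?m f h) = V f + V h"
      by (rule max_min[OF cpos_le_imp_cpos[OF f(1)] cpos_le_imp_cpos[OF h(1)]])
    have "\<bar>ext (?M F H) + ext (?m F H) - (ext F + ext H)\<bar> \<le>
      \<bar>V (?M f h) - ext (?M F H)\<bar> + \<bar>V (?m f h) - ext (?m F H)\<bar> + \<bar>V f - ext F\<bar> + \<bar>V h - ext H\<bar>"
      using vv by linarith
    also have "\<dots> \<le> b B * dev (?M f h) (?M F H) + b B * dev (?m f h) (?m F H) + b B * dev f F + b B * dev h H"
      by (intro add_mono ext_approx F H B f h M m)
    also have "\<dots> = b B * (dev (?M f h) (?M F H) + dev (?m f h) (?m F H) + dev f F + dev h H)"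
      by (simp add: algebra_simps)
    \<comment> \<open>Two for the maxima, two for the minima, one each for \<open>f\<close> and
      \<open>h\<close>.\<close>
    also have "\<dots> \<le> b B * (6 * e1)"
      using dM f(2) h(2) by (intro mult_left_mono b_nonneg) auto
    also have "\<dots> \<le> e" using e1 by (simp add: algebra_simps)
    finally show ?thesis by simp
  qed
  then have "\<bar>ext (?M F H) + ext (?m F H) - (ext F + ext H)\<bar> \<le> 0" by (rule field_le_epsilon)
  then show ?thesis by simp
qed

text \<open>\<open>V\<close> is continuous at single functions only, so one compact \<open>C\<close>
  must serve all \<open>j\<close>: \<open>h\<close> extends \<open>H\<close> from \<open>C\<close>,
  and adding a small extension \<open>g\<close> of \<open>F j - H\<close> gives a continuous
  function equal to \<open>F j\<close> on \<open>C\<close> and uniformly close to \<open>h\<close>.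
  Continuity of \<open>V\<close> is used at \<open>h\<close> alone.\<close>

lemma ext_uniform_limit:
  assumes F: "\<And>j. F j \<in> bor B" and H: "H \<in> bor B" and B: "0 \<le> B"
    and lim: "uniform_limit S F H sequentially"
  shows "(\<lambda>j. ext (F j)) \<longlonglongrightarrow> ext H"
proof (rule metric_LIMSEQ_I)
  fix e :: real assume e: "0 < e"
  define e1 where "e1 = e / 4 / (b B + 1)"
  have "0 < e / 4" using e by simp
  note e1 = small_factor[OF b_nonneg[of B] this, folded e1_def]
  \<comment> \<open>\<open>H\<close> and all the \<open>F j\<close> are packed into one sequence for
    \<open>Lusin\<close>.\<close>
  define K where "K j = (case j of 0 \<Rightarrow> H | Suc i \<Rightarrow> F i)" for j
  have "K j \<in> borel_measurable \<mu>" for j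
    unfolding K_def using borD[OF F] borD[OF H] by (auto split: nat.split)
  then obtain C where C: "compact C" "C \<subseteq> S" "\<And>j. continuous_on C (K j)" "measure \<mu> (S - C) < e1"
    using Lusin[OF sets closed fin _ e1(1), of K] by metis
  have HC: "continuous_on C H" and FC: "continuous_on C (F j)" for j
    using C(3)[of 0] C(3)[of "Suc j"] by (auto simp: K_def)
  have Ccl: "closedin (top_of_set S) C"
    using C by (simp add: compact_imp_closed closed_subset)
  have CM: "C \<in> sets \<mu>" unfolding sets_on_iff[OF sets closed] using C by (auto intro: borel_compact)
  have H01: "H x \<in> cbox 0 B" if "x \<in> C" for x
    using H C(2) that by (auto simp: bor_def)
  obtain h where h: "continuous_on S h" "\<And>x. x \<in> C \<Longrightarrow> h x = H x"
    "\<And>x. x \<in> S \<Longrightarrow> h x \<in> cbox 0 B"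
    using Tietze_closed_interval_1[OF HC Ccl B H01] by metis
  have hB: "h \<in> cpos_le S B" using h by (auto simp: cpos_le_def)
  have dle: "dev k K \<le> e1" if "\<And>x. x \<in> C \<Longrightarrow> k x = K x" for k K
  proof -
    have "dev k K \<le> measure \<mu> (S - C)"
      unfolding dev_def using CM that by (intro finite_measure_mono) auto
    with C(4) show ?thesis by linarith
  qed
  obtain d where d: "0 < d" "\<And>g. g \<in> cpos S \<Longrightarrow> (\<forall>x\<in>S. \<bar>g x - h x\<bar> < d) \<Longrightarrow> \<bar>V g - V h\<bar> < e1"
    using cont[OF cpos_le_imp_cpos[OF hB] e1(1)] by metis
  obtain N where N: "\<And>j x. N \<le> j \<Longrightarrow> x \<in> S \<Longrightarrow> dist (F j x) (H x) < d / 2"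
    using uniform_limitD[OF lim, of "d / 2"] d(1) unfolding eventually_sequentially by auto
  have "dist (ext (F j)) (ext H) < e" if j: "N \<le> j" for j
  proof -
    have "continuous_on C (\<lambda>x. F j x - H x)" by (intro continuous_intros HC FC)
    moreover have "norm (F j x - H x) \<le> d / 2" if "x \<in> C" for x
      using N[OF j, of x] that C(2) by (auto simp: dist_norm)
    moreover have "0 \<le> d / 2" using d(1) by simp
    ultimately obtain g where g: "continuous_on S g" "\<And>x. x \<in> C \<Longrightarrow> g x = F j x - H x"
      "\<And>x. x \<in> S \<Longrightarrow> norm (g x) \<le> d / 2"
      using Tietze[OF _ Ccl, of "\<lambda>x. F j x - H x" "d / 2"] by metis
    \<comment> \<open>The clamp to \<open>[0,B]\<close> changes nothing on \<open>C\<close>, where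
      \<open>h + g = F j\<close>, and cannot increase the distance to \<open>h\<close>, whose values
      lie in \<open>[0,B]\<close>.\<close>
    define f where "f x = max 0 (min B (h x + g x))" for x
    have f: "f \<in> cpos_le S B"
      unfolding f_def cpos_le_def using B h(1) g(1) by (auto intro!: continuous_intros)
    have fF: "f x = F j x" if "x \<in> C" for x
      using F[of j] that C(2) by (auto simp: f_def g h bor_def)
    have "\<bar>f x - h x\<bar> < d" if "x \<in> S" for x
    proof -
      have "0 \<le> h x" "h x \<le> B" "\<bar>g x\<bar> \<le> d / 2"
        using g(3)[OF that] hB that by (auto simp: cpos_le_def)
      then show ?thesis unfolding f_def using d(1) by linarith
    qed
    then have 1: "\<bar>V f - V h\<bar> < e1" using d(2)[OF cpos_le_imp_cpos[OF f]] by blast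
    have 2: "\<bar>V f - ext (F j)\<bar> \<le> b B * e1"
      using ext_approx[OF F B f] dle[OF fF] b_nonneg mult_left_mono order_trans by meson
    have 3: "\<bar>V h - ext H\<bar> \<le> b B * e1"
      using ext_approx[OF H B hB] dle[OF h(2)] b_nonneg mult_left_mono order_trans by meson
    have "\<bar>ext (F j) - ext H\<bar> < e1 + b B * e1 + b B * e1"
      using 1 2 3 by linarith
    also have "\<dots> \<le> e"
    proof -
      have "b B * e1 + e1 = e / 4" using e1(2) by (simp add: algebra_simps)
      moreover have "0 \<le> b B * e1" using b_nonneg[of B] e1(1) by simp
      ultimately show ?thesis using e1(1) by linarith
    qed
    finally show ?thesis by (simp add: dist_real_def)
  qed
  then show "\<exists>N. \<forall>j\<ge>N. dist (ext (F j)) (ext H) < e" by blast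
qed

lemma ext_nonneg:
  assumes F: "F \<in> bor B" and B: "0 \<le> B"
  shows "0 \<le> ext F"
proof (rule field_le_epsilon)
  fix e :: real assume e: "0 < e"
  define e1 where "e1 = e / (b B + 1)"
  have bB: "0 < b B + 1" using b_nonneg[of B] by linarith
  then have e1: "0 < e1" "(b B + 1) * e1 = e" unfolding e1_def using e by auto
  obtain f where f: "f \<in> cpos_le S B" "dev f F < e1" by (rule ex_continuous_approx[OF F B e1(1)])
  have "b B * dev f F \<le> b B * e1" using f(2) by (intro mult_left_mono b_nonneg) auto
  then show "0 \<le> ext F + e"
    using ext_approx[OF F B f(1)] nonneg[OF cpos_le_imp_cpos[OF f(1)]] e1 by (simp add: algebra_simps)
qed

lemma ext_zero: "ext (\<lambda>x. 0) = 0"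
  using ext_cont[of "\<lambda>x. 0" 0] zero by (simp add: cpos_le_def)

lemma bor_indicator:
  assumes "F \<in> bor B" "0 \<le> B" "A \<in> sets \<mu>"
  shows "(\<lambda>x. F x * indicator A x) \<in> bor B"
  using assms by (auto simp: bor_def indicator_def)

lemma ext_indicator_le:
  assumes F: "F \<in> bor B" and B: "0 \<le> B" and A: "A \<in> sets \<mu>"
  shows "ext (\<lambda>x. F x * indicator A x) \<le> b B * measure \<mu> A"
proof -
  have "(\<lambda>x. 0) \<in> bor B" using B by (simp add: bor_def)
  then have "ext (\<lambda>x. F x * indicator A x) \<le> b B * dev (\<lambda>x. F x * indicator A x) (\<lambda>x. 0)"
    using ext_dev[OF bor_indicator[OF F B A] _ B, of "\<lambda>x. 0"] ext_zero by simp
  also have "\<dots> \<le> b B * measure \<mu> A"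
    unfolding dev_def using A by (intro mult_left_mono finite_measure_mono b_nonneg) (auto simp: indicator_def)
  finally show ?thesis .
qed

text \<open>For disjoint sets, the maximum of the two localized functions is \<open>F\<close>
  localized to the union and the minimum is 0, so \<open>ext_max_min\<close> gives additivity. The
  bound by a multiple of \<open>\<mu>\<close> gives continuity at the empty set, hence countable
  additivity.\<close>

lemma ex_localized_measure:
  assumes F: "F \<in> bor B" and B: "0 \<le> B"
  obtains N where "sets N = sets \<mu>"
    "\<And>A. A \<in> sets \<mu> \<Longrightarrow> emeasure N A = ennreal (ext (\<lambda>x. F x * indicator A x))"
proof -
  define E where "E A = ennreal (ext (\<lambda>x. F x * indicator A x))" for A
  have pos: "positive (sets \<mu>) E"
    unfolding positive_def E_def by (simp add: ext_zero)
  have add: "additive (sets \<mu>) E"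
  unfolding additive_def
  proof (intro ballI impI)
    fix A C assume A: "A \<in> sets \<mu>" and C: "C \<in> sets \<mu>" and AC: "A \<inter> C = {}"
    let ?A = "\<lambda>x. F x * indicator A x" and ?C = "\<lambda>x. F x * indicator C x" and ?AC = "\<lambda>x. F x * indicator (A \<union> C) x"
    have bA: "?A \<in> bor B" "?C \<in> bor B" "?AC \<in> bor B"
      using A C by (auto intro!: bor_indicator F B)
    have "ext ?AC = ext (\<lambda>x. max (?A x) (?C x))"
      using AC F by (intro ext_cong[OF bA(3) B]) (auto simp: indicator_def bor_def max_def)
    moreover have "ext (\<lambda>x. 0) = ext (\<lambda>x. min (?A x) (?C x))"
      using AC F B by (intro ext_cong[of _ B]) (auto simp: indicator_def bor_def min_def)
    ultimately have "ext ?AC = ext ?A + ext ?C"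
      using ext_max_min[OF bA(1,2) B] ext_zero by linarith
    then show "E (A \<union> C) = E A + E C"
      unfolding E_def using ext_nonneg[OF bA(1) B] ext_nonneg[OF bA(2) B] by (simp add: ennreal_plus)
  qed
  have ca: "countably_additive (sets \<mu>) E"
  proof (rule sets.empty_continuous_imp_countably_additive[OF pos add])
    show "\<forall>A\<in>sets \<mu>. E A \<noteq> \<infinity>" by (simp add: E_def)
    fix A :: "nat \<Rightarrow> 'a set" assume A: "range A \<subseteq> sets \<mu>" "decseq A" "(\<Inter>i. A i) = {}"
    have "(\<lambda>i. measure \<mu> (A i)) \<longlonglongrightarrow> 0"
      using finite_Lim_measure_decseq[OF A(1,2)] A(3) by simp
    then have "(\<lambda>i. b B * measure \<mu> (A i)) \<longlonglongrightarrow> 0" by (rule tendsto_mult_right_zero)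
    then have "(\<lambda>i. ext (\<lambda>x. F x * indicator (A i) x)) \<longlonglongrightarrow> 0"
      by (rule tendsto_sandwich[OF _ _ tendsto_const, rotated -1])
         (use A(1) in \<open>auto intro!: always_eventually ext_nonneg[of _ B] ext_indicator_le bor_indicator F B\<close>)
    then show "(\<lambda>i. E (A i)) \<longlonglongrightarrow> 0"
      unfolding E_def using tendsto_ennrealI by fastforce
  qed
  define N where "N = measure_of S (sets \<mu>) E"
  have sig: "sigma_algebra S (sets \<mu>)" using sets.sigma_algebra_axioms[of \<mu>] by simp
  have "sets N = sets \<mu>"
    unfolding N_def using sig by (simp add: sigma_algebra.sigma_sets_eq sigma_algebra_iff2)
  moreover have "emeasure N A = E A" if "A \<in> sets \<mu>" for A
    unfolding N_def by (rule emeasure_measure_of_sigma[OF sig pos ca that])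
  ultimately show ?thesis using that unfolding E_def by blast
qed

end

section \<open>Rational grids and extension from rational levels\<close>

lemma uniform_limit_one_over_Suc:
  fixes F :: "nat \<Rightarrow> 'a \<Rightarrow> real"
  assumes "\<And>j x. x \<in> S \<Longrightarrow> \<bar>F j x - H x\<bar> \<le> 1 / real (Suc j) * c"
  shows "uniform_limit S F H sequentially"
proof (rule uniform_limitI)
  fix d :: real assume "0 < d"
  then have "\<forall>\<^sub>F j in sequentially. 1 / real (Suc j) * c < d"
    using order_tendstoD(2)[OF tendsto_mult_left_zero[OF LIMSEQ_Suc[OF lim_1_over_n]]] by blast
  then show "\<forall>\<^sub>F j in sequentially. \<forall>x\<in>S. dist (F j x) (H x) < d"
  proof eventually_elim
    case (elim j)
    then show ?case unfolding dist_real_def using le_less_trans[OF assms] by blast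
  qed
qed

text \<open>Rounding down keeps values in \<open>[0,B]\<close>; as the results are rational, rounded
  functions have countable range.\<close>

definition grid_floor :: "nat \<Rightarrow> real \<Rightarrow> real" where
  "grid_floor j y = real_of_int \<lfloor>y * real (Suc j)\<rfloor> / real (Suc j)"

lemma
  shows grid_floor_nonneg: "0 \<le> y \<Longrightarrow> 0 \<le> grid_floor j y"
    and grid_floor_le: "grid_floor j y \<le> y"
    and grid_floor_diff: "\<bar>grid_floor j y - y\<bar> \<le> 1 / real (Suc j)"
    and grid_floor_Rats: "grid_floor j y \<in> \<rat>"
proof -
  have "real_of_int \<lfloor>y * real (Suc j)\<rfloor> \<le> y * real (Suc j)" "y * real (Suc j) - 1 \<le> real_of_int \<lfloor>y * real (Suc j)\<rfloor>"
    by linarith+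
  then have "grid_floor j y \<le> y * real (Suc j) / real (Suc j)" "(y * real (Suc j) - 1) / real (Suc j) \<le> grid_floor j y"
    unfolding grid_floor_def by (intro divide_right_mono; simp)+
  moreover have "(y * real (Suc j) - 1) / real (Suc j) = y - 1 / real (Suc j)"
    by (simp add: diff_divide_distrib del: of_nat_Suc)
  ultimately show "grid_floor j y \<le> y" "\<bar>grid_floor j y - y\<bar> \<le> 1 / real (Suc j)"
    by (simp_all del: of_nat_Suc)
qed (auto simp: grid_floor_def intro!: Rats_divide)

lemma continuous_on_nonneg_reals:
  fixes h :: "real \<Rightarrow> real"
  assumes "\<And>m :: nat. continuous_on {0..real m} h"
  shows "continuous_on {0..} h"
  unfolding continuous_on_eq_continuous_within
proof
  fix x :: real assume x: "x \<in> {0..}"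
  obtain m :: nat where m: "x < real m" using reals_Archimedean2 by blast
  have "continuous (at x within {0..real m}) h"
    using assms[of m] x m by (auto simp: continuous_on_eq_continuous_within)
  moreover have "at x within {0..real m} = at x within {0..}"
    by (rule at_within_nhd[of x "{..<real m}"]) (use m in auto)
  ultimately show "continuous (at x within {0..}) h" by simp
qed

text \<open>Uniform continuity extends \<open>u\<close> from the rationals of \<open>[0,n]\<close>
  to a continuous \<open>g n\<close> on all of \<open>[0,n]\<close>. By density these extensions
  agree on overlaps, so they can be glued.\<close>

lemma rational_extension:
  fixes u :: "real \<Rightarrow> real"
  assumes u: "\<And>n :: nat. uniformly_continuous_on (\<rat> \<inter> {0..real n}) u"
  obtains h where "continuous_on {0..} h" "\<And>q. q \<in> \<rat> \<Longrightarrow> 0 \<le> q \<Longrightarrow> h q = u q"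
proof -
  have "\<exists>g. continuous_on {0..real n} g \<and> (\<forall>q\<in>\<rat> \<inter> {0..real n}. g q = u q)" for n
  proof -
    obtain g where g: "uniformly_continuous_on (closure (\<rat> \<inter> {0..real n})) g"
      "\<And>x. x \<in> \<rat> \<inter> {0..real n} \<Longrightarrow> u x = g x"
      using uniformly_continuous_on_extension_on_closure[OF u[of n]] by metis
    have "{0..real n} \<subseteq> closure (\<rat> \<inter> {0..real n})"
    proof (cases n)
      case (Suc m)
      show ?thesis
      proof
        fix x assume x: "x \<in> {0..real n}"
        show "x \<in> closure (\<rat> \<inter> {0..real n})"
          unfolding closure_approachable
        proof (intro allI impI)
          fix e :: real assume e: "0 < e"
          have "max 0 (x - e) < min (real n) (x + e)" using x e Suc by auto
          then obtain q where q: "q \<in> \<rat>" "max 0 (x - e) < q" "q < min (real n) (x + e)"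
            using Rats_dense_in_real by blast
          then show "\<exists>y\<in>\<rat> \<inter> {0..real n}. dist y x < e"
            by (intro bexI[of _ q]) (auto simp: dist_real_def)
        qed
      qed
    qed (auto intro: closure_subset[THEN subsetD])
    with g show ?thesis
      by (intro exI[of _ g]) (auto intro: continuous_on_subset uniformly_continuous_imp_continuous)
  qed
  then obtain g where g: "\<And>n :: nat. continuous_on {0..real n} (g n)"
    "\<And>n q. q \<in> \<rat> \<Longrightarrow> 0 \<le> q \<Longrightarrow> q \<le> real n \<Longrightarrow> g n q = u q"
    by (metis IntI atLeastAtMost_iff)
  have agree: "g n x = g (Suc m) x" if x: "0 \<le> x" "x < real n" "n \<le> Suc m" for n m x
  proof -
    \<comment> \<open>Rationals approach \<open>x\<close> from the right and stay below
      \<open>n\<close>, where both extensions are known to equal \<open>u\<close>.\<close>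
    obtain X where X: "\<And>i. X i \<in> \<rat>" "\<And>i :: nat. x < X i" "X \<longlonglongrightarrow> x" "\<And>i. X i < real n"
    proof -
      have "\<exists>q\<in>\<rat>. x < q \<and> q < min (real n) (x + 1 / real (Suc i))" for i
        using x(2) by (intro Rats_dense_in_real) auto
      then obtain X where X: "\<And>i. X i \<in> \<rat>" "\<And>i. x < X i" "\<And>i. X i < min (real n) (x + 1 / real (Suc i))"
        by metis
      have "(\<lambda>i. x + 1 / real (Suc i)) \<longlonglongrightarrow> x + 0"
        by (intro tendsto_intros LIMSEQ_Suc[OF lim_1_over_n])
      then have "X \<longlonglongrightarrow> x"
        by (intro tendsto_sandwich[of "\<lambda>_. x" X sequentially "\<lambda>i. x + 1 / real (Suc i)"])
           (use X in \<open>auto intro!: always_eventually less_imp_le\<close>)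
      with X show ?thesis by (intro that[of X]) auto
    qed
    have lim: "(\<lambda>i. g k (X i)) \<longlonglongrightarrow> g k x" if "n \<le> k" for k
    proof (rule continuous_on_tendsto_compose[OF g(1)[of k] X(3)])
      have nk: "real n \<le> real k" using that by simp
      then show "x \<in> {0..real k}" using \<open>0 \<le> x\<close> \<open>x < real n\<close> by auto
      have "X i \<in> {0..real k}" for i
        using X(2)[of i] X(4)[of i] \<open>0 \<le> x\<close> nk by auto
      then show "\<forall>\<^sub>F i in sequentially. X i \<in> {0..real k}" by simp
    qed
    have "g n (X i) = g (Suc m) (X i)" for i
    proof -
      have "0 \<le> X i" "X i \<le> real n" "X i \<le> real (Suc m)"
        using X(2,4)[of i] x by (auto intro: less_imp_le order_trans)
      then show ?thesis using g(2)[OF X(1)] by metis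
    qed
    then show ?thesis using lim[of n] lim[OF x(3)] LIMSEQ_unique by fastforce
  qed
  \<comment> \<open>One step up gives an integer strictly above \<open>x\<close>, as
    \<open>agree\<close> requires; the second step matches the index \<open>Suc m\<close>
    there.\<close>
  define h where "h x = g (nat \<lfloor>x\<rfloor> + 2) x" for x
  have hg: "h x = g (Suc m) x" if "0 \<le> x" "x < real m" for x m
  proof -
    let ?n = "nat \<lfloor>x\<rfloor> + 1"
    have "0 \<le> x" "x < real ?n" "?n \<le> m"
      using that by linarith+
    then have "g ?n x = g (Suc m) x" "g ?n x = g (Suc ?n) x"
      by (intro agree; simp)+
    then show ?thesis unfolding h_def by simp
  qed
  have "continuous_on {0..} h"
  proof (rule continuous_on_nonneg_reals)
    fix m :: nat
    show "continuous_on {0..real m} h"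
      by (rule continuous_on_eq[OF continuous_on_subset[OF g(1)[of "Suc (Suc m)"]]])
         (auto intro!: hg[of _ "Suc m", symmetric])
  qed
  moreover have "h q = u q" if "q \<in> \<rat>" "0 \<le> q" for q
    unfolding h_def using that by (intro g(2)) linarith+
  ultimately show ?thesis using that by blast
qed

context controlled_valuation
begin

section \<open>The kernel of a valuation\<close>

text \<open>The localized measure of the constant \<open>q\<close> is at most \<open>b q\<close>
  times \<open>\<mu>\<close>. Its Radon-Nikodym derivative therefore exceeds \<open>b q\<close> only
  on a null set and is cut off there, so that the bounds hold at every point.\<close>

lemma ex_density:
  assumes q: "0 \<le> q"
  obtains k where "k \<in> borel_measurable \<mu>" "\<And>x. 0 \<le> k x" "\<And>x. k x \<le> b q"
    "\<And>A. A \<in> sets \<mu> \<Longrightarrow> ennreal (ext (\<lambda>x. q * indicator A x)) = (\<integral>\<^sup>+x. ennreal (k x) * indicator A x \<partial>\<mu>)"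
proof -
  have qb: "(\<lambda>x. q) \<in> bor q" using q by (simp add: bor_def)
  obtain N where N: "sets N = sets \<mu>"
    "\<And>A. A \<in> sets \<mu> \<Longrightarrow> emeasure N A = ennreal (ext (\<lambda>x. q * indicator A x))"
    using ex_localized_measure[OF qb q] by blast
  have Nle: "emeasure N A \<le> ennreal (b q) * emeasure \<mu> A" if "A \<in> sets \<mu>" for A
    unfolding N(2)[OF that] emeasure_eq_measure
    using ext_indicator_le[OF qb q that] by (simp add: ennreal_mult[symmetric] b_nonneg ennreal_leI)
  have "absolutely_continuous \<mu> N"
    unfolding absolutely_continuous_def null_sets_def
  proof safe
    fix A assume "A \<in> sets \<mu>" "emeasure \<mu> A = 0"
    with Nle[of A] N(1) show "A \<in> sets N" "emeasure N A = 0" by auto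
  qed
  then obtain f where f: "f \<in> borel_measurable \<mu>" "density \<mu> f = N"
    using Radon_Nikodym[OF _ N(1)] by blast
  let ?c = "ennreal (b q)"
  define A where "A = {x\<in>space \<mu>. ?c < f x}"
  have A: "A \<in> sets \<mu>" unfolding A_def using f(1) by measurable
  have "(\<integral>\<^sup>+x. f x * indicator A x - ?c * indicator A x \<partial>\<mu>) = (\<integral>\<^sup>+x. f x * indicator A x \<partial>\<mu>) - (\<integral>\<^sup>+x. ?c * indicator A x \<partial>\<mu>)"
  proof (rule nn_integral_diff)
    have "(\<integral>\<^sup>+x. ?c * indicator A x \<partial>\<mu>) = ?c * emeasure \<mu> A"
      using A by (simp add: nn_integral_cmult_indicator)
    also have "\<dots> \<noteq> \<infinity>" by (simp add: ennreal_mult_eq_top_iff emeasure_finite)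
    finally show "(\<integral>\<^sup>+x. ?c * indicator A x \<partial>\<mu>) \<noteq> \<infinity>" .
    show "AE x in \<mu>. ?c * indicator A x \<le> f x * indicator A x"
      by (auto simp: A_def indicator_def)
    show "(\<lambda>x. f x * indicator A x) \<in> borel_measurable \<mu>" "(\<lambda>x. ?c * indicator A x) \<in> borel_measurable \<mu>"
      using f(1) A by measurable
  qed
  also have "(\<integral>\<^sup>+x. f x * indicator A x \<partial>\<mu>) = emeasure N A"
    unfolding f(2)[symmetric] by (rule emeasure_density[OF f(1) A, symmetric])
  also have "(\<integral>\<^sup>+x. ?c * indicator A x \<partial>\<mu>) = ?c * emeasure \<mu> A"
    using A by (simp add: nn_integral_cmult_indicator)
  also have "emeasure N A - ?c * emeasure \<mu> A = 0"
    using Nle[OF A] N(2)[OF A] by (simp add: diff_eq_0_iff_ennreal)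
  finally have "AE x in \<mu>. f x * indicator A x - ?c * indicator A x = 0"
    using f(1) A by (subst (asm) nn_integral_0_iff_AE) auto
  with AE_space have AE: "AE x in \<mu>. f x \<le> ?c"
  proof eventually_elim
    case (elim x)
    show ?case
    proof (rule ccontr)
      assume "\<not> f x \<le> ?c"
      with elim(1) have "x \<in> A" "?c < f x" by (auto simp: A_def)
      with elim(2) show False
        by (auto simp: diff_eq_0_iff_ennreal)
    qed
  qed
  define k where "k x = enn2real (min (f x) ?c)" for x
  have kk: "ennreal (k x) = min (f x) ?c" for x
  proof -
    have "min (f x) ?c \<le> ?c" by simp
    also have "\<dots> < top" by simp
    finally show ?thesis unfolding k_def by (rule ennreal_enn2real)
  qed
  show ?thesis
  proof (rule that)
    show "k \<in> borel_measurable \<mu>" unfolding k_def using f(1) by measurable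
    show "0 \<le> k x" for x by (simp add: k_def)
    have "ennreal (k x) \<le> ennreal (b q)" for x unfolding kk by simp
    then show "k x \<le> b q" for x using b_nonneg ennreal_le_iff by blast
    fix A assume A: "A \<in> sets \<mu>"
    have "ennreal (ext (\<lambda>x. q * indicator A x)) = (\<integral>\<^sup>+x. f x * indicator A x \<partial>\<mu>)"
      unfolding N(2)[OF A, symmetric] f(2)[symmetric] by (rule emeasure_density[OF f(1) A])
    also have "\<dots> = (\<integral>\<^sup>+x. ennreal (k x) * indicator A x \<partial>\<mu>)"
      using AE by (intro nn_integral_cong_AE) (auto simp: kk min_def)
    finally show "ennreal (ext (\<lambda>x. q * indicator A x)) = (\<integral>\<^sup>+x. ennreal (k x) * indicator A x \<partial>\<mu>)" .
  qed
qed

end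

text \<open>\<open>K q\<close> is a density for each level \<open>q\<close> separately; no
  assumption relates different levels directly.\<close>

locale valuation_kernel = controlled_valuation +
  fixes K :: "real \<Rightarrow> 'a \<Rightarrow> real"
  assumes K_meas: "0 \<le> q \<Longrightarrow> K q \<in> borel_measurable \<mu>"
    and K_nonneg: "0 \<le> q \<Longrightarrow> 0 \<le> K q x"
    and K_le: "0 \<le> q \<Longrightarrow> K q x \<le> b q"
    and K_ext: "0 \<le> q \<Longrightarrow> A \<in> sets \<mu> \<Longrightarrow>
      ennreal (ext (\<lambda>x. q * indicator A x)) = (\<integral>\<^sup>+x. ennreal (K q x) * indicator A x \<partial>\<mu>)"
begin

text \<open>No joint measurability of \<open>K\<close> is available; a countable range reduces the
  composition to countably many level sets.\<close>

lemma K_compose_measurable: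
  assumes F: "F \<in> bor B" and Q: "countable (F ` S)"
  shows "(\<lambda>x. K (F x) x) \<in> borel_measurable \<mu>"
proof (rule measurable_compose_countable'[where I = "F ` S" and f = K and g = F])
  show "F \<in> measurable \<mu> (count_space (F ` S))"
    unfolding measurable_count_space_eq_countable[OF Q]
    using measurable_sets[OF borD[OF F], of "{_}"] by auto
  show "K a \<in> borel_measurable \<mu>" if "a \<in> F ` S" for a
    using that F by (intro K_meas) (auto simp: bor_def)
qed (rule Q)

lemma K_compose_bounds:
  assumes "F \<in> bor B" "x \<in> S"
  shows "0 \<le> K (F x) x" "K (F x) x \<le> b B"
proof -
  have "0 \<le> F x" "F x \<le> B" using assms by (auto simp: bor_def)
  then show "0 \<le> K (F x) x" "K (F x) x \<le> b B"
    using K_nonneg[of "F x" x] K_le[of "F x" x] monoD[OF b_mono, of "F x" B] by auto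
qed

lemma K_compose_integrable:
  assumes F: "F \<in> bor B" and Q: "countable (F ` S)"
  shows "integrable \<mu> (\<lambda>x. K (F x) x)"
  using K_compose_bounds[OF F]
  by (intro integrable_const_bound[of _ "b B"] K_compose_measurable[OF F Q]) auto

text \<open>The localized measure of \<open>F\<close> and the measure with density
  \<open>K (F x) x\<close> agree on each level set of \<open>F\<close>, where \<open>F\<close> is
  constant, and \<open>S\<close> is the union of countably many level sets.\<close>

lemma ext_countable:
  assumes F: "F \<in> bor B" and B: "0 \<le> B" and Q: "countable (F ` S)"
  shows "ext F = (\<integral>x. K (F x) x \<partial>\<mu>)"
proof -
  obtain N where N: "sets N = sets \<mu>"
    "\<And>A. A \<in> sets \<mu> \<Longrightarrow> emeasure N A = ennreal (ext (\<lambda>x. F x * indicator A x))"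
    using ex_localized_measure[OF F B] by blast
  let ?D = "density \<mu> (\<lambda>x. ennreal (K (F x) x))"
  define X where "X q = {x\<in>S. F x = q}" for q
  have X: "X q \<in> sets \<mu>" for q
  proof -
    have "F -` {q} \<inter> space \<mu> \<in> sets \<mu>" using borD[OF F] by measurable
    moreover have "F -` {q} \<inter> space \<mu> = X q" by (auto simp: X_def)
    ultimately show ?thesis by simp
  qed
  have US: "S = (\<Union>q\<in>F ` S. X q)" by (auto simp: X_def)
  have dis: "disjoint_family_on X (F ` S)" by (auto simp: disjoint_family_on_def X_def)
  have km: "(\<lambda>x. ennreal (K (F x) x)) \<in> borel_measurable \<mu>"
    using K_compose_measurable[OF F Q] by measurable
  have "emeasure N (X q) = emeasure ?D (X q)" if "q \<in> F ` S" for q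
  proof -
    have q: "0 \<le> q" using that F by (auto simp: bor_def)
    have "ext (\<lambda>x. F x * indicator (X q) x) = ext (\<lambda>x. q * indicator (X q) x)"
      by (rule ext_cong[OF bor_indicator[OF F B X] B]) (auto simp: X_def indicator_def)
    then have "emeasure N (X q) = (\<integral>\<^sup>+x. ennreal (K q x) * indicator (X q) x \<partial>\<mu>)"
      using N(2)[OF X] K_ext[OF q X] by simp
    also have "\<dots> = (\<integral>\<^sup>+x. ennreal (K (F x) x) * indicator (X q) x \<partial>\<mu>)"
      by (intro nn_integral_cong) (auto simp: X_def indicator_def)
    also have "\<dots> = emeasure ?D (X q)" by (rule emeasure_density[OF km X, symmetric])
    finally show ?thesis .
  qed
  then have "(\<integral>\<^sup>+q. emeasure N (X q) \<partial>count_space (F ` S)) = (\<integral>\<^sup>+q. emeasure ?D (X q) \<partial>count_space (F ` S))"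
    by (intro nn_integral_cong) simp
  also have "(\<integral>\<^sup>+q. emeasure N (X q) \<partial>count_space (F ` S)) = emeasure N S"
    by (subst US, rule emeasure_UN_countable[symmetric]) (use X N(1) Q dis in auto)
  also have "(\<integral>\<^sup>+q. emeasure ?D (X q) \<partial>count_space (F ` S)) = emeasure ?D S"
    by (subst (2) US, rule emeasure_UN_countable[symmetric]) (use X Q dis in auto)
  finally have "ennreal (ext (\<lambda>x. F x * indicator S x)) = (\<integral>\<^sup>+x. ennreal (K (F x) x) * indicator S x \<partial>\<mu>)"
    using N(2)[OF S_sets] emeasure_density[OF km S_sets] by simp
  also have "ext (\<lambda>x. F x * indicator S x) = ext F"
    by (rule ext_cong[OF bor_indicator[OF F B S_sets] B]) simp
  also have "(\<integral>\<^sup>+x. ennreal (K (F x) x) * indicator S x \<partial>\<mu>) = (\<integral>\<^sup>+x. ennreal (K (F x) x) \<partial>\<mu>)"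
    by (intro nn_integral_cong) simp
  also have "\<dots> = ennreal (\<integral>x. K (F x) x \<partial>\<mu>)"
    using K_compose_bounds[OF F] by (intro nn_integral_eq_integral K_compose_integrable[OF F Q]) auto
  finally show ?thesis
    using ext_nonneg[OF F B] K_compose_bounds(1)[OF F]
    by (subst (asm) ennreal_inj) (auto intro!: Bochner_Integration.integral_nonneg)
qed


text \<open>On a set of positive measure where uniform continuity fails, the first level \<open>t(x)\<close> at which
  oscillation occurs is a measurable function, and the oscillation can be realised by rational levels
  converging uniformly to \<open>t\<close>, which contradicts continuity of the extended valuation.\<close>

lemma AE_oscillation:
  fixes n :: nat and e :: real
  assumes e: "0 < e"
  shows "AE x in \<mu>. \<exists>k :: nat. \<forall>p\<in>\<rat> \<inter> {0..real n}. \<forall>q\<in>\<rat> \<inter> {0..real n}.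
    \<bar>p - q\<bar> < 1 / real (Suc k) \<longrightarrow> K p x - K q x \<le> e"
proof -
  define R where "R = \<rat> \<inter> {0..real n}"
  have Rc: "countable R" unfolding R_def by (intro countable_Int1 countable_rat)
  have R0: "0 \<in> R" "real n \<in> R" and Rb: "\<And>r. r \<in> R \<Longrightarrow> 0 \<le> r \<and> r \<le> real n" unfolding R_def by auto
  \<comment> \<open>Only levels up to \<open>r\<close> enter, so \<open>bad\<close> is monotone in
    \<open>r\<close> and a first bad level makes sense.\<close>
  define bad where "bad r x \<longleftrightarrow> (\<forall>k :: nat. \<exists>p\<in>R. \<exists>q\<in>R. p \<le> r \<and> q \<le> r \<and>
    \<bar>p - q\<bar> < 1 / real (Suc k) \<and> e < K p x - K q x)" for r x
  have Km: "K r \<in> borel_measurable \<mu>" if "r \<in> R" for r using Rb[OF that] K_meas by auto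
  \<comment> \<open>Pairs of levels are enumerated so that \<open>bad\<close> is a countable
    combination of measurable conditions and a pair can be selected by its least index.\<close>
  define c where "c = from_nat_into (R \<times> R)"
  have cR: "c i \<in> R \<times> R" for i
    unfolding c_def using R0 by (intro from_nat_into) auto
  have fR: "fst (c i) \<in> R" "snd (c i) \<in> R" for i using cR[of i] by (auto simp: mem_Times_iff)
  have csurj: "\<exists>i. c i = (p, q)" if "p \<in> R" "q \<in> R" for p q
    unfolding c_def using that Rc from_nat_into_surj[of "R \<times> R" "(p, q)"] by auto
  have ex_pair: "(\<exists>p\<in>R. \<exists>q\<in>R. \<Phi> p q) \<longleftrightarrow> (\<exists>i. \<Phi> (fst (c i)) (snd (c i)))" for \<Phi>
  proof
    assume "\<exists>p\<in>R. \<exists>q\<in>R. \<Phi> p q"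
    then obtain p q where pq: "p \<in> R" "q \<in> R" "\<Phi> p q" by blast
    obtain i where "c i = (p, q)" using csurj[OF pq(1,2)] by blast
    with pq(3) show "\<exists>i. \<Phi> (fst (c i)) (snd (c i))" by (intro exI[of _ i]) simp
  qed (use fR in blast)
  have badm: "Measurable.pred \<mu> (bad r)" for r
  proof -
    have "bad r = (\<lambda>x. \<forall>k :: nat. \<exists>i. fst (c i) \<le> r \<and> snd (c i) \<le> r \<and>
      \<bar>fst (c i) - snd (c i)\<bar> < 1 / real (Suc k) \<and> e < K (fst (c i)) x - K (snd (c i)) x)"
      unfolding bad_def ex_pair by (rule refl)
    moreover have "Measurable.pred \<mu> (\<lambda>x. fst (c i) \<le> r \<and> snd (c i) \<le> r \<and>
      \<bar>fst (c i) - snd (c i)\<bar> < 1 / real (Suc k) \<and> e < K (fst (c i)) x - K (snd (c i)) x)" for i and k :: nat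
    proof -
      have "Measurable.pred \<mu> (\<lambda>x. e < K (fst (c i)) x - K (snd (c i)) x)"
        using borel_measurable_less[OF borel_measurable_const borel_measurable_diff[OF Km Km], of "fst (c i)" "snd (c i)" e] fR
        by (simp add: pred_def)
      then show ?thesis by (intro pred_intros_logic) simp_all
    qed
    ultimately show ?thesis by (simp only:) (intro pred_intros_countable)
  qed
  define A where "A = {x\<in>space \<mu>. bad (real n) x}"
  have A: "A \<in> sets \<mu>" unfolding A_def using badm by measurable
  \<comment> \<open>The infimum of the bad levels, written as an infimum of countably many
    measurable functions: levels that are not bad are replaced by the harmless value
    \<open>n\<close>.\<close>
  define t where "t x = (INF r\<in>R. if bad r x then r else real n)" for x
  have bdd: "bdd_below ((\<lambda>r. if bad r x then r else real n) ` R)" for x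
    by (rule bdd_belowI[of _ 0]) (use Rb in auto)
  have tm: "t \<in> borel_measurable \<mu>"
    unfolding t_def using badm by (intro borel_measurable_cINF Rc bdd) measurable
  have t0: "0 \<le> t x" for x
    unfolding t_def using Rb R0 by (intro cINF_greatest) auto
  have tle: "t x \<le> (if bad r x then r else real n)" if "r \<in> R" for r x
    unfolding t_def by (rule cINF_lower[OF bdd that])
  have tn: "t x \<le> real n" for x using tle[OF R0(2)] by (auto split: if_splits)
  \<comment> \<open>Some bad \<open>r\<close> lies below \<open>t x + \<eta>\<close>, and a level
    \<open>s\<close> just below \<open>t x\<close> is not bad. So pairs with large oscillation and
    small gap can be found below \<open>r\<close> but not both below \<open>s\<close>; the small gap
    then puts both within \<open>\<eta>\<close> of \<open>t x\<close>.\<close>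
  have near: "\<exists>p\<in>R. \<exists>q\<in>R. \<bar>p - t x\<bar> \<le> \<eta> \<and> \<bar>q - t x\<bar> \<le> \<eta> \<and> e < K p x - K q x"
    if x: "bad (real n) x" and \<eta>: "0 < \<eta>" for x \<eta>
  proof -
    have "(INF r\<in>R. if bad r x then r else real n) < t x + \<eta>" unfolding t_def using \<eta> by simp
    then obtain r1 where r1: "r1 \<in> R" "(if bad r1 x then r1 else real n) < t x + \<eta>"
      using R0 cINF_less_iff[OF _ bdd, of x] by blast
    obtain r where r: "bad r x" "r < t x + \<eta>"
      using r1 x by (cases "bad r1 x") auto
    obtain k0 :: nat where k0: "\<And>p q. p \<in> R \<Longrightarrow> q \<in> R \<Longrightarrow> \<bar>p - q\<bar> < 1 / real (Suc k0) \<Longrightarrow>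
      e < K p x - K q x \<Longrightarrow> t x - \<eta> / 2 \<le> p \<or> t x - \<eta> / 2 \<le> q"
    proof (cases "t x \<le> \<eta> / 2")
      case True
      then show ?thesis using Rb by (intro that[of 0]) force
    next
      case False
      then have "max 0 (t x - \<eta> / 2) < t x" using \<eta> by auto
      then obtain s where s: "s \<in> \<rat>" "max 0 (t x - \<eta> / 2) < s" "s < t x"
        using Rats_dense_in_real by blast
      then have "s \<in> R" using tn[of x] by (auto simp: R_def)
      then have "\<not> bad s x" using tle[of s x] s(3) by auto
      then obtain k :: nat where "\<And>p q. p \<in> R \<Longrightarrow> q \<in> R \<Longrightarrow> p \<le> s \<Longrightarrow> q \<le> s \<Longrightarrow>
        \<bar>p - q\<bar> < 1 / real (Suc k) \<Longrightarrow> \<not> e < K p x - K q x" unfolding bad_def by blast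
      then show ?thesis using s(2) by (intro that[of k]) (meson less_imp_le max.strict_boundedE nle_le order_trans)
    qed
    obtain k1 :: nat where k1: "1 / real (Suc k1) < \<eta> / 2"
      using nat_approx_posE[of "\<eta> / 2"] \<eta> by auto
    obtain p q where pq: "p \<in> R" "q \<in> R" "p \<le> r" "q \<le> r" "\<bar>p - q\<bar> < 1 / real (Suc (max k0 k1))" "e < K p x - K q x"
      using r(1) unfolding bad_def by blast
    have "1 / real (Suc (max k0 k1)) \<le> 1 / real (Suc k0)" "1 / real (Suc (max k0 k1)) \<le> 1 / real (Suc k1)"
      by (auto intro!: divide_left_mono)
    with pq(5) have d: "\<bar>p - q\<bar> < 1 / real (Suc k0)" "\<bar>p - q\<bar> < \<eta> / 2" using k1 by auto
    with k0[OF pq(1,2) d(1) pq(6)] pq(3,4) r(2)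
    have "\<bar>p - t x\<bar> \<le> \<eta>" "\<bar>q - t x\<bar> \<le> \<eta>" by linarith+
    with pq show ?thesis by blast
  qed
  define good where "good j i x \<longleftrightarrow> \<bar>fst (c i) - t x\<bar> \<le> 1 / real (Suc j) \<and> \<bar>snd (c i) - t x\<bar> \<le> 1 / real (Suc j) \<and>
    e < K (fst (c i)) x - K (snd (c i)) x" for j i :: nat and x
  have goodm: "Measurable.pred \<mu> (good j i)" for j i
    unfolding good_def using Km[OF fR(1)[of i]] Km[OF fR(2)[of i]] tm by measurable
  \<comment> \<open>The least index is a measurable selection.\<close>
  define l where "l j x = (LEAST i. good j i x)" for j x
  have lm: "l j \<in> measurable \<mu> (count_space UNIV)" for j
    unfolding l_def by (rule measurable_Least) (rule goodm)
  have gl: "good j (l j x) x" if "x \<in> A" for j x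
  proof -
    have "bad (real n) x" using that by (simp add: A_def)
    then obtain p q where "p \<in> R" "q \<in> R" "\<bar>p - t x\<bar> \<le> 1 / real (Suc j)" "\<bar>q - t x\<bar> \<le> 1 / real (Suc j)" "e < K p x - K q x"
      using near[of x "1 / real (Suc j)"] by auto
    then obtain i where "good j i x" using csurj[of p q] unfolding good_def by (metis fst_conv snd_conv)
    then show ?thesis unfolding l_def by (rule LeastI)
  qed
  \<comment> \<open>Off \<open>A\<close> both selections and their limit \<open>H\<close> are 0, so
    only \<open>A\<close> contributes to the difference of the integrals.\<close>
  define P where "P j x = (if x \<in> A then fst (c (l j x)) else 0)" for j x
  define Q where "Q j x = (if x \<in> A then snd (c (l j x)) else 0)" for j x
  define H where "H x = (if x \<in> A then t x else 0)" for x
  have PR: "P j x \<in> R" "Q j x \<in> R" for j x unfolding P_def Q_def using fR R0 by auto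
  have "(\<lambda>x. fst (c (l j x))) \<in> borel_measurable \<mu>" "(\<lambda>x. snd (c (l j x))) \<in> borel_measurable \<mu>" for j
    using measurable_compose[OF lm, of "\<lambda>i. fst (c i)"] measurable_compose[OF lm, of "\<lambda>i. snd (c i)"] by auto
  then have bor: "P j \<in> bor (real n)" "Q j \<in> bor (real n)" for j
    unfolding bor_def P_def Q_def using A Rb fR by (auto intro!: measurable_If_set)
  have Hb: "H \<in> bor (real n)"
    unfolding bor_def H_def using A tm t0 tn by (auto intro!: measurable_If_set)
  have cP: "countable (P j ` S)" "countable (Q j ` S)" for j
    using PR by (auto intro!: countable_subset[OF _ Rc])
  have PH: "\<bar>P j x - H x\<bar> \<le> 1 / real (Suc j)" "\<bar>Q j x - H x\<bar> \<le> 1 / real (Suc j)" for j x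
    using gl[of x j] unfolding P_def Q_def H_def good_def by auto
  \<comment> \<open>Both sequences converge uniformly to \<open>H\<close>, so the difference tends
    to 0, whereas the oscillation keeps it at least \<open>e * measure \<mu> A\<close>.\<close>
  have "(\<lambda>j. ext (P j) - ext (Q j)) \<longlonglongrightarrow> ext H - ext H"
    by (intro tendsto_diff ext_uniform_limit[OF bor(1) Hb] ext_uniform_limit[OF bor(2) Hb]
        uniform_limit_one_over_Suc[where c = 1]) (use PH in auto)
  moreover have "e * measure \<mu> A \<le> ext (P j) - ext (Q j)" for j
  proof -
    have "e * measure \<mu> A = (\<integral>x. e * indicator A x \<partial>\<mu>)"
      using A sets.sets_into_space[OF A] by (simp add: Int_absorb2)
    also have "\<dots> \<le> (\<integral>x. K (P j x) x - K (Q j x) x \<partial>\<mu>)"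
    proof (rule integral_mono)
      show "integrable \<mu> (\<lambda>x. e * indicator A x)"
        using A by (intro integrable_mult_right integrable_real_indicator) (auto simp: emeasure_finite less_top[symmetric])
      show "integrable \<mu> (\<lambda>x. K (P j x) x - K (Q j x) x)"
        by (intro Bochner_Integration.integrable_diff K_compose_integrable[OF bor(1) cP(1)] K_compose_integrable[OF bor(2) cP(2)])
      show "e * indicator A x \<le> K (P j x) x - K (Q j x) x" for x
        using gl[of x j] unfolding P_def Q_def good_def by (auto simp: indicator_def)
    qed
    also have "\<dots> = ext (P j) - ext (Q j)"
      using ext_countable[OF bor(1) _ cP(1)] ext_countable[OF bor(2) _ cP(2)]
        K_compose_integrable[OF bor(1) cP(1)] K_compose_integrable[OF bor(2) cP(2)] by simp
    finally show ?thesis .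
  qed
  ultimately have "e * measure \<mu> A \<le> 0"
    using LIMSEQ_le_const[of _ "ext H - ext H" "e * measure \<mu> A"] by auto
  then have "measure \<mu> A = 0" using e by (simp add: mult_le_0_iff zero_less_measure_iff measure_le_0_iff)
  then have "A \<in> null_sets \<mu>" using A by (simp add: emeasure_eq_measure null_sets_def)
  then have "AE x in \<mu>. x \<notin> A" by (rule AE_not_in)
  with AE_space show ?thesis
  proof eventually_elim
    case (elim x)
    then have "\<not> bad (real n) x" by (simp add: A_def)
    then show ?case unfolding bad_def R_def[symmetric] using Rb by (meson not_less)
  qed
qed

lemma AE_uniformly_continuous:
  "AE x in \<mu>. \<forall>n :: nat. uniformly_continuous_on (\<rat> \<inter> {0..real n}) (\<lambda>q. K q x)"
proof -
  have "AE x in \<mu>. \<forall>n m :: nat. \<exists>k :: nat. \<forall>p\<in>\<rat> \<inter> {0..real n}. \<forall>q\<in>\<rat> \<inter> {0..real n}.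
    \<bar>p - q\<bar> < 1 / real (Suc k) \<longrightarrow> K p x - K q x \<le> 1 / real (Suc m)"
    unfolding AE_all_countable by (intro allI AE_oscillation) simp
  then show ?thesis
  proof eventually_elim
    case (elim x)
    show ?case
      unfolding uniformly_continuous_on_def
    proof (intro allI impI)
      fix n :: nat and e :: real assume "0 < e"
      then obtain m :: nat where m: "1 / real (Suc m) < e" using nat_approx_posE by blast
      obtain k :: nat where k: "\<And>p q. p \<in> \<rat> \<inter> {0..real n} \<Longrightarrow> q \<in> \<rat> \<inter> {0..real n} \<Longrightarrow>
        \<bar>p - q\<bar> < 1 / real (Suc k) \<Longrightarrow> K p x - K q x \<le> 1 / real (Suc m)"
        using elim by meson
      have "dist (K p x) (K q x) < e" if "p \<in> \<rat> \<inter> {0..real n}" "q \<in> \<rat> \<inter> {0..real n}" "dist p q < 1 / real (Suc k)" for p q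
      proof -
        have "\<bar>p - q\<bar> < 1 / real (Suc k)" "\<bar>q - p\<bar> < 1 / real (Suc k)" using that(3) by (auto simp: dist_real_def)
        then have "K p x - K q x \<le> 1 / real (Suc m)" "K q x - K p x \<le> 1 / real (Suc m)"
          using k that(1,2) by blast+
        with m show ?thesis unfolding dist_real_def by linarith
      qed
      then show "\<exists>d>0. \<forall>y\<in>\<rat> \<inter> {0..real n}. \<forall>z\<in>\<rat> \<inter> {0..real n}. dist z y < d \<longrightarrow> dist (K z x) (K y x) < e"
        by (intro exI[of _ "1 / real (Suc k)"]) auto
    qed
  qed
qed

text \<open>\<open>f\<close> is rounded down to rational grids. On \<open>S0\<close> the kernels
  \<open>k\<close> and \<open>K\<close> agree at rational levels, so \<open>ext_countable\<close>
  gives the integrals; these converge by dominated convergence with the constant \<open>b B\<close>,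
  and the values of \<open>ext\<close> by \<open>ext_uniform_limit\<close>. As \<open>k\<close> is 0
  off \<open>S0\<close>, the composition is measurable for \<open>\<mu>\<close> itself.\<close>

lemma representation:
  fixes k :: "real \<Rightarrow> 'a \<Rightarrow> real"
  assumes S0: "S0 \<in> sets \<mu>" "AE x in \<mu>. x \<in> S0"
    and kc: "\<And>x. x \<in> S0 \<Longrightarrow> continuous_on {0..} (\<lambda>l. k l x)"
    and kK: "\<And>x q. x \<in> S0 \<Longrightarrow> q \<in> \<rat> \<Longrightarrow> 0 \<le> q \<Longrightarrow> k q x = K q x"
    and k0: "\<And>x l. x \<in> S - S0 \<Longrightarrow> k l x = 0"
    and f: "f \<in> cpos S"
  shows "has_bochner_integral \<mu> (\<lambda>x. k (f x) x) (V f)"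
proof -
  obtain B where B: "0 < B" "f \<in> cpos_le S B" by (rule cpos_imp_cpos_le[OF compact f])
  have fb: "f \<in> bor B" by (rule cpos_le_bor[OF B(2)])
  define p where "p j x = grid_floor j (f x)" for j x
  have p: "0 \<le> p j x" if "x \<in> S" for j x
    unfolding p_def using f that by (intro grid_floor_nonneg) (auto simp: cpos_def)
  have pR: "p j x \<in> \<rat>" for j x unfolding p_def by (rule grid_floor_Rats)
  have pb: "p j \<in> bor B" for j
    unfolding bor_def
  proof safe
    show "p j \<in> borel_measurable \<mu>" unfolding p_def grid_floor_def using borD[OF fb] by measurable
    fix x assume x: "x \<in> S"
    then show "0 \<le> p j x" by (rule p)
    show "p j x \<le> B"
      unfolding p_def using grid_floor_le[of j "f x"] B(2) x by (auto simp: cpos_le_def intro: order_trans)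
  qed
  have pc: "countable (p j ` S)" for j
    by (rule countable_subset[OF _ countable_rat]) (use pR in auto)
  have "uniform_limit S p f sequentially"
    by (rule uniform_limit_one_over_Suc[where c = 1]) (use grid_floor_diff in \<open>simp add: p_def\<close>)
  then have "(\<lambda>j. ext (p j)) \<longlonglongrightarrow> ext f"
    using B(1) by (intro ext_uniform_limit[OF pb fb]) auto
  moreover have "ext f = V f" using B by (intro ext_cont) auto
  ultimately have lim1: "(\<lambda>j. ext (p j)) \<longlonglongrightarrow> V f" by simp
  define s where "s j x = indicator S0 x * K (p j x) x" for j x
  have sm: "s j \<in> borel_measurable \<mu>" for j
    unfolding s_def using K_compose_measurable[OF pb pc] S0(1) by measurable
  have lim: "(\<lambda>j. s j x) \<longlonglongrightarrow> k (f x) x" if x: "x \<in> S" for x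
  proof (cases "x \<in> S0")
    case True
    have "(\<lambda>j. p j x) \<longlonglongrightarrow> f x"
      by (rule tendsto_one_over_Suc[where c = 1]) (use grid_floor_diff in \<open>simp add: p_def\<close>)
    then have "(\<lambda>j. k (p j x) x) \<longlonglongrightarrow> k (f x) x"
      by (rule continuous_on_tendsto_compose[OF kc[OF True]])
         (use p[OF x] f x in \<open>auto simp: cpos_def\<close>)
    moreover have "s j x = k (p j x) x" for j
      using True kK[OF True pR p(1)[OF x]] by (simp add: s_def)
    ultimately show ?thesis by simp
  qed (use x k0 in \<open>simp add: s_def\<close>)
  have km: "(\<lambda>x. k (f x) x) \<in> borel_measurable \<mu>"
    by (rule borel_measurable_LIMSEQ_real[OF _ sm]) (use lim in auto)
  have sb: "AE x in \<mu>. norm (s j x) \<le> b B" for j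
    using K_compose_bounds[OF pb] b_nonneg[of B] by (auto simp: s_def indicator_def)
  have AElim: "AE x in \<mu>. (\<lambda>j. s j x) \<longlonglongrightarrow> k (f x) x" using lim by auto
  note dc = integrable_dominated_convergence[OF km sm _ AElim sb] integral_dominated_convergence[OF km sm _ AElim sb]
  have "integral\<^sup>L \<mu> (s j) = ext (p j)" for j
  proof -
    have "integral\<^sup>L \<mu> (s j) = (\<integral>x. K (p j x) x \<partial>\<mu>)"
      using S0(2) by (intro integral_cong_AE sm K_compose_measurable[OF pb pc]) (auto simp: s_def)
    then show ?thesis using ext_countable[OF pb _ pc] B(1) by simp
  qed
  with dc(2) lim1 have "(\<integral>x. k (f x) x \<partial>\<mu>) = V f"
    using LIMSEQ_unique by fastforce
  with dc(1) show ?thesis by (simp add: has_bochner_integral_iff)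
qed

end

section \<open>Sums of measures\<close>

text \<open>\<open>valuation\<close> equates sums of measures on sets, whereas the functionals
  \<open>V g\<close> are integrals; the identity passes to integrals by induction on measurable
  functions.\<close>

lemma nn_integral_measure_sum_eq:
  assumes sets: "sets M2 = sets M1" "sets M3 = sets M1" "sets M4 = sets M1"
    and eq: "\<And>A. A \<in> sets M1 \<Longrightarrow> emeasure M1 A + emeasure M2 A = emeasure M3 A + emeasure M4 A"
    and u: "u \<in> borel_measurable M1"
  shows "(\<integral>\<^sup>+x. u x \<partial>M1) + (\<integral>\<^sup>+x. u x \<partial>M2) = (\<integral>\<^sup>+x. u x \<partial>M3) + (\<integral>\<^sup>+x. u x \<partial>M4)"
  using u
proof (induction rule: borel_measurable_induct)
  case (cong f g)
  have sp: "space M2 = space M1" "space M3 = space M1" "space M4 = space M1"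
    using sets by (auto dest: sets_eq_imp_space_eq)
  have "(\<integral>\<^sup>+x. f x \<partial>M) = (\<integral>\<^sup>+x. g x \<partial>M)" if "space M = space M1" for M
    using cong(3) that by (intro nn_integral_cong) auto
  with cong(4) sp show ?case by simp
next
  case (set A)
  then show ?case using eq[of A] sets by simp
next
  case (mult u c)
  then show ?case
    using sets by (simp add: nn_integral_cmult measurable_cong_sets[OF sets(1) refl] measurable_cong_sets[OF sets(2) refl]
      measurable_cong_sets[OF sets(3) refl] flip: distrib_left)
next
  case (add u v)
  have m: "w \<in> borel_measurable M2" "w \<in> borel_measurable M3" "w \<in> borel_measurable M4"
    if "w \<in> borel_measurable M1" for w :: "'a \<Rightarrow> ennreal"
    using that by (simp_all add: measurable_cong_sets[OF sets(1) refl] measurable_cong_sets[OF sets(2) refl]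
      measurable_cong_sets[OF sets(3) refl])
  have "(\<integral>\<^sup>+x. v x + u x \<partial>M1) + (\<integral>\<^sup>+x. v x + u x \<partial>M2) =
    ((\<integral>\<^sup>+x. v x \<partial>M1) + (\<integral>\<^sup>+x. v x \<partial>M2)) + ((\<integral>\<^sup>+x. u x \<partial>M1) + (\<integral>\<^sup>+x. u x \<partial>M2))"
    unfolding nn_integral_add[OF add(3,1)] nn_integral_add[OF m(1)[OF add(3)] m(1)[OF add(1)]] by (simp only: ac_simps)
  also have "\<dots> = ((\<integral>\<^sup>+x. v x \<partial>M3) + (\<integral>\<^sup>+x. v x \<partial>M4)) + ((\<integral>\<^sup>+x. u x \<partial>M3) + (\<integral>\<^sup>+x. u x \<partial>M4))"
    using add(6,7) by simp
  also have "\<dots> = (\<integral>\<^sup>+x. v x + u x \<partial>M3) + (\<integral>\<^sup>+x. v x + u x \<partial>M4)"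
    unfolding nn_integral_add[OF m(2)[OF add(3)] m(2)[OF add(1)]] nn_integral_add[OF m(3)[OF add(3)] m(3)[OF add(1)]] by (simp only: ac_simps)
  finally show ?case by simp
next
  case (seq U)
  have m: "U i \<in> borel_measurable M2" "U i \<in> borel_measurable M3" "U i \<in> borel_measurable M4" for i
    using seq(1) by (simp_all add: measurable_cong_sets[OF sets(1) refl] measurable_cong_sets[OF sets(2) refl]
      measurable_cong_sets[OF sets(3) refl])
  have inc: "incseq (\<lambda>i. \<integral>\<^sup>+x. U i x \<partial>M)" for M
    using seq by (auto simp: incseq_def le_fun_def intro!: nn_integral_mono)
  have S: "(\<integral>\<^sup>+x. (SUP i. U i) x \<partial>M) = (SUP i. \<integral>\<^sup>+x. U i x \<partial>M)" if "\<And>i. U i \<in> borel_measurable M" for M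
    using nn_integral_monotone_convergence_SUP[OF _ that] seq by (simp add: image_comp)
  show ?case
    unfolding S[OF seq(1)] S[OF m(1)] S[OF m(2)] S[OF m(3)]
    unfolding ennreal_SUP_add[OF inc inc, symmetric] using seq by simp
qed

lemma integral_measure_sum_eq:
  assumes sets: "sets M2 = sets M1" "sets M3 = sets M1" "sets M4 = sets M1"
    and fin: "finite_measure M1" "finite_measure M2" "finite_measure M3" "finite_measure M4"
    and eq: "\<And>A. A \<in> sets M1 \<Longrightarrow> emeasure M1 A + emeasure M2 A = emeasure M3 A + emeasure M4 A"
    and u: "u \<in> borel_measurable M1" "\<And>x. x \<in> space M1 \<Longrightarrow> 0 \<le> u x \<and> u x \<le> (B :: real)"
  shows "(\<integral>x. u x \<partial>M1) + (\<integral>x. u x \<partial>M2) = (\<integral>x. u x \<partial>M3) + (\<integral>x. u x \<partial>M4)"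
proof -
  have *: "(\<integral>\<^sup>+x. ennreal (u x) \<partial>M) = ennreal (\<integral>x. u x \<partial>M)" "0 \<le> (\<integral>x. u x \<partial>M)"
    if M: "sets M = sets M1" "finite_measure M" for M
  proof -
    have sp: "space M = space M1" using M(1) by (rule sets_eq_imp_space_eq)
    have um: "u \<in> borel_measurable M" using u(1) by (simp add: measurable_cong_sets[OF M(1) refl])
    have "integrable M u"
      by (rule finite_measure.integrable_const_bound[OF M(2) _ um, of B]) (use u(2) sp in auto)
    then show "(\<integral>\<^sup>+x. ennreal (u x) \<partial>M) = ennreal (\<integral>x. u x \<partial>M)"
      using u(2) sp by (intro nn_integral_eq_integral) auto
    show "0 \<le> (\<integral>x. u x \<partial>M)" using u(2) sp by (intro Bochner_Integration.integral_nonneg) auto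
  qed
  have "ennreal (\<integral>x. u x \<partial>M1) + ennreal (\<integral>x. u x \<partial>M2) = ennreal (\<integral>x. u x \<partial>M3) + ennreal (\<integral>x. u x \<partial>M4)"
    unfolding *(1)[OF refl fin(1), symmetric] *(1)[OF sets(1) fin(2), symmetric]
      *(1)[OF sets(2) fin(3), symmetric] *(1)[OF sets(3) fin(4), symmetric]
    by (rule nn_integral_measure_sum_eq[OF sets eq]) (use u(1) in auto)
  then show ?thesis
    using *(2)[OF refl fin(1)] *(2)[OF sets(1) fin(2)] *(2)[OF sets(2) fin(3)] *(2)[OF sets(3) fin(4)]
    by (simp add: ennreal_plus[symmetric] del: ennreal_plus)
qed

section \<open>A countable dense cone of non-negative functions\<close>

text \<open>Polynomials with rational coefficients as syntax trees: the functions are countably many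
  because the trees are.\<close>

datatype rpoly = RConst rat | RVar nat | RAdd rpoly rpoly | RMult rpoly rpoly

instance rpoly :: countable
  by countable_datatype

primrec reval :: "rpoly \<Rightarrow> 'a::euclidean_space \<Rightarrow> real" where
  "reval (RConst c) x = real_of_rat c"
| "reval (RVar i) x = x \<bullet> from_nat_into Basis i"
| "reval (RAdd p q) x = reval p x + reval q x"
| "reval (RMult p q) x = reval p x * reval q x"

lemma continuous_on_reval: "continuous_on S (reval p)"
  by (induction p) (auto intro!: continuous_intros)

text \<open>Functions uniformly approximable on \<open>S\<close> are closed under sums and products
  and include constants and coordinates, hence all real polynomials; Stone-Weierstrass does the
  rest.\<close>

lemma reval_dense:
  fixes f :: "'a::euclidean_space \<Rightarrow> real"
  assumes S: "compact S" and f: "continuous_on S f" and e: "0 < e"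
  obtains p :: "rpoly" where "\<And>x. x \<in> S \<Longrightarrow> \<bar>f x - reval p x\<bar> < e"
proof -
  define P where "P g \<longleftrightarrow> continuous_on S g \<and> (\<forall>e>0. \<exists>p :: rpoly. \<forall>x\<in>S. \<bar>g x - reval p x\<bar> < e)" for g :: "'a \<Rightarrow> real"
  have const: "P (\<lambda>x. c)" for c
    unfolding P_def
  proof (intro conjI allI impI)
    fix e :: real assume "0 < e"
    then obtain q where "c - e < real_of_rat q" "real_of_rat q < c + e"
      using of_rat_dense[of "c - e" "c + e"] by auto
    then show "\<exists>p :: rpoly. \<forall>x\<in>S. \<bar>c - reval p x\<bar> < e"
      by (intro exI[of _ "RConst q"]) auto
  qed auto
  have add: "P (\<lambda>x. g x + h x)" if "P g" "P h" for g h
    unfolding P_def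
  proof (intro conjI allI impI)
    show "continuous_on S (\<lambda>x. g x + h x)" using that by (auto simp: P_def intro!: continuous_intros)
    fix e :: real assume "0 < e"
    then obtain p q :: "rpoly" where "\<And>x. x \<in> S \<Longrightarrow> \<bar>g x - reval p x\<bar> < e / 2" "\<And>x. x \<in> S \<Longrightarrow> \<bar>h x - reval q x\<bar> < e / 2"
      using \<open>P g\<close> \<open>P h\<close> unfolding P_def by (meson half_gt_zero)
    then show "\<exists>p :: rpoly. \<forall>x\<in>S. \<bar>g x + h x - reval p x\<bar> < e"
      by (intro exI[of _ "RAdd p q"]) (force simp: abs_if split: if_splits)
  qed
  have bdd: "\<exists>B>0. \<forall>x\<in>S. \<bar>g x\<bar> \<le> B" if "continuous_on S g" for g :: "'a \<Rightarrow> real"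
    using bounded_pos[of "g ` S"] compact_imp_bounded[OF compact_continuous_image[OF that S]] by auto
  have mult: "P (\<lambda>x. g x * h x)" if g: "P g" and h: "P h" for g h
    unfolding P_def
  proof (intro conjI allI impI)
    show "continuous_on S (\<lambda>x. g x * h x)" using that by (auto simp: P_def intro!: continuous_intros)
    fix e :: real assume e: "0 < e"
    obtain B where B: "0 < B" "\<And>x. x \<in> S \<Longrightarrow> \<bar>g x\<bar> \<le> B" using bdd[of g] g unfolding P_def by blast
    \<comment> \<open>The order of choices matters: \<open>q\<close> first, then a bound
      \<open>C\<close> for it, then \<open>p\<close> with accuracy
      \<open>e / (2 * C)\<close>.\<close>
    obtain q :: "rpoly" where q: "\<And>x. x \<in> S \<Longrightarrow> \<bar>h x - reval q x\<bar> < e / (2 * B)"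
      using h e B unfolding P_def by (meson divide_pos_pos mult_pos_pos zero_less_numeral)
    obtain C where C: "0 < C" "\<And>x. x \<in> S \<Longrightarrow> \<bar>reval q x\<bar> \<le> C" using bdd[OF continuous_on_reval] by blast
    obtain p :: "rpoly" where p: "\<And>x. x \<in> S \<Longrightarrow> \<bar>g x - reval p x\<bar> < e / (2 * C)"
      using g e C unfolding P_def by (meson divide_pos_pos mult_pos_pos zero_less_numeral)
    have "\<bar>g x * h x - reval (RMult p q) x\<bar> < e" if "x \<in> S" for x
    proof -
      have "g x * h x - reval (RMult p q) x = g x * (h x - reval q x) + (g x - reval p x) * reval q x"
        by (simp add: algebra_simps)
      then have "\<bar>g x * h x - reval (RMult p q) x\<bar> \<le> \<bar>g x\<bar> * \<bar>h x - reval q x\<bar> + \<bar>g x - reval p x\<bar> * \<bar>reval q x\<bar>"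
        by (metis abs_mult abs_triangle_ineq)
      also have "\<dots> \<le> B * \<bar>h x - reval q x\<bar> + \<bar>g x - reval p x\<bar> * C"
        using B C that by (intro add_mono mult_right_mono mult_left_mono) auto
      also have "\<dots> < B * (e / (2 * B)) + (e / (2 * C)) * C"
        using B C p[OF that] q[OF that] by (intro add_strict_mono mult_strict_left_mono mult_strict_right_mono) auto
      also have "\<dots> = e" using B C by simp
      finally show ?thesis .
    qed
    then show "\<exists>p :: rpoly. \<forall>x\<in>S. \<bar>g x * h x - reval p x\<bar> < e" by blast
  qed
  have coord: "P (\<lambda>x. x \<bullet> b)" if b: "b \<in> Basis" for b
  proof -
    obtain i where "from_nat_into Basis i = b"
      using from_nat_into_surj[OF countable_finite[OF finite_Basis] b] by blast
    then have eq: "reval (RVar i) x = x \<bullet> b" for x :: 'a by simp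
    show ?thesis
      unfolding P_def
    proof (intro conjI allI impI)
      fix e :: real assume "0 < e"
      then show "\<exists>p :: rpoly. \<forall>x\<in>S. \<bar>x \<bullet> b - reval p x\<bar> < e"
        using eq by (intro exI[of _ "RVar i"]) auto
    qed (auto intro!: continuous_intros)
  qed
  have Psum: "P (\<lambda>x. \<Sum>b\<in>A. g b x)" if "finite A" "\<And>b. b \<in> A \<Longrightarrow> P (g b)" for A :: "'a set" and g
    using that by (induction A rule: finite_induct) (auto intro: const add)
  have "P g" if "real_polynomial_function g" for g
    using that
  proof induction
    case (linear g)
    then interpret bounded_linear g .
    have "g = (\<lambda>x. \<Sum>b\<in>Basis. g b * (x \<bullet> b))"
    proof
      fix x
      have "g x = g (\<Sum>b\<in>Basis. (x \<bullet> b) *\<^sub>R b)" by (simp add: euclidean_representation)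
      also have "\<dots> = (\<Sum>b\<in>Basis. g b * (x \<bullet> b))" by (simp add: sum scale mult.commute)
      finally show "g x = (\<Sum>b\<in>Basis. g b * (x \<bullet> b))" .
    qed
    moreover have "P (\<lambda>x. \<Sum>b\<in>Basis. g b * (x \<bullet> b))"
      using Psum[where A = Basis and g = "\<lambda>b x. g b * (x \<bullet> b)"] mult[OF const coord] by auto
    ultimately show ?case by simp
  qed (auto intro: const add mult)
  moreover obtain g where "real_polynomial_function g" "\<And>x. x \<in> S \<Longrightarrow> \<bar>f x - g x\<bar> < e / 2"
    using Stone_Weierstrass_real_polynomial_function[OF S f, of "e / 2"] e by auto
  ultimately obtain p :: "rpoly" where "\<And>x. x \<in> S \<Longrightarrow> \<bar>g x - reval p x\<bar> < e / 2"
    "\<And>x. x \<in> S \<Longrightarrow> \<bar>f x - g x\<bar> < e / 2"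
    unfolding P_def using e by (meson half_gt_zero)
  then show ?thesis by (intro that[of p]) (force simp: abs_if split: if_splits)
qed

definition ratcone :: "'a::euclidean_space set \<Rightarrow> ('a \<Rightarrow> real) set" where
  "ratcone S = {d. d \<in> range reval \<and> (\<forall>x\<in>S. 0 \<le> d x)}"

lemma countable_ratcone: "countable (ratcone S)"
  unfolding ratcone_def by (rule countable_subset[of _ "range reval"]) auto

lemma ratcone_cpos: "d \<in> ratcone S \<Longrightarrow> d \<in> cpos S"
  by (auto simp: ratcone_def cpos_def intro: continuous_on_reval)

lemma ratcone_const: "0 \<le> c \<Longrightarrow> (\<lambda>x. real_of_rat c) \<in> ratcone S"
  unfolding ratcone_def by (auto intro!: image_eqI[of _ _ "RConst c"])

lemma ratcone_add: "d \<in> ratcone S \<Longrightarrow> e \<in> ratcone S \<Longrightarrow> (\<lambda>x. d x + e x) \<in> ratcone S"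
  unfolding ratcone_def by (auto intro!: image_eqI[of _ _ "RAdd _ _"])

text \<open>Differences are what makes a non-negative additive functional on the cone
  monotone.\<close>

lemma ratcone_diff:
  assumes "d \<in> ratcone S" "e \<in> ratcone S" "\<And>x. x \<in> S \<Longrightarrow> d x \<le> e x"
  shows "(\<lambda>x. e x - d x) \<in> ratcone S"
proof -
  obtain p q where "d = reval p" "e = reval q" using assms by (auto simp: ratcone_def)
  then have "(\<lambda>x. e x - d x) = reval (RAdd q (RMult (RConst (-1)) p))" by (auto simp: of_rat_minus)
  then have "(\<lambda>x. e x - d x) \<in> range reval" by (rule range_eqI)
  with assms(3) show ?thesis by (simp add: ratcone_def)
qed

text \<open>Shifting \<open>f\<close> by \<open>e / 2\<close> before approximating puts the
  polynomial above \<open>f\<close>, so it is non-negative on \<open>S\<close> and a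
  majorant.\<close>

lemma ratcone_dense:
  assumes S: "compact S" and f: "f \<in> cpos S" and e: "0 < e"
  obtains d where "d \<in> ratcone S" "\<And>x. x \<in> S \<Longrightarrow> f x < d x" "\<And>x. x \<in> S \<Longrightarrow> d x < f x + e"
proof -
  have "continuous_on S (\<lambda>x. f x + e / 2)" using f by (auto simp: cpos_def intro!: continuous_intros)
  then obtain p where p: "\<And>x. x \<in> S \<Longrightarrow> \<bar>f x + e / 2 - reval p x\<bar> < e / 2"
    using reval_dense[OF S, of _ "e / 2"] e by auto
  have b: "f x < reval p x" "reval p x < f x + e" if "x \<in> S" for x using p[OF that] by linarith+
  have "0 \<le> reval p x" if "x \<in> S" for x using b(1)[OF that] f that by (auto simp: cpos_def intro: order_trans)
  then show ?thesis using b by (intro that[of "reval p"]) (auto simp: ratcone_def)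
qed

text \<open>\<open>\<Phi> g\<close> is the infimum of \<open>\<kappa>\<close> over the majorants of
  \<open>g\<close> in the cone. Superadditivity is the point: a majorant of \<open>g + h\<close>
  dominates, up to a small constant, a sum of majorants of \<open>g\<close> and \<open>h\<close>,
  and \<open>const\<close> makes the value of that constant small.\<close>

lemma Riesz_representation_ratcone:
  fixes S :: "'a::euclidean_space set" and \<kappa> :: "('a \<Rightarrow> real) \<Rightarrow> real"
  assumes S: "compact S" "S \<noteq> {}"
    and nonneg: "\<And>d. d \<in> ratcone S \<Longrightarrow> 0 \<le> \<kappa> d"
    and add: "\<And>d e. d \<in> ratcone S \<Longrightarrow> e \<in> ratcone S \<Longrightarrow> \<kappa> (\<lambda>x. d x + e x) = \<kappa> d + \<kappa> e"
    and const: "\<And>c. 0 \<le> c \<Longrightarrow> \<kappa> (\<lambda>x. real_of_rat c) \<le> real_of_rat c * \<beta>"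
  obtains M where "sets M = sets (restrict_space borel S)" "finite_measure M"
    "\<And>d. d \<in> ratcone S \<Longrightarrow> integral\<^sup>L M d = \<kappa> d"
proof -
  have mono: "\<kappa> d \<le> \<kappa> e" if "d \<in> ratcone S" "e \<in> ratcone S" "\<And>x. x \<in> S \<Longrightarrow> d x \<le> e x" for d e
  proof -
    have r: "(\<lambda>x. e x - d x) \<in> ratcone S" using that by (rule ratcone_diff)
    from add[OF that(1) r] nonneg[OF r] show ?thesis by simp
  qed
  have \<beta>: "0 \<le> \<beta>" using nonneg[OF ratcone_const[of 1]] const[of 1] by simp
  define X where "X g = {d \<in> ratcone S. \<forall>x\<in>S. g x \<le> d x}" for g
  define \<Phi> where "\<Phi> g = (INF d\<in>X g. \<kappa> d)" for g
  have Xd: "d \<in> ratcone S" if "d \<in> X g" for d g using that by (simp add: X_def)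
  have ne: "X g \<noteq> {}" if g: "g \<in> cpos S" for g
  proof -
    obtain B where B: "0 < B" "g \<in> cpos_le S B" by (rule cpos_imp_cpos_le[OF S(1) g])
    obtain c where c: "B < real_of_rat c" using of_rat_dense[of B "B + 1"] by auto
    then have "0 \<le> real_of_rat c" using B(1) by linarith
    then have "0 \<le> c" by simp
    then have "(\<lambda>x. real_of_rat c) \<in> X g"
      unfolding X_def using B(2) c ratcone_const by (force simp: cpos_le_def)
    then show ?thesis by blast
  qed
  have bdd: "bdd_below (\<kappa> ` X g)" for g
    by (rule bdd_belowI[of _ 0]) (use Xd nonneg in auto)
  have lower: "\<Phi> g \<le> \<kappa> d" if "d \<in> X g" for g d
    unfolding \<Phi>_def by (rule cINF_lower[OF bdd that])
  have \<Phi>\<kappa>: "\<Phi> d = \<kappa> d" if d: "d \<in> ratcone S" for d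
  proof (rule antisym)
    show "\<Phi> d \<le> \<kappa> d" using d by (intro lower) (simp add: X_def)
    show "\<kappa> d \<le> \<Phi> d"
      unfolding \<Phi>_def by (intro cINF_greatest ne ratcone_cpos d) (auto simp: X_def intro: mono d)
  qed
  obtain M where M: "sets M = sets (restrict_space borel S)" "finite_measure M"
    "\<And>f. f \<in> cpos S \<Longrightarrow> integral\<^sup>L M f = \<Phi> f"
  proof (rule Riesz_representation_compact[OF S(1), of \<Phi>])
    show "\<Phi> f = \<Phi> g" if "\<And>x. x \<in> S \<Longrightarrow> f x = g x" for f g
    proof -
      have "X f = X g" unfolding X_def using that by auto
      then show ?thesis by (simp add: \<Phi>_def)
    qed
    show "0 \<le> \<Phi> f" if "f \<in> cpos S" for f
      unfolding \<Phi>_def by (intro cINF_greatest ne that nonneg Xd)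
    fix g h assume g: "g \<in> cpos S" and h: "h \<in> cpos S"
    have gh: "(\<lambda>x. g x + h x) \<in> cpos S" using g h by (auto simp: cpos_def intro!: continuous_intros)
    have 1: "\<Phi> (\<lambda>x. g x + h x) \<le> \<kappa> d + \<kappa> e" if "d \<in> X g" "e \<in> X h" for d e
    proof -
      have "(\<lambda>x. d x + e x) \<in> X (\<lambda>x. g x + h x)"
        using that by (auto simp: X_def intro: ratcone_add add_mono)
      from lower[OF this] add[OF Xd[OF that(1)] Xd[OF that(2)]] show ?thesis by simp
    qed
    have "\<Phi> (\<lambda>x. g x + h x) - \<kappa> d \<le> \<Phi> h" if "d \<in> X g" for d
      unfolding \<Phi>_def[of h] using 1[OF that] by (intro cINF_greatest ne h) (auto simp: algebra_simps)
    then have "\<Phi> (\<lambda>x. g x + h x) - \<Phi> h \<le> \<Phi> g"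
      unfolding \<Phi>_def[of g] by (intro cINF_greatest ne g) (auto simp: algebra_simps)
    moreover have "\<Phi> g + \<Phi> h \<le> \<Phi> (\<lambda>x. g x + h x)"
      unfolding \<Phi>_def[of "\<lambda>x. g x + h x"]
    proof (intro cINF_greatest ne gh)
      fix d assume d: "d \<in> X (\<lambda>x. g x + h x)"
      have est: "\<Phi> g + \<Phi> h \<le> \<kappa> d + 2 / real (Suc n) * \<beta>" for n
      proof -
        \<comment> \<open>Each of the two approximations from above overshoots by less than
          \<open>1 / (n + 1)\<close>.\<close>
        let ?c = "2 / of_nat (Suc n) :: rat"
        have c: "real_of_rat ?c = 2 / real (Suc n)" by (simp add: of_rat_divide of_rat_add)
        obtain e where e: "e \<in> ratcone S" "\<And>x. x \<in> S \<Longrightarrow> g x < e x" "\<And>x. x \<in> S \<Longrightarrow> e x < g x + 1 / real (Suc n)"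
          using ratcone_dense[OF S(1) g, of "1 / real (Suc n)"] by auto
        obtain e' where e': "e' \<in> ratcone S" "\<And>x. x \<in> S \<Longrightarrow> h x < e' x" "\<And>x. x \<in> S \<Longrightarrow> e' x < h x + 1 / real (Suc n)"
          using ratcone_dense[OF S(1) h, of "1 / real (Suc n)"] by auto
        have rc: "(\<lambda>x. real_of_rat ?c) \<in> ratcone S" by (rule ratcone_const) simp
        have "\<Phi> g + \<Phi> h \<le> \<kappa> e + \<kappa> e'"
          using e(1,2) e'(1,2) by (intro add_mono lower) (auto simp: X_def less_imp_le)
        also have "\<dots> = \<kappa> (\<lambda>x. e x + e' x)" using add[OF e(1) e'(1)] by simp
        also have "\<dots> \<le> \<kappa> (\<lambda>x. d x + real_of_rat ?c)"
        proof (intro mono ratcone_add e(1) e'(1) Xd[OF d] rc)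
          fix x assume x: "x \<in> S"
          then have "g x + h x \<le> d x" using d by (auto simp: X_def)
          with e(3)[OF x] e'(3)[OF x] show "e x + e' x \<le> d x + real_of_rat ?c"
            unfolding c by linarith
        qed
        also have "\<dots> = \<kappa> d + \<kappa> (\<lambda>x. real_of_rat ?c)" by (rule add[OF Xd[OF d] rc])
        also have "\<dots> \<le> \<kappa> d + 2 / real (Suc n) * \<beta>" using const[of ?c] unfolding c by simp
        finally show ?thesis .
      qed
      have "(\<lambda>n. \<kappa> d + 2 * (1 / real (Suc n)) * \<beta>) \<longlonglongrightarrow> \<kappa> d + 2 * 0 * \<beta>"
        by (intro tendsto_intros LIMSEQ_Suc[OF lim_1_over_n])
      then show "\<Phi> g + \<Phi> h \<le> \<kappa> d"
        using est by (intro LIMSEQ_le_const[where X = "\<lambda>n. \<kappa> d + 2 * (1 / real (Suc n)) * \<beta>"]) auto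
    qed
    ultimately show "\<Phi> (\<lambda>x. g x + h x) = \<Phi> g + \<Phi> h" by linarith
  qed blast
  have "integral\<^sup>L M d = \<kappa> d" if "d \<in> ratcone S" for d
    using M(3)[OF ratcone_cpos[OF that]] \<Phi>\<kappa>[OF that] by simp
  then show ?thesis by (rule that[OF M(1,2)])
qed

section \<open>Measure-valued valuations\<close>

lemma
  fixes S :: "'a::euclidean_space set" and g :: "'a \<Rightarrow> real"
  assumes M: "sets M = sets (restrict_space borel S)" "finite_measure M"
    and g: "continuous_on S g" "\<And>x. x \<in> S \<Longrightarrow> \<bar>g x\<bar> \<le> B"
  shows integrable_bounded_on: "integrable M g"
    and integral_bounded_on: "\<bar>\<integral>x. g x \<partial>M\<bar> \<le> B * measure M S"
proof -
  interpret finite_measure M by fact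
  have sp: "space M = S"
    using sets_eq_imp_space_eq[OF M(1)] by (simp add: space_restrict_space)
  have gm: "g \<in> borel_measurable M"
    unfolding measurable_cong_sets[OF M(1) refl] by (rule borel_measurable_continuous_on_restrict[OF g(1)])
  show i: "integrable M g"
    by (rule integrable_const_bound[of _ B]) (use g(2) gm sp in auto)
  have "\<bar>\<integral>x. g x \<partial>M\<bar> \<le> (\<integral>x. \<bar>g x\<bar> \<partial>M)" by (rule integral_abs_bound)
  also have "\<dots> \<le> (\<integral>x. B \<partial>M)"
    using i g(2) sp by (intro integral_mono) auto
  also have "\<dots> = B * measure M S" using sp by simp
  finally show "\<bar>\<integral>x. g x \<partial>M\<bar> \<le> B * measure M S" .
qed

lemma compact_bounded_real:
  fixes g :: "'a::topological_space \<Rightarrow> real"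
  assumes "compact S" "continuous_on S g"
  obtains n :: nat where "\<And>x. x \<in> S \<Longrightarrow> \<bar>g x\<bar> \<le> real n"
proof -
  obtain B where "\<forall>y\<in>g ` S. norm y \<le> B"
    using bounded_pos[of "g ` S"] compact_imp_bounded[OF compact_continuous_image[OF assms(2,1)]] by auto
  moreover obtain n :: nat where "B \<le> real n" using real_arch_simple by blast
  ultimately show ?thesis by (intro that[of n]) force
qed

lemma integrable_on_compact:
  fixes S :: "'a::euclidean_space set" and g :: "'a \<Rightarrow> real"
  assumes "compact S" "sets M = sets (restrict_space borel S)" "finite_measure M" "continuous_on S g"
  shows "integrable M g"
proof -
  obtain n :: nat where "\<And>x. x \<in> S \<Longrightarrow> \<bar>g x\<bar> \<le> real n"
    using compact_bounded_real[OF assms(1,4)] by metis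
  then show ?thesis by (rule integrable_bounded_on[OF assms(2,3,4)])
qed

text \<open>The bound \<open>l + 1\<close> turns \<open>K_le\<close> at the levels
  \<open>X i\<close> into the bound \<open>b (l + 1)\<close> at \<open>l\<close>.\<close>

lemma nonneg_rational_seq:
  fixes l :: real
  assumes "0 \<le> l"
  obtains X where "\<And>i :: nat. X i \<in> \<rat>" "\<And>i. 0 \<le> X i" "\<And>i. X i \<le> l + 1" "X \<longlonglongrightarrow> l"
proof -
  have "\<exists>q\<in>\<rat>. l < q \<and> q < l + 1 / real (Suc i)" for i :: nat
    by (intro Rats_dense_in_real) auto
  then obtain X where X: "\<And>i. X i \<in> \<rat>" "\<And>i. l < X i" "\<And>i. X i < l + 1 / real (Suc i)" by metis
  have "(\<lambda>i. l + 1 / real (Suc i)) \<longlonglongrightarrow> l + 0"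
    by (intro tendsto_intros LIMSEQ_Suc[OF lim_1_over_n])
  then have "X \<longlonglongrightarrow> l"
    by (intro tendsto_sandwich[of "\<lambda>_. l" X sequentially "\<lambda>i. l + 1 / real (Suc i)"])
       (use X in \<open>auto intro!: always_eventually less_imp_le\<close>)
  moreover have "X i \<le> l + 1" for i
  proof -
    have "1 / real (Suc i) \<le> 1" by simp
    with X(3)[of i] show ?thesis by linarith
  qed
  moreover have "0 \<le> X i" for i using X(2)[of i] assms by linarith
  ultimately show ?thesis using that X(1) by blast
qed

section \<open>Existence and additivity of kernels\<close>

lemma (in valuation_functional) ex_controlled: "\<exists>\<mu> b. controlled_valuation S V \<mu> b"
proof (rule ex_control_measure)
  fix \<mu> and b :: "real \<Rightarrow> real"
  assume a: "sets \<mu> = sets (restrict_space borel S)" "finite_measure \<mu>" "\<And>B. 0 \<le> b B" "mono b"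
    "\<And>f B G. f \<in> cpos_le S B \<Longrightarrow> 0 \<le> B \<Longrightarrow> open G \<Longrightarrow> (\<And>x. x \<in> S - G \<Longrightarrow> f x = 0) \<Longrightarrow>
      V f \<le> b B * measure \<mu> (G \<inter> S)"
  have "controlled_valuation S V \<mu> b"
    by (intro controlled_valuation.intro valuation_functional_axioms controlled_valuation_axioms.intro) (fact a)+
  then show ?thesis by blast
qed

lemma (in controlled_valuation) ex_kernel: "\<exists>K. valuation_kernel S V \<mu> b K"
proof -
  have "\<exists>k. 0 \<le> q \<longrightarrow> k \<in> borel_measurable \<mu> \<and> (\<forall>x. 0 \<le> k x) \<and> (\<forall>x. k x \<le> b q) \<and>
    (\<forall>A\<in>sets \<mu>. ennreal (ext (\<lambda>x. q * indicator A x)) = (\<integral>\<^sup>+x. ennreal (k x) * indicator A x \<partial>\<mu>))" for q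
    using ex_density[of q] by metis
  then obtain K where "\<And>q. 0 \<le> q \<longrightarrow> K q \<in> borel_measurable \<mu> \<and> (\<forall>x. 0 \<le> K q x) \<and> (\<forall>x. K q x \<le> b q) \<and>
    (\<forall>A\<in>sets \<mu>. ennreal (ext (\<lambda>x. q * indicator A x)) = (\<integral>\<^sup>+x. ennreal (K q x) * indicator A x \<partial>\<mu>))"
    by metis
  then have "valuation_kernel S V \<mu> b K" by unfold_locales auto
  then show ?thesis by blast
qed

text \<open>\<open>dev\<close> depends on \<open>S\<close> and \<open>\<mu>\<close> only, so one
  continuous function approximates \<open>F\<close> for all three valuations and additivity passes
  to \<open>ext\<close>; uniqueness of densities does the rest.\<close>

lemma kernel_add:
  fixes S :: "'a::euclidean_space set"
  assumes "valuation_kernel S V1 \<mu> b1 K1" "valuation_kernel S V2 \<mu> b2 K2" "valuation_kernel S V3 \<mu> b3 K3"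
    and V: "\<And>f. f \<in> cpos S \<Longrightarrow> V3 f = V1 f + V2 f" and q: "0 \<le> q"
  shows "AE x in \<mu>. K3 q x = K1 q x + K2 q x"
proof -
  interpret k1: valuation_kernel S V1 \<mu> b1 K1 by fact
  interpret k2: valuation_kernel S V2 \<mu> b2 K2 by fact
  interpret k3: valuation_kernel S V3 \<mu> b3 K3 by fact
  have ext: "k3.ext F = k1.ext F + k2.ext F" if F: "F \<in> k1.bor B" and B: "0 \<le> B" for F B
  proof -
    let ?c = "b1 B + b2 B + b3 B"
    have c: "0 \<le> ?c" using k1.b_nonneg[of B] k2.b_nonneg[of B] k3.b_nonneg[of B] by linarith
    have "\<bar>k3.ext F - (k1.ext F + k2.ext F)\<bar> \<le> 0 + e" if e: "0 < e" for e
    proof -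
      note e1 = small_factor[OF c e]
      obtain f where f: "f \<in> cpos_le S B" "k1.dev f F < e / (?c + 1)"
        by (rule k1.ex_continuous_approx[OF F B e1(1)])
      have "\<bar>k3.ext F - (k1.ext F + k2.ext F)\<bar> \<le> \<bar>V1 f - k1.ext F\<bar> + \<bar>V2 f - k2.ext F\<bar> + \<bar>V3 f - k3.ext F\<bar>"
        using V[OF cpos_le_imp_cpos[OF f(1)]] by linarith
      also have "\<dots> \<le> b1 B * k1.dev f F + b2 B * k1.dev f F + b3 B * k1.dev f F"
        by (intro add_mono k1.ext_approx[OF F B f(1)] k2.ext_approx[OF F B f(1)] k3.ext_approx[OF F B f(1)])
      also have "\<dots> = ?c * k1.dev f F" by (simp add: algebra_simps)
      also have "\<dots> \<le> (?c + 1) * (e / (?c + 1))"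
        using f(2) k1.dev_nonneg[of f F] c by (intro mult_mono) auto
      finally show ?thesis using e1(2) by simp
    qed
    then have "\<bar>k3.ext F - (k1.ext F + k2.ext F)\<bar> \<le> 0" by (rule field_le_epsilon)
    then show ?thesis by simp
  qed
  have qb: "(\<lambda>x. q) \<in> k1.bor q" using q by (simp add: k1.bor_def)
  note m = k1.K_meas[OF q] k2.K_meas[OF q] k3.K_meas[OF q]
  have "density \<mu> (\<lambda>x. ennreal (K3 q x)) = density \<mu> (\<lambda>x. ennreal (K1 q x + K2 q x))"
  proof (rule measure_eqI)
    fix A assume "A \<in> sets (density \<mu> (\<lambda>x. ennreal (K3 q x)))"
    then have A: "A \<in> sets \<mu>" by simp
    have b: "(\<lambda>x. q * indicator A x) \<in> k1.bor q" by (rule k1.bor_indicator[OF qb q A])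
    have "emeasure (density \<mu> (\<lambda>x. ennreal (K3 q x))) A = ennreal (k3.ext (\<lambda>x. q * indicator A x))"
      using m A by (simp add: emeasure_density k3.K_ext[OF q A])
    also have "\<dots> = ennreal (k1.ext (\<lambda>x. q * indicator A x)) + ennreal (k2.ext (\<lambda>x. q * indicator A x))"
      unfolding ext[OF b q] using k1.ext_nonneg[OF b q] k2.ext_nonneg[OF b q] by (rule ennreal_plus)
    also have "\<dots> = (\<integral>\<^sup>+x. ennreal (K1 q x) * indicator A x + ennreal (K2 q x) * indicator A x \<partial>\<mu>)"
      using m A by (simp add: k1.K_ext[OF q A] k2.K_ext[OF q A] nn_integral_add)
    also have "\<dots> = (\<integral>\<^sup>+x. ennreal (K1 q x + K2 q x) * indicator A x \<partial>\<mu>)"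
      using k1.K_nonneg[OF q] k2.K_nonneg[OF q] by (intro nn_integral_cong) (simp add: ennreal_plus distrib_right)
    also have "\<dots> = emeasure (density \<mu> (\<lambda>x. ennreal (K1 q x + K2 q x))) A"
      using m A by (simp add: emeasure_density)
    finally show "emeasure (density \<mu> (\<lambda>x. ennreal (K3 q x))) A = emeasure (density \<mu> (\<lambda>x. ennreal (K1 q x + K2 q x))) A" .
  qed simp
  then have "AE x in \<mu>. ennreal (K3 q x) = ennreal (K1 q x + K2 q x)"
    using m by (subst (asm) k1.density_unique_iff) auto
  then show ?thesis
  proof eventually_elim
    case (elim x)
    then show ?case
      using k1.K_nonneg[OF q, of x] k2.K_nonneg[OF q, of x] k3.K_nonneg[OF q, of x]
      by (subst (asm) ennreal_inj) auto
  qed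
qed

text \<open>Star bodies are abstracted away: \<open>Z f\<close> stands for the measure of the body
  with radial function \<open>f\<close>.\<close>

locale measure_valuation =
  fixes S :: "'a::euclidean_space set" and Z :: "('a \<Rightarrow> real) \<Rightarrow> 'a measure"
  assumes compact: "compact S" and nonempty: "S \<noteq> {}"
    and Z_cong: "(\<And>x. x \<in> S \<Longrightarrow> f x = g x) \<Longrightarrow> Z f = Z g"
    and Z_sets: "f \<in> cpos S \<Longrightarrow> sets (Z f) = sets (restrict_space borel S)"
    and Z_finite: "f \<in> cpos S \<Longrightarrow> finite_measure (Z f)"
    and Z_zero: "measure (Z (\<lambda>x. 0)) S = 0"
    and Z_max_min: "f \<in> cpos S \<Longrightarrow> g \<in> cpos S \<Longrightarrow> A \<in> sets (restrict_space borel S) \<Longrightarrow>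
      emeasure (Z (\<lambda>x. max (f x) (g x))) A + emeasure (Z (\<lambda>x. min (f x) (g x))) A = emeasure (Z f) A + emeasure (Z g) A"
    and Z_cont: "f \<in> cpos S \<Longrightarrow> continuous_on S g \<Longrightarrow> 0 < e \<Longrightarrow>
      \<exists>d>0. \<forall>h\<in>cpos S. (\<forall>x\<in>S. \<bar>h x - f x\<bar> < d) \<longrightarrow> \<bar>(\<integral>x. g x \<partial>Z h) - (\<integral>x. g x \<partial>Z f)\<bar> < e"
begin

definition V :: "('a \<Rightarrow> real) \<Rightarrow> ('a \<Rightarrow> real) \<Rightarrow> real" where
  "V g f = (\<integral>x. g x \<partial>Z f)"

lemma valuation_functional_V:
  assumes g: "g \<in> cpos S"
  shows "valuation_functional S (V g)"
proof
  have gc: "continuous_on S g" using g by (simp add: cpos_def)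
  obtain B where B: "0 < B" "g \<in> cpos_le S B" by (rule cpos_imp_cpos_le[OF compact g])
  have z: "(\<lambda>x. 0) \<in> cpos S" by (simp add: cpos_def)
  have sp: "space (Z f) = S" if "f \<in> cpos S" for f
    using sets_eq_imp_space_eq[OF Z_sets[OF that]] by (simp add: space_restrict_space)
  show "compact S" by (rule compact)
  show "V g f = V g h" if "\<And>x. x \<in> S \<Longrightarrow> f x = h x" for f h
    unfolding V_def using Z_cong[OF that] by simp
  have "\<bar>V g (\<lambda>x. 0)\<bar> \<le> B * measure (Z (\<lambda>x. 0)) S"
    unfolding V_def using B(2) by (intro integral_bounded_on Z_sets Z_finite z gc) (auto simp: cpos_le_def)
  then show "V g (\<lambda>x. 0) = 0" using Z_zero by simp
  show "0 \<le> V g f" if "f \<in> cpos S" for f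
    unfolding V_def using g sp[OF that] by (intro Bochner_Integration.integral_nonneg) (auto simp: cpos_def)
  show "V g (\<lambda>x. max (f x) (h x)) + V g (\<lambda>x. min (f x) (h x)) = V g f + V g h"
    if f: "f \<in> cpos S" and h: "h \<in> cpos S" for f h
  proof -
    have m: "(\<lambda>x. max (f x) (h x)) \<in> cpos S" "(\<lambda>x. min (f x) (h x)) \<in> cpos S"
      using f h by (auto simp: cpos_def le_max_iff_disj intro!: continuous_intros)
    show ?thesis
      unfolding V_def
    proof (rule integral_measure_sum_eq[where B = B])
      show "g \<in> borel_measurable (Z (\<lambda>x. max (f x) (h x)))"
        unfolding measurable_cong_sets[OF Z_sets[OF m(1)] refl] by (rule borel_measurable_continuous_on_restrict[OF gc])
    qed (use B(2) Z_max_min[OF f h] Z_sets Z_finite f h m sp in \<open>auto simp: cpos_le_def\<close>)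
  qed
  show "\<exists>d>0. \<forall>h\<in>cpos S. (\<forall>x\<in>S. \<bar>h x - f x\<bar> < d) \<longrightarrow> \<bar>V g h - V g f\<bar> < e"
    if "f \<in> cpos S" "0 < e" for f and e :: real
    unfolding V_def by (rule Z_cont[OF that(1) gc that(2)])
qed

lemma one_cpos: "(\<lambda>x. 1) \<in> cpos S"
  by (simp add: cpos_def)

definition top_val :: "('a \<Rightarrow> real) \<Rightarrow> real" where
  "top_val d = (SUP x\<in>S. d x)"

lemma top_val:
  assumes "d \<in> cpos S"
  shows "d \<in> cpos_le S (top_val d)" "0 \<le> top_val d"
proof -
  obtain B where B: "0 < B" "d \<in> cpos_le S B" by (rule cpos_imp_cpos_le[OF compact assms])
  have bdd: "bdd_above (d ` S)" by (rule bdd_aboveI[of _ B]) (use B in \<open>auto simp: cpos_le_def\<close>)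
  have le: "d x \<le> top_val d" if "x \<in> S" for x
    unfolding top_val_def by (rule cSUP_upper[OF that bdd])
  then show "d \<in> cpos_le S (top_val d)" using assms by (auto simp: cpos_def cpos_le_def)
  obtain x where "x \<in> S" using nonempty by blast
  with le[of x] assms show "0 \<le> top_val d" by (auto simp: cpos_def intro: order_trans)
qed

lemma top_val_const: "top_val (\<lambda>x. c) = c"
  unfolding top_val_def using nonempty by simp

text \<open>From \<open>d \<le> top_val d\<close> on \<open>S\<close>, \<open>V d\<close> is at most
  \<open>top_val d\<close> times the total mass, so the control measure for total mass serves every
  \<open>d\<close>.\<close>

lemma controlled_V:
  assumes b: "controlled_valuation S (V (\<lambda>x. 1)) \<mu> b" and d: "d \<in> cpos S"
  shows "controlled_valuation S (V d) \<mu> (\<lambda>B. top_val d * b B)"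
proof -
  interpret one: controlled_valuation S "V (\<lambda>x. 1)" \<mu> b by (rule b)
  interpret valuation_functional S "V d" by (rule valuation_functional_V[OF d])
  note t = top_val[OF d]
  have dc: "continuous_on S d" using d by (simp add: cpos_def)
  have le: "V d f \<le> top_val d * V (\<lambda>x. 1) f" if f: "f \<in> cpos S" for f
  proof -
    have sp: "space (Z f) = S"
      using sets_eq_imp_space_eq[OF Z_sets[OF f]] by (simp add: space_restrict_space)
    have "\<bar>V d f\<bar> \<le> top_val d * measure (Z f) S"
      unfolding V_def using t(1) by (intro integral_bounded_on Z_sets Z_finite f dc) (auto simp: cpos_le_def)
    then show ?thesis unfolding V_def using sp by simp
  qed
  show ?thesis
  proof
    show "mono (\<lambda>B. top_val d * b B)"
      using one.b_mono t(2) by (intro monoI mult_left_mono) (auto dest: monoD)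
    show "V d f \<le> top_val d * b B * measure \<mu> (G \<inter> S)"
      if "f \<in> cpos_le S B" "0 \<le> B" "open G" "\<And>x. x \<in> S - G \<Longrightarrow> f x = 0" for f B G
    proof -
      have "V d f \<le> top_val d * V (\<lambda>x. 1) f" by (rule le[OF cpos_le_imp_cpos[OF that(1)]])
      also have "\<dots> \<le> top_val d * (b B * measure \<mu> (G \<inter> S))"
        by (intro mult_left_mono t(2) one.control that)
      finally show ?thesis by (simp add: mult.assoc)
    qed
  qed (use one.sets one.fin one.b_nonneg t(2) in auto)
qed

text \<open>The almost-everywhere statements concern countably many functions of the cone and
  rational levels, so one null set collects all exceptions. At the other points the hypotheses of
  Riesz' theorem pass from rational to real levels by limits.\<close>

theorem ex_representation:
  obtains \<mu> :: "'a measure" and U :: "real \<Rightarrow> 'a \<Rightarrow> 'a measure" and S0 \<zeta>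
  where "sets \<mu> = sets (restrict_space borel S)" "finite_measure \<mu>"
    "\<And>l x. 0 \<le> l \<Longrightarrow> x \<in> S \<Longrightarrow> sets (U l x) = sets (restrict_space borel S)"
    "\<And>l x. 0 \<le> l \<Longrightarrow> x \<in> S \<Longrightarrow> finite_measure (U l x)"
    "\<And>l. 0 \<le> \<zeta> l" "\<And>l x. 0 \<le> l \<Longrightarrow> x \<in> S \<Longrightarrow> measure (U l x) S \<le> \<zeta> l"
    "S0 \<in> sets \<mu>" "AE x in \<mu>. x \<in> S0"
    "\<And>x (g :: 'a \<Rightarrow> real). x \<in> S0 \<Longrightarrow> continuous_on S g \<Longrightarrow> continuous_on {0..} (\<lambda>l. \<integral>y. g y \<partial>U l x)"
    "\<And>l (g :: 'a \<Rightarrow> real). 0 \<le> l \<Longrightarrow> continuous_on S g \<Longrightarrow> (\<lambda>x. \<integral>y. g y \<partial>U l x) \<in> borel_measurable \<mu>"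
    "\<And>x. x \<in> S0 \<Longrightarrow> measure (U 0 x) S = 0"
    "\<And>f (g :: 'a \<Rightarrow> real). f \<in> cpos S \<Longrightarrow> continuous_on S g \<Longrightarrow>
      has_bochner_integral \<mu> (\<lambda>x. \<integral>y. g y \<partial>U (f x) x) (\<integral>y. g y \<partial>Z f)"
proof -
  interpret v1: valuation_functional S "V (\<lambda>x. 1)" by (rule valuation_functional_V[OF one_cpos])
  obtain \<mu> b where c1: "controlled_valuation S (V (\<lambda>x. 1)) \<mu> b"
    using v1.ex_controlled by blast
  interpret c1: controlled_valuation S "V (\<lambda>x. 1)" \<mu> b
    by (rule c1)
  have mb: "sets \<mu> = sets (restrict_space borel S)" "finite_measure \<mu>" "\<And>B. 0 \<le> b B" "mono b"
    using c1.sets c1.fin c1.b_nonneg c1.b_mono by blast+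
  have "\<exists>K. valuation_kernel S (V d) \<mu> (\<lambda>B. top_val d * b B) K" if "d \<in> ratcone S" for d
    using controlled_valuation.ex_kernel[OF controlled_V[OF c1 ratcone_cpos[OF that]]] .
  then obtain K where K: "\<And>d. d \<in> ratcone S \<Longrightarrow> valuation_kernel S (V d) \<mu> (\<lambda>B. top_val d * b B) (K d)"
    by metis
  have one: "(\<lambda>x. 1) \<in> ratcone S" using ratcone_const[of 1 S] by simp
  have A1: "AE x in \<mu>. \<forall>d\<in>ratcone S. \<forall>n :: nat. uniformly_continuous_on (\<rat> \<inter> {0..real n}) (\<lambda>q. K d q x)"
    unfolding AE_ball_countable[OF countable_ratcone]
    using valuation_kernel.AE_uniformly_continuous[OF K] by blast
  have A2: "AE x in \<mu>. \<forall>d\<in>ratcone S. \<forall>e\<in>ratcone S. \<forall>q\<in>\<rat> \<inter> {0..}. K (\<lambda>y. d y + e y) q x = K d q x + K e q x"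
    unfolding AE_ball_countable[OF countable_ratcone] AE_ball_countable[OF countable_Int1[OF countable_rat]]
  proof (intro ballI)
    fix d e and q :: real assume d: "d \<in> ratcone S" and e: "e \<in> ratcone S" and q: "q \<in> \<rat> \<inter> {0..}"
    have "V (\<lambda>y. d y + e y) f = V d f + V e f" if f: "f \<in> cpos S" for f
      unfolding V_def using ratcone_cpos[OF d] ratcone_cpos[OF e]
      by (intro Bochner_Integration.integral_add integrable_on_compact[OF compact Z_sets[OF f] Z_finite[OF f]]) (auto simp: cpos_def)
    then show "AE x in \<mu>. K (\<lambda>y. d y + e y) q x = K d q x + K e q x"
      using q by (intro kernel_add[OF K[OF d] K[OF e] K[OF ratcone_add[OF d e]]]) auto
  qed
  interpret k1: valuation_kernel S "V (\<lambda>x. 1)" \<mu> "\<lambda>B. top_val (\<lambda>x. 1) * b B" "K (\<lambda>x. 1)"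
    by (rule K[OF one])
  have A3: "AE x in \<mu>. K (\<lambda>x. 1) 0 x = 0"
  proof -
    have "(\<integral>\<^sup>+x. ennreal (K (\<lambda>x. 1) 0 x) * indicator S x \<partial>\<mu>) = 0"
      using k1.K_ext[of 0 S] k1.ext_zero by simp
    moreover have "(\<integral>\<^sup>+x. ennreal (K (\<lambda>x. 1) 0 x) * indicator S x \<partial>\<mu>) = (\<integral>\<^sup>+x. ennreal (K (\<lambda>x. 1) 0 x) \<partial>\<mu>)"
      by (intro nn_integral_cong) simp
    ultimately have "AE x in \<mu>. ennreal (K (\<lambda>x. 1) 0 x) = 0"
      using k1.K_meas[of 0] by (subst nn_integral_0_iff_AE[symmetric]) auto
    then show ?thesis
    proof eventually_elim
      case (elim x)
      with k1.K_nonneg[of 0 x] show ?case by simp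
    qed
  qed
  define ok where "ok x \<longleftrightarrow> (\<forall>d\<in>ratcone S. \<forall>n :: nat. uniformly_continuous_on (\<rat> \<inter> {0..real n}) (\<lambda>q. K d q x)) \<and>
    (\<forall>d\<in>ratcone S. \<forall>e\<in>ratcone S. \<forall>q\<in>\<rat> \<inter> {0..}. K (\<lambda>y. d y + e y) q x = K d q x + K e q x) \<and>
    K (\<lambda>x. 1) 0 x = 0" for x
  have "AE x in \<mu>. ok x" unfolding ok_def using A1 A2 A3 by auto
  \<comment> \<open>A measurable null set around the points where \<open>ok\<close> fails makes
    \<open>S0\<close> a Borel set.\<close>
  then obtain N where N: "{x\<in>space \<mu>. \<not> ok x} \<subseteq> N" "N \<in> null_sets \<mu>"
    by (auto simp: eventually_ae_filter)
  define S0 where "S0 = S - N"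
  have S0: "S0 \<in> sets \<mu>" "S0 \<subseteq> S" "\<And>x. x \<in> S0 \<Longrightarrow> ok x"
    using N unfolding S0_def by auto
  have AES0: "AE x in \<mu>. x \<in> S0"
    using AE_space AE_not_in[OF N(2)] by eventually_elim (auto simp: S0_def)
  have "\<exists>h. continuous_on {0..} h \<and> (\<forall>q\<in>\<rat>. 0 \<le> q \<longrightarrow> h q = K d q x)" if "x \<in> S0" "d \<in> ratcone S" for x d
    using rational_extension[of "\<lambda>q. K d q x"] S0(3)[OF that(1)] that(2) unfolding ok_def by metis
  then obtain k where k: "\<And>x d. x \<in> S0 \<Longrightarrow> d \<in> ratcone S \<Longrightarrow> continuous_on {0..} (k x d)"
    "\<And>x d q. x \<in> S0 \<Longrightarrow> d \<in> ratcone S \<Longrightarrow> q \<in> \<rat> \<Longrightarrow> 0 \<le> q \<Longrightarrow> k x d q = K d q x"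
    by metis
  have klim: "(\<lambda>i. K d (X i) x) \<longlonglongrightarrow> k x d l"
    if "x \<in> S0" "d \<in> ratcone S" "\<And>i :: nat. X i \<in> \<rat>" "\<And>i. 0 \<le> X i" "X \<longlonglongrightarrow> l" "0 \<le> l" for x d X l
  proof -
    have "(\<lambda>i. k x d (X i)) \<longlonglongrightarrow> k x d l"
      by (rule continuous_on_tendsto_compose[OF k(1)[OF that(1,2)] that(5)]) (use that in auto)
    then show ?thesis using k(2)[OF that(1,2)] that(3,4) by simp
  qed
  have exM: "\<exists>M. sets M = sets (restrict_space borel S) \<and> finite_measure M \<and> (\<forall>d\<in>ratcone S. integral\<^sup>L M d = k x d l)"
    if x: "x \<in> S0" and l: "0 \<le> l" for x l
  proof -
    obtain X where X: "\<And>i :: nat. X i \<in> \<rat>" "\<And>i. 0 \<le> X i" "\<And>i. X i \<le> l + 1" "X \<longlonglongrightarrow> l"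
      using nonneg_rational_seq[OF l] by metis
    note kl = klim[OF x _ X(1,2,4) l]
    obtain M where "sets M = sets (restrict_space borel S)" "finite_measure M"
      "\<And>d. d \<in> ratcone S \<Longrightarrow> integral\<^sup>L M d = k x d l"
    proof (rule Riesz_representation_ratcone[OF compact nonempty, of "\<lambda>d. k x d l" "b (l + 1)"])
      show "0 \<le> k x d l" if "d \<in> ratcone S" for d
        using valuation_kernel.K_nonneg[OF K[OF that] X(2)] by (intro LIMSEQ_le_const[OF kl[OF that]]) auto
      show "k x (\<lambda>y. d y + e y) l = k x d l + k x e l" if "d \<in> ratcone S" "e \<in> ratcone S" for d e
      proof (rule LIMSEQ_unique[OF kl[OF ratcone_add[OF that]]])
        have "K (\<lambda>y. d y + e y) (X i) x = K d (X i) x + K e (X i) x" for i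
          using S0(3)[OF x] that X(1,2) unfolding ok_def by auto
        then show "(\<lambda>i. K (\<lambda>y. d y + e y) (X i) x) \<longlonglongrightarrow> k x d l + k x e l"
          by (simp add: tendsto_add[OF kl[OF that(1)] kl[OF that(2)]])
      qed
      show "k x (\<lambda>y. real_of_rat c) l \<le> real_of_rat c * b (l + 1)" if "0 \<le> c" for c
      proof (rule LIMSEQ_le_const2[OF kl[OF ratcone_const[OF that]]], intro exI allI impI)
        fix i
        have "K (\<lambda>y. real_of_rat c) (X i) x \<le> real_of_rat c * b (X i)"
          using valuation_kernel.K_le[OF K[OF ratcone_const[OF that]] X(2)] by (simp add: top_val_const)
        also have "\<dots> \<le> real_of_rat c * b (l + 1)"
          using X(3)[of i] that by (intro mult_left_mono monoD[OF mb(4)]) auto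
        finally show "K (\<lambda>y. real_of_rat c) (X i) x \<le> real_of_rat c * b (l + 1)" .
      qed
    qed blast
    then show ?thesis by blast
  qed
  define W where "W l x = (SOME M. sets M = sets (restrict_space borel S) \<and> finite_measure M \<and>
    (\<forall>d\<in>ratcone S. integral\<^sup>L M d = k x d l))" for l x
  have W: "sets (W l x) = sets (restrict_space borel S)" "finite_measure (W l x)"
    "\<And>d. d \<in> ratcone S \<Longrightarrow> integral\<^sup>L (W l x) d = k x d l" if "x \<in> S0" "0 \<le> l" for x l
    using someI_ex[OF exM[OF that]] unfolding W_def[symmetric] by blast+
  \<comment> \<open>The null measure off \<open>S0\<close> makes the measurability in
    \<open>x\<close> and the bound \<open>b (l + 1)\<close> hold without exceptions.\<close>
  define U where "U l x = (if x \<in> S0 then W l x else null_measure (restrict_space borel S))" for l x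
  have U: "sets (U l x) = sets (restrict_space borel S)" "finite_measure (U l x)" if "0 \<le> l" for l x
    using W that unfolding U_def by (auto intro!: finite_measureI)
  have Uk: "integral\<^sup>L (U l x) d = k x d l" if "x \<in> S0" "0 \<le> l" "d \<in> ratcone S" for x l d
    using W(3)[OF that] that(1) by (simp add: U_def)
  have U0: "integral\<^sup>L (U l x) g = 0" if "x \<notin> S0" for x l and g :: "'a \<Rightarrow> real"
    using that by (simp add: U_def integral_null_measure)
  have spU: "space (U l x) = S" if "0 \<le> l" for l x
    using sets_eq_imp_space_eq[OF U(1)[OF that]] by (simp add: space_restrict_space)
  have Uone: "measure (U l x) S = integral\<^sup>L (U l x) (\<lambda>y. 1)" if "0 \<le> l" for l x
    using spU[OF that] by simp
  have bound: "measure (U l x) S \<le> b (l + 1)" if l: "0 \<le> l" for l x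
  proof (cases "x \<in> S0")
    case True
    obtain X where X: "\<And>i :: nat. X i \<in> \<rat>" "\<And>i. 0 \<le> X i" "\<And>i. X i \<le> l + 1" "X \<longlonglongrightarrow> l"
      using nonneg_rational_seq[OF l] by metis
    have "K (\<lambda>y. 1) (X i) x \<le> b (l + 1)" for i
      using k1.K_le[OF X(2), of i x] monoD[OF mb(4) X(3)[of i]] by (simp add: top_val_const)
    then have "k x (\<lambda>y. 1) l \<le> b (l + 1)"
      by (intro LIMSEQ_le_const2[OF klim[OF True one X(1,2,4) l]]) auto
    then show ?thesis unfolding Uone[OF l] Uk[OF True l one] .
  next
    case False
    show ?thesis unfolding Uone[OF l] U0[OF False] by (rule mb(3))
  qed
  have rep: "has_bochner_integral \<mu> (\<lambda>x. integral\<^sup>L (U (f x) x) d) (V d f)"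
    if d: "d \<in> ratcone S" and f: "f \<in> cpos S" for d f
  proof (rule valuation_kernel.representation[OF K[OF d] S0(1) AES0 _ _ _ f])
    show "continuous_on {0..} (\<lambda>l. integral\<^sup>L (U l x) d)" if "x \<in> S0" for x
      by (rule continuous_on_eq[OF k(1)[OF that d]]) (use Uk[OF that _ d] in auto)
    show "integral\<^sup>L (U q x) d = K d q x" if "x \<in> S0" "q \<in> \<rat>" "0 \<le> q" for x q
      using Uk[OF that(1,3) d] k(2)[OF that(1) d that(2,3)] by simp
  qed (use U0 in auto)
  have meas: "(\<lambda>x. integral\<^sup>L (U l x) d) \<in> borel_measurable \<mu>" if d: "d \<in> ratcone S" and l: "0 \<le> l" for d l
  proof -
    have "(\<lambda>x. l) \<in> cpos S" using l by (simp add: cpos_def)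
    from rep[OF d this] show ?thesis by (rule borel_measurable_has_bochner_integral)
  qed
  \<comment> \<open>A signed \<open>g\<close> is approximated by \<open>d j - n\<close> with
    \<open>d j\<close> in the cone. The error is stated for all finite \<open>M\<close> at once,
    since it is applied to \<open>U l x\<close> for varying \<open>l\<close> and \<open>x\<close>
    and also to \<open>Z f\<close>.\<close>
  have approx: "\<exists>d. \<forall>j :: nat. d j \<in> ratcone S \<and> (\<forall>M. sets M = sets (restrict_space borel S) \<longrightarrow> finite_measure M \<longrightarrow>
      \<bar>integral\<^sup>L M g - (integral\<^sup>L M (d j) - real n * integral\<^sup>L M (\<lambda>y. 1))\<bar> \<le> 1 / real (Suc j) * measure M S)"
    if g: "continuous_on S g" and n: "\<And>x. x \<in> S \<Longrightarrow> \<bar>g x\<bar> \<le> real n" for g :: "'a \<Rightarrow> real" and n :: nat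
  proof -
    have gn: "(\<lambda>x. g x + real n) \<in> cpos S"
      using g n by (force simp: cpos_def abs_le_iff intro!: continuous_intros)
    have "\<exists>d. d \<in> ratcone S \<and> (\<forall>x\<in>S. g x + real n < d x \<and> d x < g x + real n + 1 / real (Suc j))" for j :: nat
      using ratcone_dense[OF compact gn, of "1 / real (Suc j)"] by (metis of_nat_0_less_iff zero_less_Suc zero_less_divide_1_iff)
    then obtain d where d: "\<And>j. d j \<in> ratcone S" "\<And>j x. x \<in> S \<Longrightarrow> g x + real n < d j x \<and> d j x < g x + real n + 1 / real (Suc j)"
      by metis
    have "\<bar>integral\<^sup>L M g - (integral\<^sup>L M (d j) - real n * integral\<^sup>L M (\<lambda>y. 1))\<bar> \<le> 1 / real (Suc j) * measure M S"
      if M: "sets M = sets (restrict_space borel S)" "finite_measure M" for M j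
    proof -
      have dc: "continuous_on S (d j)" using ratcone_cpos[OF d(1)] by (simp add: cpos_def)
      note i = integrable_on_compact[OF compact M g] integrable_on_compact[OF compact M dc]
        integrable_on_compact[OF compact M continuous_on_const[of S "1::real"]]
      have "\<bar>\<integral>x. g x - (d j x - real n * 1) \<partial>M\<bar> \<le> 1 / real (Suc j) * measure M S"
      proof (rule integral_bounded_on[OF M])
        show "continuous_on S (\<lambda>x. g x - (d j x - real n * 1))" by (intro continuous_intros g dc)
        show "\<bar>g x - (d j x - real n * 1)\<bar> \<le> 1 / real (Suc j)" if "x \<in> S" for x
          using d(2)[OF that, of j] by (simp del: of_nat_Suc)
      qed
      also have "(\<integral>x. g x - (d j x - real n * 1) \<partial>M) = integral\<^sup>L M g - (integral\<^sup>L M (d j) - real n * integral\<^sup>L M (\<lambda>y. 1))"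
        using i by (simp only: Bochner_Integration.integral_diff Bochner_Integration.integrable_diff integral_mult_right_zero integrable_mult_right)
      finally show ?thesis .
    qed
    with d(1) show ?thesis by blast
  qed
  have cont: "continuous_on {0..} (\<lambda>l. \<integral>y. g y \<partial>U l x)" if x: "x \<in> S0" and g: "continuous_on S g" for x and g :: "'a \<Rightarrow> real"
  proof (rule continuous_on_nonneg_reals)
    fix m :: nat
    obtain n :: nat where n: "\<And>x. x \<in> S \<Longrightarrow> \<bar>g x\<bar> \<le> real n" using compact_bounded_real[OF compact g] by metis
    obtain d where d: "\<And>j :: nat. d j \<in> ratcone S" "\<And>j M. sets M = sets (restrict_space borel S) \<Longrightarrow> finite_measure M \<Longrightarrow>
      \<bar>integral\<^sup>L M g - (integral\<^sup>L M (d j) - real n * integral\<^sup>L M (\<lambda>y. 1))\<bar> \<le> 1 / real (Suc j) * measure M S"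
      using approx[OF g n] by metis
    define h where "h j l = k x (d j) l - real n * k x (\<lambda>y. 1) l" for j l
    have hc: "continuous_on {0..real m} (h j)" for j
      unfolding h_def by (intro continuous_intros continuous_on_subset[OF k(1)[OF x]] d(1) one) auto
    \<comment> \<open>Masses are bounded on \<open>[0,m]\<close>, so the approximation is uniform in
      \<open>l\<close> and preserves continuity.\<close>
    have est: "\<bar>h j l - (\<integral>y. g y \<partial>U l x)\<bar> \<le> 1 / real (Suc j) * b (real m + 1)" if l: "l \<in> {0..real m}" for j l
    proof -
      have l0: "0 \<le> l" using l by simp
      have "\<bar>h j l - (\<integral>y. g y \<partial>U l x)\<bar> \<le> 1 / real (Suc j) * measure (U l x) S"
        using d(2)[where j = j, OF U[OF l0]] Uk[OF x l0 d(1)] Uk[OF x l0 one]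
        unfolding h_def by (metis abs_minus_commute)
      also have "\<dots> \<le> 1 / real (Suc j) * b (real m + 1)"
        using bound[OF l0, of x] monoD[OF mb(4), of "l + 1" "real m + 1"] l
        by (intro mult_left_mono) auto
      finally show ?thesis .
    qed
    have "uniform_limit {0..real m} h (\<lambda>l. \<integral>y. g y \<partial>U l x) sequentially"
      by (rule uniform_limit_one_over_Suc) (rule est)
    then show "continuous_on {0..real m} (\<lambda>l. \<integral>y. g y \<partial>U l x)"
      by (rule uniform_limit_theorem[OF always_eventually[OF allI[OF hc]] _ sequentially_bot])
  qed
  have conv: "(\<lambda>x. \<integral>y. g y \<partial>U (f x) x) \<in> borel_measurable \<mu> \<and>
      has_bochner_integral \<mu> (\<lambda>x. \<integral>y. g y \<partial>U (f x) x) (\<integral>y. g y \<partial>Z f)"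
    if f: "f \<in> cpos S" and g: "continuous_on S g" for f and g :: "'a \<Rightarrow> real"
  proof -
    obtain n :: nat where n: "\<And>x. x \<in> S \<Longrightarrow> \<bar>g x\<bar> \<le> real n" using compact_bounded_real[OF compact g] by metis
    obtain d where d: "\<And>j :: nat. d j \<in> ratcone S" "\<And>j M. sets M = sets (restrict_space borel S) \<Longrightarrow> finite_measure M \<Longrightarrow>
      \<bar>integral\<^sup>L M g - (integral\<^sup>L M (d j) - real n * integral\<^sup>L M (\<lambda>y. 1))\<bar> \<le> 1 / real (Suc j) * measure M S"
      using approx[OF g n] by metis
    obtain B where B: "0 < B" "f \<in> cpos_le S B" by (rule cpos_imp_cpos_le[OF compact f])
    define h where "h j x = integral\<^sup>L (U (f x) x) (d j) - real n * integral\<^sup>L (U (f x) x) (\<lambda>y. 1)" for j x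
    have h: "has_bochner_integral \<mu> (h j) (V (d j) f - real n * V (\<lambda>y. 1) f)" for j
      unfolding h_def by (intro has_bochner_integral_diff has_bochner_integral_mult_right rep d(1) one f)
    have f0: "0 \<le> f x" "f x \<le> B" if "x \<in> S" for x using B(2) that by (auto simp: cpos_le_def)
    have mB: "measure (U (f x) x) S \<le> b (B + 1)" if "x \<in> S" for x
      using bound[OF f0(1)[OF that], of x] monoD[OF mb(4), of "f x + 1" "B + 1"] f0(2)[OF that] by auto
    have est: "\<bar>h j x - (\<integral>y. g y \<partial>U (f x) x)\<bar> \<le> 1 / real (Suc j) * b (B + 1)" if x: "x \<in> S" for j x
    proof -
      have "\<bar>h j x - (\<integral>y. g y \<partial>U (f x) x)\<bar> \<le> 1 / real (Suc j) * measure (U (f x) x) S"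
        using d(2)[where j = j, OF U[OF f0(1)[OF x]]] unfolding h_def by (metis abs_minus_commute)
      also have "\<dots> \<le> 1 / real (Suc j) * b (B + 1)"
        using mB[OF x] by (intro mult_left_mono) auto
      finally show ?thesis .
    qed
    have gb: "\<bar>\<integral>y. g y \<partial>U (f x) x\<bar> \<le> real n * b (B + 1)" if x: "x \<in> S" for x
    proof -
      have "\<bar>\<integral>y. g y \<partial>U (f x) x\<bar> \<le> real n * measure (U (f x) x) S"
        by (intro integral_bounded_on U f0(1) x g n)
      also have "\<dots> \<le> real n * b (B + 1)" using mB[OF x] by (intro mult_left_mono) auto
      finally show ?thesis .
    qed
    have lim: "(\<lambda>j. h j x) \<longlonglongrightarrow> (\<integral>y. g y \<partial>U (f x) x)" if x: "x \<in> S" for x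
      by (rule tendsto_one_over_Suc) (rule est[OF x])
    have hm: "h j \<in> borel_measurable \<mu>" for j using h by (rule borel_measurable_has_bochner_integral)
    have gm: "(\<lambda>x. \<integral>y. g y \<partial>U (f x) x) \<in> borel_measurable \<mu>"
      by (rule borel_measurable_LIMSEQ_real[OF _ hm]) (use lim in auto)
    have AEl: "AE x in \<mu>. (\<lambda>j. h j x) \<longlonglongrightarrow> (\<integral>y. g y \<partial>U (f x) x)" using lim by auto
    have hb: "AE x in \<mu>. norm (h j x) \<le> real n * b (B + 1) + b (B + 1)" for j
    proof -
      have "\<bar>h j x\<bar> \<le> real n * b (B + 1) + b (B + 1)" if x: "x \<in> S" for x
      proof -
        have "1 / real (Suc j) * b (B + 1) \<le> 1 * b (B + 1)" using mb(3) by (intro mult_right_mono) auto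
        with est[OF x, of j] gb[OF x] show ?thesis by linarith
      qed
      then show ?thesis by auto
    qed
    note dc = integrable_dominated_convergence[OF gm hm _ AEl hb] integral_dominated_convergence[OF gm hm _ AEl hb]
    have "(\<lambda>j. V (d j) f - real n * V (\<lambda>y. 1) f) \<longlonglongrightarrow> (\<integral>y. g y \<partial>Z f)"
      by (rule tendsto_one_over_Suc[where c = "measure (Z f) S"])
         (use d(2)[OF Z_sets[OF f] Z_finite[OF f]] in \<open>auto simp: V_def abs_minus_commute\<close>)
    moreover have "integral\<^sup>L \<mu> (h j) = V (d j) f - real n * V (\<lambda>y. 1) f" for j
      using h by (rule has_bochner_integral_integral_eq)
    ultimately have "(\<integral>x. (\<integral>y. g y \<partial>U (f x) x) \<partial>\<mu>) = (\<integral>y. g y \<partial>Z f)"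
      using dc(2) LIMSEQ_unique by fastforce
    with dc(1) gm show ?thesis by (simp add: has_bochner_integral_iff)
  qed
  show ?thesis
  proof (rule that[of \<mu> U "\<lambda>l. b (l + 1)" S0])
    \<comment> \<open>Measurability in \<open>x\<close> at a fixed level is the case of a constant
      \<open>f\<close>.\<close>
    show "(\<lambda>x. \<integral>y. g y \<partial>U l x) \<in> borel_measurable \<mu>" if "0 \<le> l" "continuous_on S g" for l and g :: "'a \<Rightarrow> real"
      using conv[of "\<lambda>x. l" g] that by (auto simp: cpos_def)
    show "measure (U 0 x) S = 0" if "x \<in> S0" for x
      using Uone[of 0 x] Uk[OF that order_refl one] k(2)[OF that one, of 0] S0(3)[OF that] by (simp add: ok_def)
  qed (use mb U bound S0 AES0 cont conv in auto)
qed

end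

section \<open>Superposition operators\<close>

text \<open>Continuity is demanded at every point of \<open>S\<close>: the exceptional null set is
  dealt with beforehand by making the kernel 0 there, so that compositions are Borel.\<close>

locale caratheodory_on =
  fixes S :: "'a::euclidean_space set" and \<mu> :: "'a measure" and k :: "real \<Rightarrow> 'a \<Rightarrow> real"
  assumes sets: "sets \<mu> = sets (restrict_space borel S)"
    and fin: "finite_measure \<mu>"
    and compact: "compact S"
    and k_meas: "0 \<le> l \<Longrightarrow> k l \<in> borel_measurable \<mu>"
    and k_cont: "x \<in> S \<Longrightarrow> continuous_on {0..} (\<lambda>l. k l x)"
begin

sublocale finite_measure \<mu> by (rule fin)

lemma space_eq [simp]: "space \<mu> = S"
  using sets_eq_imp_space_eq[OF sets] by (simp add: space_restrict_space)

lemma closed: "closed S" by (rule compact_imp_closed[OF compact])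

lemma cont_measurable: "continuous_on S f \<Longrightarrow> f \<in> borel_measurable \<mu>" for f :: "'a \<Rightarrow> real"
  unfolding measurable_cong_sets[OF sets refl] by (rule borel_measurable_continuous_on_restrict)

text \<open>\<open>F\<close> rounded down to a grid has countable range, for which the composition
  is measurable; continuity in the level passes this to the limit.\<close>

lemma superposition_measurable:
  assumes F: "F \<in> borel_measurable \<mu>" "\<And>x. x \<in> S \<Longrightarrow> 0 \<le> F x"
  shows "(\<lambda>x. k (F x) x) \<in> borel_measurable \<mu>"
proof -
  define p where "p j x = grid_floor j (F x)" for j x
  have p0: "0 \<le> p j x" if "x \<in> S" for j x
    unfolding p_def by (rule grid_floor_nonneg[OF F(2)[OF that]])
  have pm: "p j \<in> borel_measurable \<mu>" for j unfolding p_def grid_floor_def using F(1) by measurable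
  have pc: "countable (p j ` S)" for j
    by (rule countable_subset[OF _ countable_rat]) (auto simp: p_def grid_floor_Rats)
  have m: "(\<lambda>x. k (p j x) x) \<in> borel_measurable \<mu>" for j
  proof (rule measurable_compose_countable'[where I = "p j ` S" and f = k and g = "p j"])
    show "p j \<in> measurable \<mu> (count_space (p j ` S))"
      unfolding measurable_count_space_eq_countable[OF pc]
      using measurable_sets[OF pm, of "{_}"] by auto
    show "k a \<in> borel_measurable \<mu>" if "a \<in> p j ` S" for a
      using that p0 by (intro k_meas) auto
  qed (rule pc)
  have lim: "(\<lambda>j. k (p j x) x) \<longlonglongrightarrow> k (F x) x" if x: "x \<in> S" for x
  proof (rule continuous_on_tendsto_compose[OF k_cont[OF x]])
    show "(\<lambda>j. p j x) \<longlonglongrightarrow> F x"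
      by (rule tendsto_one_over_Suc[where c = 1]) (use grid_floor_diff in \<open>simp add: p_def\<close>)
  qed (use p0[OF x] F(2)[OF x] in auto)
  show ?thesis
    by (rule borel_measurable_LIMSEQ_real[OF _ m]) (use lim in auto)
qed

end

text \<open>\<open>acting\<close> bounds no integral uniformly in \<open>f\<close>; uniformity along
  convergent sequences has to be extracted from it.\<close>

locale nonneg_caratheodory_on = caratheodory_on +
  assumes k_nonneg: "0 \<le> l \<Longrightarrow> x \<in> S \<Longrightarrow> 0 \<le> k l x"
    and acting: "f \<in> cpos S \<Longrightarrow> integrable \<mu> (\<lambda>x. k (f x) x)"
begin

lemma nn_integral_acting: "f \<in> cpos S \<Longrightarrow> (\<integral>\<^sup>+x. ennreal (k (f x) x) \<partial>\<mu>) < \<infinity>"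
  by (subst nn_integral_eq_integral[OF acting]) (auto simp: cpos_def k_nonneg)

text \<open>If the supremum were not integrable, it would fail to be integrable near some point \<open>s\<close>. On
  disjoint annuli shrinking to \<open>s\<close> one could then choose among the functions \<open>f j\<close> pieces, each
  contributing at least 1, which fit together to one continuous function because \<open>f j\<close> converges
  uniformly; the operator would not be finite at that function.\<close>

lemma superposition_dominated:
  assumes f: "\<And>j. f j \<in> cpos S" and f0: "f0 \<in> cpos S" and lim: "uniform_limit S f f0 sequentially"
  shows "(\<integral>\<^sup>+x. (SUP j. ennreal (k (f j x) x)) \<partial>\<mu>) < \<infinity>"
proof (rule ccontr)
  assume asm: "\<not> (\<integral>\<^sup>+x. (SUP j. ennreal (k (f j x) x)) \<partial>\<mu>) < \<infinity>"
  define w where "w j x = ennreal (k (f j x) x)" for j x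
  define G where "G x = (SUP j. w j x)" for x
  have inf: "(\<integral>\<^sup>+x. G x \<partial>\<mu>) = \<infinity>"
    using asm by (simp add: G_def w_def less_top[symmetric])
  have fm: "f j \<in> borel_measurable \<mu>" and fnn: "x \<in> S \<Longrightarrow> 0 \<le> f j x" for j x
    using f[of j] by (auto simp: cpos_def intro: cont_measurable)
  have wm: "w j \<in> borel_measurable \<mu>" for j
    unfolding w_def using superposition_measurable[OF fm fnn] by measurable
  have Gm: "G \<in> borel_measurable \<mu>"
    unfolding G_def using wm by measurable
  have wfin: "(\<integral>\<^sup>+x. w j x \<partial>\<mu>) < \<infinity>" for j
    unfolding w_def by (rule nn_integral_acting[OF f])
  have op: "A \<inter> S \<in> sets \<mu>" if "open A" for A
    using that unfolding sets by (auto simp: sets_restrict_space)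
  have ptw: "(\<lambda>j. f j x) \<longlonglongrightarrow> f0 x" if "x \<in> S" for x
    using tendsto_uniform_limitI[OF lim that] .
  define I where "I A = (\<integral>\<^sup>+x. G x * indicator A x \<partial>\<mu>)" for A
  \<comment> \<open>Otherwise finitely many balls of finite integral would cover
    \<open>S\<close>.\<close>
  have "\<exists>s\<in>S. \<forall>r>0. I (ball s r \<inter> S) = \<infinity>"
  proof (rule ccontr)
    assume "\<not> ?thesis"
    then have "\<forall>s\<in>S. \<exists>r>0. I (ball s r \<inter> S) \<noteq> \<infinity>" by blast
    then obtain r where r: "\<And>s. s \<in> S \<Longrightarrow> 0 < r s" "\<And>s. s \<in> S \<Longrightarrow> I (ball s (r s) \<inter> S) \<noteq> \<infinity>"
      by metis
    obtain T where T: "T \<subseteq> S" "finite T" "S \<subseteq> (\<Union>s\<in>T. ball s (r s))"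
      using compactE_image[OF compact, of S "\<lambda>s. ball s (r s)"] r(1) by force
    have "(\<integral>\<^sup>+x. G x \<partial>\<mu>) \<le> (\<integral>\<^sup>+x. (\<Sum>s\<in>T. G x * indicator (ball s (r s) \<inter> S) x) \<partial>\<mu>)"
    proof (rule nn_integral_mono)
      fix x assume "x \<in> space \<mu>"
      then obtain s where s: "s \<in> T" "x \<in> ball s (r s) \<inter> S" using T by auto
      then have "G x \<le> G x * indicator (ball s (r s) \<inter> S) x" by simp
      also have "\<dots> \<le> (\<Sum>s\<in>T. G x * indicator (ball s (r s) \<inter> S) x)"
        using s(1) T(2) by (intro member_le_sum) auto
      finally show "G x \<le> (\<Sum>s\<in>T. G x * indicator (ball s (r s) \<inter> S) x)" .
    qed
    also have "\<dots> = (\<Sum>s\<in>T. I (ball s (r s) \<inter> S))"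
      unfolding I_def using Gm op by (intro nn_integral_sum) auto
    also have "\<dots> < \<infinity>" using r(2) T by (auto simp: less_top)
    finally show False using inf by simp
  qed
  then obtain s where s: "s \<in> S" "\<And>r. 0 < r \<Longrightarrow> I (ball s r \<inter> S) = \<infinity>" by blast
  have sM: "{s} \<in> sets \<mu>" using s(1) unfolding sets_on_iff[OF sets closed] by auto
  \<comment> \<open>The point \<open>s\<close> itself has finite integral since
    \<open>k (f j s) s\<close> converges, so the infinite integral sits on the punctured
    balls.\<close>
  have "Bseq (\<lambda>j. k (f j s) s)"
  proof (rule convergent_imp_Bseq, rule convergentI)
    show "(\<lambda>j. k (f j s) s) \<longlonglongrightarrow> k (f0 s) s"
      by (rule continuous_on_tendsto_compose[OF k_cont[OF s(1)] ptw[OF s(1)]])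
         (use fnn[OF s(1)] f0 s(1) in \<open>auto simp: cpos_def\<close>)
  qed
  then obtain c where c: "\<And>j. \<bar>k (f j s) s\<bar> \<le> c" by (auto simp: Bseq_def)
  have Is: "I {s} < \<infinity>"
  proof -
    have "G s \<le> ennreal c" unfolding G_def w_def using c by (intro SUP_least ennreal_leI) (auto simp: abs_le_iff)
    then have Gs: "G s < top" by (rule le_less_trans) simp
    have "I {s} = (\<integral>\<^sup>+x. G s * indicator {s} x \<partial>\<mu>)"
      unfolding I_def by (intro nn_integral_cong) (auto simp: indicator_def)
    also have "\<dots> = G s * emeasure \<mu> {s}" using sM by (simp add: nn_integral_cmult_indicator)
    also have "\<dots> < \<infinity>"
      using Gs by (simp add: ennreal_mult_eq_top_iff less_top[symmetric] emeasure_finite)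
    finally show ?thesis .
  qed
  \<comment> \<open>The index bound \<open>m\<close> will make the piece uniformly close to
    \<open>f0\<close>; the inner radius \<open>r'\<close> will serve as the next outer
    radius.\<close>
  define piece where "piece r m r' C v \<longleftrightarrow> 0 < r' \<and> r' < r \<and> compact C \<and>
      C \<subseteq> {x\<in>S. r' < dist s x \<and> dist s x < r} \<and> continuous_on C v \<and> (\<forall>x\<in>C. \<exists>j\<ge>m. v x = f j x) \<and>
      1 \<le> (\<integral>\<^sup>+x. ennreal (k (v x) x) * indicator C x \<partial>\<mu>)" for r r' :: real and m :: nat and C v
  have step: "\<exists>r' C v. piece r m r' C v" if r: "0 < r" for r and m :: nat
  proof -
    define A where "A n = {x. 1 / real (Suc n) < dist s x \<and> dist s x < r} \<inter> S" for n
    have Ao: "open {x. 1 / real (Suc n) < dist s x \<and> dist s x < r}" for n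
      by (intro open_Collect_conj open_Collect_less continuous_intros)
    have AM: "A n \<in> sets \<mu>" for n unfolding A_def by (rule op[OF Ao])
    \<comment> \<open>Dropping the finitely many \<open>w j\<close> with \<open>j < m\<close>, each
      of finite integral, leaves an infinite integral; the finite suprema on growing annuli increase
      to it.\<close>
    define u where "u n x = (SUP j\<in>{m..m + n}. w j x)" for n x
    have um: "u n \<in> borel_measurable \<mu>" for n
      unfolding u_def using wm by measurable
    have u_le: "u n x \<le> (\<Sum>j\<in>{m..m+n}. w j x)" for n x
      unfolding u_def by (intro SUP_least member_le_sum) auto
    define g where "g n x = u n x * indicator (A n) x" for n x
    have ginc: "incseq g"
    proof (intro incseq_SucI le_funI)
      fix n x
      have "A n \<subseteq> A (Suc n)" unfolding A_def by (auto intro: le_less_trans[rotated] simp: frac_le)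
      moreover have "u n x \<le> u (Suc n) x" unfolding u_def by (intro SUP_subset_mono) auto
      ultimately show "g n x \<le> g (Suc n) x" unfolding g_def by (intro mult_mono) (auto simp: indicator_def)
    qed
    have gm: "g n \<in> borel_measurable \<mu>" for n unfolding g_def using um AM by measurable
    have "G x * indicator (ball s r \<inter> S) x \<le> G x * indicator {s} x + (SUP n. g n x) + (\<Sum>j<m. w j x)"
      if x: "x \<in> S" for x
    proof (cases "x = s \<or> x \<notin> ball s r")
      case True
      then show ?thesis by (auto simp: indicator_def add_increasing2)
    next
      case False
      then have d: "0 < dist s x" "dist s x < r" by auto
      then obtain n0 :: nat where n0: "1 / real (Suc n0) < dist s x" using nat_approx_posE by blast
      have "w j x \<le> (SUP n. g n x) + (\<Sum>j<m. w j x)" for j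
      proof (cases "j < m")
        case True
        then have "w j x \<le> (\<Sum>j<m. w j x)" by (intro member_le_sum) auto
        then show ?thesis by (simp add: add_increasing)
      next
        case False
        let ?n = "max n0 j"
        have "1 / real (Suc ?n) \<le> 1 / real (Suc n0)" by (intro divide_left_mono) auto
        then have "x \<in> A ?n" using n0 d x unfolding A_def by auto
        moreover have "w j x \<le> u ?n x" unfolding u_def using False by (intro SUP_upper) auto
        ultimately have "w j x \<le> g ?n x" by (simp add: g_def)
        also have "\<dots> \<le> (SUP n. g n x)" by (rule SUP_upper) simp
        finally show ?thesis by (simp add: add_increasing2)
      qed
      then have "G x \<le> (SUP n. g n x) + (\<Sum>j<m. w j x)" unfolding G_def by (intro SUP_least)
      then show ?thesis using False x by (simp add: indicator_def)
    qed
    then have "I (ball s r \<inter> S) \<le> (\<integral>\<^sup>+x. G x * indicator {s} x + (SUP n. g n x) + (\<Sum>j<m. w j x) \<partial>\<mu>)"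
      unfolding I_def by (intro nn_integral_mono) simp
    also have "\<dots> = I {s} + (\<integral>\<^sup>+x. (SUP n. g n x) \<partial>\<mu>) + (\<Sum>j<m. \<integral>\<^sup>+x. w j x \<partial>\<mu>)"
      unfolding I_def using Gm sM gm wm by (simp add: nn_integral_add nn_integral_sum)
    finally have "(\<integral>\<^sup>+x. (SUP n. g n x) \<partial>\<mu>) = \<infinity>"
      using s(2)[OF r] Is wfin by (auto simp: top_unique less_top[symmetric])
    moreover have "(\<integral>\<^sup>+x. (SUP n. g n x) \<partial>\<mu>) = (SUP n. \<integral>\<^sup>+x. g n x \<partial>\<mu>)"
      by (rule nn_integral_monotone_convergence_SUP[OF ginc gm])
    ultimately have e: "(SUP n. \<integral>\<^sup>+x. g n x \<partial>\<mu>) = \<infinity>" by metis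
    \<comment> \<open>Two units, because Lusin's theorem and the inner approximation by a compact
      set may each lose up to \<open>1/2\<close>, and 1 must remain.\<close>
    have "2 < (SUP n. \<integral>\<^sup>+x. g n x \<partial>\<mu>)" unfolding e by simp
    then obtain n where n: "2 < (\<integral>\<^sup>+x. g n x \<partial>\<mu>)" unfolding less_SUP_iff by blast
    \<comment> \<open>Losses are counted with the weight \<open>g n\<close>, so \<open>Lusin\<close>
      is applied to this finite measure and not to \<open>\<mu>\<close>.\<close>
    define N where "N = density \<mu> (g n)"
    have Nsets: "sets N = sets (restrict_space borel S)" unfolding N_def using sets by simp
    have NE: "emeasure N B = (\<integral>\<^sup>+x. g n x * indicator B x \<partial>\<mu>)" if "B \<in> sets \<mu>" for B
      unfolding N_def by (rule emeasure_density[OF gm that])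
    have SM: "S \<in> sets \<mu>" using sets.top[of \<mu>] by simp
    have "(\<integral>\<^sup>+x. g n x \<partial>\<mu>) \<le> (\<integral>\<^sup>+x. (\<Sum>j\<in>{m..m+n}. w j x) \<partial>\<mu>)"
      using u_le by (intro nn_integral_mono) (auto simp: g_def indicator_def)
    also have "\<dots> = (\<Sum>j\<in>{m..m+n}. \<integral>\<^sup>+x. w j x \<partial>\<mu>)" using wm by (simp add: nn_integral_sum)
    also have "\<dots> < \<infinity>" using wfin by auto
    finally have gfin: "(\<integral>\<^sup>+x. g n x \<partial>\<mu>) < \<infinity>" .
    have spN: "space N = S" unfolding N_def by simp
    have NS: "emeasure N S = (\<integral>\<^sup>+x. g n x \<partial>\<mu>)"
      unfolding NE[OF SM] by (intro nn_integral_cong) auto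
    have Nfin: "finite_measure N" using gfin NS spN by (intro finite_measureI) auto
    interpret N: finite_measure N by (rule Nfin)
    \<comment> \<open>The least index attaining the maximum makes the selection \<open>v\<close>
      measurable.\<close>
    define J where "J x = (LEAST i. w (m + i) x = u n x)" for x
    have J: "w (m + J x) x = u n x" for x
    proof -
      have "u n x \<in> (\<lambda>j. w j x) ` {m..m+n}"
        unfolding u_def by (intro closed_contains_Sup_cl) (auto simp: finite_imp_closed)
      then obtain i where "w (m + i) x = u n x"
        by (metis (no_types, lifting) atLeastAtMost_iff image_iff le_Suc_ex)
      then show ?thesis unfolding J_def by (rule LeastI)
    qed
    have Jm: "J \<in> measurable \<mu> (count_space UNIV)"
      unfolding J_def
    proof (rule measurable_Least)
      fix i show "Measurable.pred \<mu> (\<lambda>x. w (m + i) x = u n x)" using wm um by measurable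
    qed
    define v where "v x = f (m + J x) x" for x
    have "v \<in> borel_measurable \<mu>"
      unfolding v_def by (rule measurable_compose_countable[where g = J and f = "\<lambda>i. f (m + i)", OF fm Jm])
    then have vN: "v \<in> borel_measurable N" unfolding N_def by simp
    obtain C1 where C1: "compact C1" "C1 \<subseteq> S" "continuous_on C1 v" "measure N (S - C1) < 1 / 2"
      using Lusin[OF Nsets closed Nfin, of "\<lambda>_. v" "1 / 2"] vN by auto
    have C1M: "C1 \<in> sets N" unfolding sets_on_iff[OF Nsets closed] using C1 by (auto intro: borel_compact)
    have AN: "A n \<in> sets N" using AM by (simp add: N_def)
    obtain C where C: "compact C" "C \<subseteq> A n \<inter> C1" "measure N (A n \<inter> C1) < measure N C + 1 / 2"
      using inner_regular_on[OF Nsets closed Nfin, of "A n \<inter> C1" "1 / 2"] AN C1M by auto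
    have CM: "C \<in> sets N" unfolding sets_on_iff[OF Nsets closed] using C C1 by (auto intro: borel_compact)
    have SN: "S \<in> sets N" using SM by (simp add: N_def)
    have "ennreal 2 \<le> emeasure N S" unfolding NS using n by (simp add: less_imp_le)
    then have "2 \<le> measure N S"
      using ennreal_le_measure_iff[OF Nfin, of 2 S] by simp
    moreover have "measure N S \<le> measure N (A n \<inter> C1) + measure N (S - C1) + measure N (S - A n)"
    proof -
      have "measure N S \<le> measure N ((A n \<inter> C1) \<union> (S - C1) \<union> (S - A n))"
        using AN C1M SN by (intro N.finite_measure_mono) auto
      also have "\<dots> \<le> measure N ((A n \<inter> C1) \<union> (S - C1)) + measure N (S - A n)"
        using AN C1M SN by (intro measure_Un_le) auto
      also have "measure N ((A n \<inter> C1) \<union> (S - C1)) \<le> measure N (A n \<inter> C1) + measure N (S - C1)"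
        using AN C1M SN by (intro measure_Un_le) auto
      finally show ?thesis by simp
    qed
    moreover have "measure N (S - A n) = 0"
    proof -
      have "emeasure N (S - A n) = (\<integral>\<^sup>+x. g n x * indicator (S - A n) x \<partial>\<mu>)"
        using SM AM by (intro NE) auto
      also have "\<dots> = (\<integral>\<^sup>+x. 0 \<partial>\<mu>)"
        by (intro nn_integral_cong) (simp add: g_def indicator_def)
      finally have "emeasure N (S - A n) = 0" by simp
      then show ?thesis by (simp add: measure_def)
    qed
    ultimately have "1 \<le> measure N C" using C1(4) C(3) by linarith
    then have "1 \<le> emeasure N C" by (simp add: N.emeasure_eq_measure)
    also have "emeasure N C = (\<integral>\<^sup>+x. g n x * indicator C x \<partial>\<mu>)"
      using CM by (intro NE) (simp add: N_def)
    also have "\<dots> = (\<integral>\<^sup>+x. ennreal (k (v x) x) * indicator C x \<partial>\<mu>)"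
    proof (intro nn_integral_cong)
      fix x
      have "x \<in> A n" if "x \<in> C" using that C(2) by blast
      then show "g n x * indicator C x = ennreal (k (v x) x) * indicator C x"
        using J[of x] by (cases "x \<in> C") (simp_all add: g_def v_def w_def)
    qed
    finally have one: "1 \<le> (\<integral>\<^sup>+x. ennreal (k (v x) x) * indicator C x \<partial>\<mu>)" .
    have "C \<noteq> {}" using one by auto
    then obtain y where "y \<in> A n" using C(2) by blast
    then have "1 / real (Suc n) < r" unfolding A_def by auto
    moreover have "continuous_on C v" using C1(3) C(2) continuous_on_subset by blast
    moreover have "C \<subseteq> {x\<in>S. 1 / real (Suc n) < dist s x \<and> dist s x < r}" using C(2) by (auto simp: A_def)
    moreover have "\<exists>j\<ge>m. v x = f j x" for x
      by (intro exI[of _ "m + J x"]) (simp add: v_def)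
    ultimately show ?thesis using C(1) one unfolding piece_def
      by (intro exI[of _ "1 / real (Suc n)"] exI[of _ C] exI[of _ v]) auto
  qed
  have "\<exists>m. \<forall>j\<ge>m. \<forall>x\<in>S. \<bar>f j x - f0 x\<bar> \<le> (1/2) ^ i" for i :: nat
    using uniform_limitD[OF lim, of "(1/2) ^ i"] unfolding eventually_sequentially dist_real_def
    by (meson less_imp_le zero_less_divide_1_iff zero_less_numeral zero_less_power)
  then obtain m where m: "\<And>i j x. m i \<le> j \<Longrightarrow> x \<in> S \<Longrightarrow> \<bar>f j x - f0 x\<bar> \<le> (1/2) ^ i" by metis
  obtain R Cf vf where RCv: "\<And>r m. 0 < r \<Longrightarrow> piece r m (R r m) (Cf r m) (vf r m)"
    using step by metis
  \<comment> \<open>The inner radius of each piece is the outer radius of the next, so the annuli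
    are disjoint.\<close>
  define r where "r = rec_nat 1 (\<lambda>i t. R t (m i))"
  have rS: "r (Suc i) = R (r i) (m i)" for i by (simp add: r_def)
  have r0: "0 < r i" for i
  proof (induction i)
    case (Suc i)
    then show ?case using RCv[of "r i" "m i"] unfolding rS piece_def by blast
  qed (simp add: r_def)
  define C where "C i = Cf (r i) (m i)" for i
  define v where "v i = vf (r i) (m i)" for i
  have Cv: "r (Suc i) < r i" "compact (C i)" "C i \<subseteq> {x\<in>S. r (Suc i) < dist s x \<and> dist s x < r i}"
    "continuous_on (C i) (v i)" "\<And>x. x \<in> C i \<Longrightarrow> \<exists>j\<ge>m i. v i x = f j x"
    "1 \<le> (\<integral>\<^sup>+x. ennreal (k (v i x) x) * indicator (C i) x \<partial>\<mu>)" for i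
    using RCv[OF r0[of i], of "m i"] unfolding C_def v_def rS piece_def by blast+
  have rdec: "r j \<le> r i" if "i \<le> j" for i j
    using lift_Suc_antimono_le[of r i j] Cv(1) that by (simp add: less_imp_le)
  have f0c: "continuous_on S f0" using f0 by (simp add: cpos_def)
  \<comment> \<open>Tietze's theorem extends the correction \<open>v i - f0\<close> from
    \<open>C i\<close>, with value 0 off the annulus and with the bound \<open>(1/2) ^ i\<close>
    that the choice of \<open>m i\<close> provides.\<close>
  have "\<exists>e. continuous_on S e \<and> (\<forall>x\<in>C i. e x = v i x - f0 x) \<and>
    (\<forall>x\<in>S. \<not> (r (Suc i) < dist s x \<and> dist s x < r i) \<longrightarrow> e x = 0) \<and> (\<forall>x\<in>S. \<bar>e x\<bar> \<le> (1/2) ^ i)" for i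
  proof -
    define D where "D = S - {x. r (Suc i) < dist s x \<and> dist s x < r i}"
    have CS: "C i \<subseteq> S" using Cv(3) by blast
    have "open {x. r (Suc i) < dist s x \<and> dist s x < r i}"
      by (intro open_Collect_conj open_Collect_less continuous_intros)
    then have Dc: "closed D" unfolding D_def using closed by auto
    have Cc: "closed (C i)" using Cv(2) compact_imp_closed by blast
    have dis: "C i \<inter> D = {}" using Cv(3) unfolding D_def by auto
    have "continuous_on (C i \<union> D) (\<lambda>x. if x \<in> C i then v i x - f0 x else 0)"
      using dis Cv(4) continuous_on_subset[OF f0c CS]
      by (intro continuous_on_cases Cc Dc continuous_intros) auto
    moreover have "closedin (top_of_set S) (C i \<union> D)"
      using Cc Dc CS by (intro closed_subset) (auto simp: D_def)
    moreover have "norm (if x \<in> C i then v i x - f0 x else 0) \<le> (1/2) ^ i" if "x \<in> C i \<union> D" for x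
    proof (cases "x \<in> C i")
      case True
      then obtain j where "m i \<le> j" "v i x = f j x" using Cv(5) by blast
      then show ?thesis using m[of i j x] True CS by auto
    qed simp
    ultimately obtain e where e: "continuous_on S e"
      "\<And>x. x \<in> C i \<union> D \<Longrightarrow> e x = (if x \<in> C i then v i x - f0 x else 0)" "\<And>x. x \<in> S \<Longrightarrow> norm (e x) \<le> (1/2) ^ i"
      using Tietze[of "C i \<union> D" "\<lambda>x. if x \<in> C i then v i x - f0 x else 0" S "(1/2) ^ i"] by auto
    show ?thesis
    proof (intro exI[of _ e] conjI ballI impI)
      fix x assume "x \<in> S" "\<not> (r (Suc i) < dist s x \<and> dist s x < r i)"
      then have "x \<in> D" by (simp add: D_def)
      then show "e x = 0" using e(2)[of x] dis by auto
    qed (use e in auto)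
  qed
  then obtain e where e: "\<And>i. continuous_on S (e i)" "\<And>i x. x \<in> C i \<Longrightarrow> e i x = v i x - f0 x"
    "\<And>i x. x \<in> S \<Longrightarrow> \<not> (r (Suc i) < dist s x \<and> dist s x < r i) \<Longrightarrow> e i x = 0"
    "\<And>i x. x \<in> S \<Longrightarrow> \<bar>e i x\<bar> \<le> (1/2) ^ i"
    by metis
  \<comment> \<open>The bounds on the \<open>e i\<close> make \<open>h\<close> continuous. On
    \<open>C i\<close> only \<open>e i\<close> can be non-zero and \<open>f0 + e i\<close> is
    \<open>v i \<ge> 0\<close>, so the maximum changes nothing there.\<close>
  define h where "h x = max 0 (f0 x + (\<Sum>i. e i x))" for x
  have "uniform_limit S (\<lambda>n x. \<Sum>i<n. e i x) (\<lambda>x. \<Sum>i. e i x) sequentially"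
    by (rule Weierstrass_m_test[of _ _ "\<lambda>i. (1/2) ^ i"]) (use e(4) in auto)
  then have "continuous_on S (\<lambda>x. \<Sum>i. e i x)"
    by (rule uniform_limit_theorem[OF always_eventually _ sequentially_bot, rotated])
       (auto intro!: continuous_intros e(1))
  then have hc: "h \<in> cpos S" unfolding h_def cpos_def by (auto intro!: continuous_intros f0c)
  have hv: "h x = v i x" if x: "x \<in> C i" for i x
  proof -
    have xS: "x \<in> S" "r (Suc i) < dist s x" "dist s x < r i" using Cv(3)[of i] x by auto
    have "e j x = 0" if "j \<noteq> i" for j
    proof (rule e(3)[OF xS(1)])
      show "\<not> (r (Suc j) < dist s x \<and> dist s x < r j)"
      proof (cases "j < i")
        case True
        then have "r i \<le> r (Suc j)" by (intro rdec) auto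
        with xS show ?thesis by auto
      next
        case False
        then have "r j \<le> r (Suc i)" using that by (intro rdec) auto
        with xS show ?thesis by auto
      qed
    qed
    then have "(\<Sum>j. e j x) = e i x"
      using suminf_finite[of "{i}" "\<lambda>j. e j x"] by auto
    then have "h x = max 0 (v i x)" unfolding h_def using e(2)[OF x] by simp
    moreover have "0 \<le> v i x" using Cv(5)[OF x] fnn[OF xS(1)] by auto
    ultimately show ?thesis by simp
  qed
  have disj: "C i \<inter> C j = {}" if "i < j" for i j
  proof -
    have "r j \<le> r (Suc i)" using that by (intro rdec) auto
    then show ?thesis using Cv(3)[of i] Cv(3)[of j] by force
  qed
  have CM: "C i \<in> sets \<mu>" for i
    unfolding sets_on_iff[OF sets closed] using Cv(2,3)[of i] by (auto intro: borel_compact)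
  have hm: "(\<lambda>x. ennreal (k (h x) x)) \<in> borel_measurable \<mu>"
    using superposition_measurable[of h] hc cont_measurable[of h] by (auto simp: cpos_def)
  \<comment> \<open>The first \<open>n\<close> pieces contribute at least 1 each, against the
    finiteness of the integral for \<open>h\<close>.\<close>
  have "ennreal (real n) \<le> (\<integral>\<^sup>+x. ennreal (k (h x) x) \<partial>\<mu>)" for n
  proof -
    have "ennreal (real n) = (\<Sum>i<n. 1)" by (simp add: ennreal_of_nat_eq_real_of_nat)
    also have "\<dots> \<le> (\<Sum>i<n. \<integral>\<^sup>+x. ennreal (k (v i x) x) * indicator (C i) x \<partial>\<mu>)"
      by (intro sum_mono Cv(6))
    also have "\<dots> = (\<Sum>i<n. \<integral>\<^sup>+x. ennreal (k (h x) x) * indicator (C i) x \<partial>\<mu>)"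
      by (intro sum.cong refl nn_integral_cong) (auto simp: indicator_def hv)
    also have "\<dots> = (\<integral>\<^sup>+x. (\<Sum>i<n. ennreal (k (h x) x) * indicator (C i) x) \<partial>\<mu>)"
      using hm CM by (intro nn_integral_sum[symmetric]) auto
    also have "\<dots> \<le> (\<integral>\<^sup>+x. ennreal (k (h x) x) \<partial>\<mu>)"
    proof (rule nn_integral_mono)
      fix x
      have "(\<Sum>i<n. indicator (C i) x :: ennreal) \<le> 1"
      proof (cases "\<exists>i<n. x \<in> C i")
        case True
        then obtain i where i: "i < n" "x \<in> C i" by blast
        have "x \<notin> C j" if "j \<noteq> i" for j using disj[of i j] disj[of j i] i that by (cases "i < j") auto
        then have "(\<Sum>i<n. indicator (C i) x :: ennreal) = (\<Sum>j\<in>{i}. indicator (C j) x)"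
          using i(1) by (intro sum.mono_neutral_right) auto
        then show ?thesis using i(2) by simp
      qed simp
      then have "ennreal (k (h x) x) * (\<Sum>i<n. indicator (C i) x) \<le> ennreal (k (h x) x) * 1"
        by (intro mult_left_mono) auto
      then show "(\<Sum>i<n. ennreal (k (h x) x) * indicator (C i) x) \<le> ennreal (k (h x) x)"
        by (simp add: sum_distrib_left)
    qed
    finally show ?thesis .
  qed
  moreover obtain z where z: "(\<integral>\<^sup>+x. ennreal (k (h x) x) \<partial>\<mu>) = ennreal z" "0 \<le> z"
    using nn_integral_acting[OF hc] by (cases "\<integral>\<^sup>+x. ennreal (k (h x) x) \<partial>\<mu>") auto
  ultimately have "real n \<le> z" for n using ennreal_le_iff by metis
  then show False using reals_Archimedean2 by (meson not_less)
qed

text \<open>The supremum of the non-negative kernel along the sequence is, up to a factor, an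
  integrable majorant for the signed kernel \<open>c\<close>. So the kernel of a signed
  \<open>g\<close> is governed by that of total mass.\<close>

lemma superposition_continuous:
  assumes c: "caratheodory_on S \<mu> c" and bound: "\<And>l x. 0 \<le> l \<Longrightarrow> x \<in> S \<Longrightarrow> \<bar>c l x\<bar> \<le> B * k l x"
    and f: "\<And>j. f j \<in> cpos S" and f0: "f0 \<in> cpos S" and lim: "uniform_limit S f f0 sequentially"
  shows "(\<lambda>j. \<integral>x. c (f j x) x \<partial>\<mu>) \<longlonglongrightarrow> (\<integral>x. c (f0 x) x \<partial>\<mu>)"
proof -
  interpret c: caratheodory_on S \<mu> c by (rule c)
  have m: "(\<lambda>x. c (g x) x) \<in> borel_measurable \<mu>" "(\<lambda>x. k (g x) x) \<in> borel_measurable \<mu>" if "g \<in> cpos S" for g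
    using that cont_measurable[of g] c.superposition_measurable[of g] superposition_measurable[of g]
    by (auto simp: cpos_def)
  define G where "G x = (SUP j. ennreal (k (f j x) x))" for x
  have Gm: "G \<in> borel_measurable \<mu>" unfolding G_def using m(2)[OF f] by measurable
  have Gi: "(\<integral>\<^sup>+x. G x \<partial>\<mu>) < \<infinity>"
    unfolding G_def by (rule superposition_dominated[OF f f0 lim])
  then have AE: "AE x in \<mu>. G x \<noteq> \<infinity>" using Gm by (intro nn_integral_PInf_AE) auto
  have fnn: "0 \<le> f j x" if "x \<in> S" for j x using f[of j] that by (auto simp: cpos_def)
  show ?thesis
  proof (rule integral_dominated_convergence[where w = "\<lambda>x. \<bar>B\<bar> * enn2real (G x)"])
    have "(\<integral>\<^sup>+x. ennreal (enn2real (G x)) \<partial>\<mu>) \<le> (\<integral>\<^sup>+x. G x \<partial>\<mu>)"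
      by (intro nn_integral_mono) (metis ennreal_enn2real_if order_refl zero_le)
    then have "integrable \<mu> (\<lambda>x. enn2real (G x))"
      using Gm Gi by (intro integrableI_nonneg) auto
    then show "integrable \<mu> (\<lambda>x. \<bar>B\<bar> * enn2real (G x))" by simp
    show "AE x in \<mu>. (\<lambda>j. c (f j x) x) \<longlonglongrightarrow> c (f0 x) x"
    proof (rule AE_I2)
      fix x assume "x \<in> space \<mu>"
      then have x: "x \<in> S" by simp
      show "(\<lambda>j. c (f j x) x) \<longlonglongrightarrow> c (f0 x) x"
        by (rule continuous_on_tendsto_compose[OF c.k_cont[OF x] tendsto_uniform_limitI[OF lim x]])
           (use fnn[OF x] f0 x in \<open>auto simp: cpos_def\<close>)
    qed
    show "AE x in \<mu>. norm (c (f j x) x) \<le> \<bar>B\<bar> * enn2real (G x)" for j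
      using AE AE_space
    proof eventually_elim
      case (elim x)
      then have x: "x \<in> S" by simp
      have kn: "0 \<le> k (f j x) x" by (rule k_nonneg[OF fnn[OF x] x])
      have "ennreal (k (f j x) x) \<le> G x" unfolding G_def by (rule SUP_upper) simp
      then have "k (f j x) x \<le> enn2real (G x)"
        using elim(1) kn by (metis enn2real_ennreal enn2real_mono infinity_ennreal_def less_top)
      then have "\<bar>B\<bar> * k (f j x) x \<le> \<bar>B\<bar> * enn2real (G x)" by (intro mult_left_mono) auto
      moreover have "B * k (f j x) x \<le> \<bar>B\<bar> * k (f j x) x" using kn by (intro mult_right_mono) auto
      ultimately show ?case using bound[OF fnn[OF x] x, of j] by simp
    qed
  qed (use m(1) f f0 in auto)
qed

end

section \<open>Star bodies\<close>

lemma usphere_nonempty: "(usphere :: (real ^ 'n) set) \<noteq> {}"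
  by simp

lemma star_body_radial_ext:
  assumes "star_body L" "s \<in> usphere"
  shows "radial_ext L s = ereal (radial L s)" "0 \<le> radial L s"
proof -
  have "0 \<le> radial_ext L s" "radial_ext L s < \<infinity>" using assms by (auto simp: star_body_def)
  then show "radial_ext L s = ereal (radial L s)" "0 \<le> radial L s"
    unfolding radial_def by (cases "radial_ext L s"; simp)+
qed

lemma radial_cpos: "star_body L \<Longrightarrow> radial L \<in> cpos usphere"
  using star_body_radial_ext(2)[of L] by (auto simp: cpos_def star_body_def)

lemma radial_ext_mono: "(\<And>l. 0 \<le> l \<Longrightarrow> l *\<^sub>R s \<in> K \<Longrightarrow> l *\<^sub>R s \<in> L) \<Longrightarrow> radial_ext K s \<le> radial_ext L s"
  unfolding radial_ext_def by (intro Sup_subset_mono) auto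

lemma radial_ext_Un: "radial_ext (K \<union> L) s = max (radial_ext K s) (radial_ext L s)"
proof -
  have "{ereal l |l. 0 \<le> l \<and> l *\<^sub>R s \<in> K \<union> L} =
    {ereal l |l. 0 \<le> l \<and> l *\<^sub>R s \<in> K} \<union> {ereal l |l. 0 \<le> l \<and> l *\<^sub>R s \<in> L}" by auto
  then show ?thesis unfolding radial_ext_def by (simp add: Sup_union_distrib sup_max)
qed

lemma star_set_scale:
  assumes K: "star_set K" and l: "l *\<^sub>R s \<in> K" "0 \<le> l'" "l' \<le> l"
  shows "l' *\<^sub>R s \<in> K"
proof (cases "l = 0")
  case False
  then have "l' *\<^sub>R s = (l' / l) *\<^sub>R (l *\<^sub>R s)" by simp
  moreover have "0 \<le> l' / l" "l' / l \<le> 1" using l False by (auto simp: divide_le_eq)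
  ultimately show ?thesis using K l(1) unfolding star_set_def by blast
qed (use l in simp)

text \<open>A star set meets each ray in an initial segment, so on a given ray one of
  \<open>K\<close> and \<open>L\<close> contains the other.\<close>

lemma radial_ext_Int:
  assumes K: "star_set K" and L: "star_set L"
  shows "radial_ext (K \<inter> L) s = min (radial_ext K s) (radial_ext L s)"
proof -
  have *: "radial_ext (K \<inter> L) s = min (radial_ext K s) (radial_ext L s)"
    if sub: "\<And>l. 0 \<le> l \<Longrightarrow> l *\<^sub>R s \<in> K \<Longrightarrow> l *\<^sub>R s \<in> L" for K L
  proof -
    have "radial_ext (K \<inter> L) s = radial_ext K s"
      by (intro antisym radial_ext_mono) (use sub in auto)
    moreover have "radial_ext K s \<le> radial_ext L s" by (rule radial_ext_mono) (rule sub)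
    ultimately show ?thesis by simp
  qed
  show ?thesis
  proof (cases "\<forall>l\<ge>0. l *\<^sub>R s \<in> K \<longrightarrow> l *\<^sub>R s \<in> L")
    case False
    then obtain l0 where l0: "0 \<le> l0" "l0 *\<^sub>R s \<in> K" "l0 *\<^sub>R s \<notin> L" by blast
    have "l *\<^sub>R s \<in> K" if "0 \<le> l" "l *\<^sub>R s \<in> L" for l
    proof -
      have "l \<le> l0" using star_set_scale[OF L that(2) l0(1)] l0(3) by fastforce
      with star_set_scale[OF K l0(2)] that show ?thesis by blast
    qed
    from *[of L K, OF this] show ?thesis by (simp add: Int_commute min.commute)
  qed (use * in blast)
qed

lemma
  assumes K: "star_body K" and L: "star_body L" and s: "s \<in> usphere"
  shows radial_Un: "radial (K \<union> L) s = max (radial K s) (radial L s)"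
    and radial_Int: "radial (K \<inter> L) s = min (radial K s) (radial L s)"
  using star_body_radial_ext[OF K s] star_body_radial_ext[OF L s] K L
  by (simp_all add: radial_def[of "K \<union> L"] radial_def[of "K \<inter> L"] radial_ext_Un radial_ext_Int star_body_def
      max_def min_def)

lemma
  assumes K: "star_body K" and L: "star_body L"
  shows star_body_Un: "star_body (K \<union> L)" and star_body_Int: "star_body (K \<inter> L)"
proof -
  have ss: "star_set K" "star_set L" using K L by (auto simp: star_body_def)
  then have st: "star_set (K \<union> L)" "star_set (K \<inter> L)" unfolding star_set_def by blast+
  have e: "0 \<le> radial_ext (K \<union> L) s" "radial_ext (K \<union> L) s < \<infinity>"
    "0 \<le> radial_ext (K \<inter> L) s" "radial_ext (K \<inter> L) s < \<infinity>" if "s \<in> usphere" for s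
    unfolding radial_ext_Un radial_ext_Int[OF ss]
    using star_body_radial_ext[OF K that] star_body_radial_ext[OF L that] by (simp_all add: max_def min_def)
  have c: "continuous_on usphere (radial K)" "continuous_on usphere (radial L)"
    using K L by (auto simp: star_body_def)
  have "continuous_on usphere (radial (K \<union> L))"
    by (rule continuous_on_eq[OF continuous_on_max[OF c]]) (simp add: radial_Un[OF K L])
  moreover have "continuous_on usphere (radial (K \<inter> L))"
    by (rule continuous_on_eq[OF continuous_on_min[OF c]]) (simp add: radial_Int[OF K L])
  ultimately show "star_body (K \<union> L)" "star_body (K \<inter> L)"
    using st e by (auto simp: star_body_def)
qed

text \<open>The case \<open>x = 0\<close> is split off because its normalisation is the default
  \<open>0\<close> and not a direction.\<close>

definition body_of :: "(real ^ 'n \<Rightarrow> real) \<Rightarrow> (real ^ 'n) set" where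
  "body_of f = {x. x = 0 \<or> norm x \<le> f (x /\<^sub>R norm x)}"

lemma scaled_in_body_of:
  assumes "s \<in> usphere" "0 \<le> l" "0 \<le> f s"
  shows "l *\<^sub>R s \<in> body_of f \<longleftrightarrow> l \<le> f s"
  using assms by (cases "l = 0") (auto simp: body_of_def)

lemma radial_ext_body_of:
  assumes f: "f \<in> cpos usphere" and s: "s \<in> usphere"
  shows "radial_ext (body_of f) s = ereal (f s)"
proof -
  have fs: "0 \<le> f s" using f s by (auto simp: cpos_def)
  have eq: "{ereal l |l. 0 \<le> l \<and> l *\<^sub>R s \<in> body_of f} = {ereal l |l. 0 \<le> l \<and> l \<le> f s}"
    using scaled_in_body_of[where f = f, OF s _ fs] by blast
  show ?thesis
    unfolding radial_ext_def eq by (rule Sup_eqI) (use fs in auto)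
qed

lemma radial_body_of: "f \<in> cpos usphere \<Longrightarrow> s \<in> usphere \<Longrightarrow> radial (body_of f) s = f s"
  by (simp add: radial_def radial_ext_body_of)

lemma star_body_body_of:
  assumes f: "f \<in> cpos usphere"
  shows "star_body (body_of f)"
  unfolding star_body_def
proof (intro conjI ballI)
  show "star_set (body_of f)"
    unfolding star_set_def
  proof safe
    fix x and l :: real assume x: "x \<in> body_of f" and l: "0 \<le> l" "l \<le> 1"
    show "l *\<^sub>R x \<in> body_of f"
    proof (cases "x = 0 \<or> l = 0")
      case False
      then have eq: "(l *\<^sub>R x) /\<^sub>R norm (l *\<^sub>R x) = x /\<^sub>R norm x" using l by simp
      have "norm (l *\<^sub>R x) \<le> norm x" using l by (simp add: mult_left_le_one_le)
      also have "\<dots> \<le> f (x /\<^sub>R norm x)" using x False by (simp add: body_of_def)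
      finally show ?thesis unfolding body_of_def mem_Collect_eq eq by blast
    qed (auto simp: body_of_def)
  qed
  show "continuous_on usphere (radial (body_of f))"
    by (rule continuous_on_eq[of _ f]) (use f radial_body_of[OF f] in \<open>simp_all add: cpos_def\<close>)
qed (use f radial_ext_body_of[OF f] in \<open>auto simp: cpos_def\<close>)

lemma normalize_in_usphere: "x \<noteq> 0 \<Longrightarrow> x /\<^sub>R norm x \<in> usphere"
  by simp

lemma body_of_cong:
  assumes "\<And>s. s \<in> usphere \<Longrightarrow> f s = g s"
  shows "body_of f = body_of g"
proof -
  have "f (x /\<^sub>R norm x) = g (x /\<^sub>R norm x)" if "x \<noteq> 0" for x
    by (rule assms[OF normalize_in_usphere[OF that]])
  then have "x \<in> body_of f \<longleftrightarrow> x \<in> body_of g" for x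
    by (cases "x = 0") (simp_all add: body_of_def)
  then show ?thesis by blast
qed

lemma body_of_max: "body_of (\<lambda>s. max (f s) (g s)) = body_of f \<union> body_of g"
  by (auto simp: body_of_def le_max_iff_disj)

lemma body_of_min: "body_of (\<lambda>s. min (f s) (g s)) = body_of f \<inter> body_of g"
  by (auto simp: body_of_def)

lemma body_of_zero: "body_of (\<lambda>s. 0) = {0}"
  by (auto simp: body_of_def)

lemma sup_norm_upper:
  fixes g :: "real ^ 'n \<Rightarrow> real"
  assumes "continuous_on usphere g" "s \<in> usphere"
  shows "\<bar>g s\<bar> \<le> sup_norm g"
proof -
  obtain n :: nat where "\<And>x. x \<in> usphere \<Longrightarrow> \<bar>g x\<bar> \<le> real n"
    using compact_bounded_real[OF compact_sphere assms(1)] by metis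
  then have "bdd_above ((\<lambda>s. \<bar>g s\<bar>) ` usphere)" by (intro bdd_aboveI[of _ "real n"]) auto
  then show ?thesis unfolding sup_norm_def by (rule cSUP_upper[OF assms(2)])
qed

lemma sup_norm_least:
  fixes g :: "real ^ 'n \<Rightarrow> real"
  assumes "\<And>s. s \<in> usphere \<Longrightarrow> \<bar>g s\<bar> \<le> c"
  shows "sup_norm g \<le> c"
  unfolding sup_norm_def by (rule cSUP_least[OF usphere_nonempty]) (rule assms)

lemma sup_norm_nonneg: "continuous_on usphere g \<Longrightarrow> 0 \<le> sup_norm g"
  for g :: "real ^ 'n \<Rightarrow> real"
  using usphere_nonempty sup_norm_upper[of g] by (metis abs_ge_zero equals0I order_trans)

lemma radial_dist_upper:
  assumes "star_body K" "star_body L" "s \<in> usphere"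
  shows "\<bar>radial K s - radial L s\<bar> \<le> radial_dist K L"
  unfolding radial_dist_def using assms
  by (intro sup_norm_upper[of "\<lambda>s. radial K s - radial L s"]) (auto simp: star_body_def intro!: continuous_intros)

section \<open>Radon measures on the sphere\<close>

text \<open>The supremum over compact subsets is \<open>inner_regular_on\<close>, valid for every
  finite Borel measure on the sphere.\<close>

lemma radon_measures_iff: "M \<in> radon_measures \<longleftrightarrow> sets M = sets sphere_borel \<and> finite_measure M"
proof
  assume M: "sets M = sets sphere_borel \<and> finite_measure M"
  then interpret finite_measure M by simp
  have "emeasure M A = (SUP C\<in>{C. C \<subseteq> A \<and> compact C}. emeasure M C)" if A: "A \<in> sets M" for A
  proof (rule antisym)
    show "emeasure M A \<le> (SUP C\<in>{C. C \<subseteq> A \<and> compact C}. emeasure M C)"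
    proof (rule ennreal_le_epsilon)
      fix e :: real assume e: "0 < e"
      obtain C where C: "compact C" "C \<subseteq> A" "measure M A < measure M C + e"
        using inner_regular_on[OF _ closed_sphere _ A e] M by blast
      have "emeasure M A \<le> ennreal (measure M C + e)"
        unfolding emeasure_eq_measure using C(3) by (intro ennreal_leI) simp
      also have "\<dots> = emeasure M C + ennreal e" using e by (simp add: emeasure_eq_measure)
      also have "\<dots> \<le> (SUP C\<in>{C. C \<subseteq> A \<and> compact C}. emeasure M C) + ennreal e"
        using C by (intro add_right_mono SUP_upper) auto
      finally show "emeasure M A \<le> (SUP C\<in>{C. C \<subseteq> A \<and> compact C}. emeasure M C) + ennreal e" .
    qed
  qed (use A in \<open>auto intro!: SUP_least emeasure_mono\<close>)
  with M show "M \<in> radon_measures" by (simp add: radon_measures_def)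
qed (simp add: radon_measures_def)

lemma
  assumes "M \<in> radon_measures"
  shows radon_sets: "sets M = sets sphere_borel" and radon_finite: "finite_measure M"
    and radon_space: "space M = usphere"
  using assms sets_eq_imp_space_eq[of M sphere_borel] unfolding radon_measures_iff
  by (auto simp: space_restrict_space)

lemma null_measureI:
  assumes "M \<in> radon_measures" "measure M usphere = 0"
  shows "M = null_measure sphere_borel"
proof (rule measure_eqI)
  interpret finite_measure M by (rule radon_finite[OF assms(1)])
  show "sets M = sets (null_measure sphere_borel)" using radon_sets[OF assms(1)] by simp
  fix A
  have "emeasure M A \<le> emeasure M (space M)" by (rule emeasure_space)
  also have "\<dots> = 0" using assms(2) radon_space[OF assms(1)] by (simp add: emeasure_eq_measure)
  finally show "emeasure M A = emeasure (null_measure sphere_borel) A" by simp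
qed

lemma pairing_one: "M \<in> radon_measures \<Longrightarrow> pairing M (\<lambda>x. 1) = measure M usphere"
  unfolding pairing_def using radon_space[of M] by simp

text \<open>The tents \<open>max 0 (1 - n * infdist x C)\<close> decrease to the indicator of
  \<open>C\<close>. \<open>C\<close> must be nonempty because \<open>infdist\<close> to the empty
  set is 0 by convention.\<close>

lemma integral_thickened_indicator:
  assumes M: "M \<in> radon_measures" and C: "closed C" "C \<noteq> {}" "C \<subseteq> usphere"
  shows "(\<lambda>n. pairing M (\<lambda>x. max 0 (1 - real n * infdist x C))) \<longlonglongrightarrow> measure M C"
proof -
  interpret finite_measure M by (rule radon_finite[OF M])
  have CM: "C \<in> sets M" using C unfolding sets_on_iff[OF radon_sets[OF M] closed_sphere] by auto
  have "(\<lambda>n. \<integral>x. max 0 (1 - real n * infdist x C) \<partial>M) \<longlonglongrightarrow> (\<integral>x. indicator C x \<partial>M)"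
  proof (rule integral_dominated_convergence[where w = "\<lambda>_. 1"])
    show "(\<lambda>x. max 0 (1 - real n * infdist x C)) \<in> borel_measurable M" for n
      unfolding measurable_cong_sets[OF radon_sets[OF M] refl]
      by (intro borel_measurable_continuous_on_restrict continuous_intros)
    show "AE x in M. norm (max 0 (1 - real n * infdist x C)) \<le> 1" for n
      by (auto simp: infdist_nonneg)
    show "AE x in M. (\<lambda>n. max 0 (1 - real n * infdist x C)) \<longlonglongrightarrow> indicator C x"
    proof (rule AE_I2)
      fix x
      show "(\<lambda>n. max 0 (1 - real n * infdist x C)) \<longlonglongrightarrow> indicator C x"
      proof (cases "x \<in> C")
        case False
        then have pos: "0 < infdist x C" using C infdist_pos_not_in_closed by blast
        obtain N :: nat where N: "1 < real N * infdist x C"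
          using reals_Archimedean3[OF pos] by blast
        have "max 0 (1 - real n * infdist x C) = 0" if "N \<le> n" for n
        proof -
          have "real N * infdist x C \<le> real n * infdist x C" using that pos by (intro mult_right_mono) auto
          with N show ?thesis by simp
        qed
        then show ?thesis using False
          by (intro tendsto_eventually) (auto simp: eventually_sequentially)
      qed (simp add: infdist_zero)
    qed
  qed (use CM in auto)
  then show ?thesis unfolding pairing_def using CM sets.sets_into_space[OF CM] by (simp add: Int_absorb2)
qed

text \<open>Continuous tents give the equation on compact sets, and inner regularity carries it to
  Borel sets.\<close>

lemma radon_sum_eq:
  assumes M: "M1 \<in> radon_measures" "M2 \<in> radon_measures" "M3 \<in> radon_measures" "M4 \<in> radon_measures"
    and eq: "\<And>g. continuous_on usphere g \<Longrightarrow> pairing M1 g + pairing M2 g = pairing M3 g + pairing M4 g"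
    and A: "A \<in> sets sphere_borel"
  shows "emeasure M1 A + emeasure M2 A = emeasure M3 A + emeasure M4 A"
proof -
  have closed: "measure M1 C + measure M2 C = measure M3 C + measure M4 C" if C: "compact C" "C \<subseteq> usphere" for C
  proof (cases "C = {}")
    case False
    note lim = integral_thickened_indicator[OF _ compact_imp_closed[OF C(1)] False C(2)]
    let ?g = "\<lambda>n x. max 0 (1 - real n * infdist x C)"
    have "(\<lambda>n. pairing M1 (?g n) + pairing M2 (?g n)) \<longlonglongrightarrow> measure M1 C + measure M2 C"
      by (intro tendsto_add lim M)
    moreover have "(\<lambda>n. pairing M3 (?g n) + pairing M4 (?g n)) \<longlonglongrightarrow> measure M3 C + measure M4 C"
      by (intro tendsto_add lim M)
    moreover have "pairing M1 (?g n) + pairing M2 (?g n) = pairing M3 (?g n) + pairing M4 (?g n)" for n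
      by (intro eq continuous_intros)
    ultimately show ?thesis using LIMSEQ_unique by fastforce
  qed simp
  have AM: "A \<in> sets M" if "M \<in> radon_measures" for M using A radon_sets[OF that] by simp
  have "\<bar>(measure M1 A + measure M2 A) - (measure M3 A + measure M4 A)\<bar> \<le> 0 + e" if e: "0 < e" for e
  proof -
    have "\<exists>C. compact C \<and> C \<subseteq> A \<and> measure M A < measure M C + e / 4" if "M \<in> radon_measures" for M
      using inner_regular_on[OF radon_sets[OF that] closed_sphere radon_finite[OF that] AM[OF that], of "e / 4"] e by simp
    then obtain C1 C2 C3 C4 where C: "compact C1" "C1 \<subseteq> A" "measure M1 A < measure M1 C1 + e / 4"
      "compact C2" "C2 \<subseteq> A" "measure M2 A < measure M2 C2 + e / 4"
      "compact C3" "C3 \<subseteq> A" "measure M3 A < measure M3 C3 + e / 4"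
      "compact C4" "C4 \<subseteq> A" "measure M4 A < measure M4 C4 + e / 4" using M by meson
    \<comment> \<open>One compact set for all four measures: enlarging inside \<open>A\<close> only
      improves each approximation.\<close>
    let ?C = "C1 \<union> C2 \<union> C3 \<union> C4"
    have cC: "compact ?C" using C by (intro compact_Un)
    have CA: "?C \<subseteq> A" using C by blast
    have AS: "A \<subseteq> usphere" using sets.sets_into_space[OF A] by (simp add: space_restrict_space)
    have bounds: "measure M ?C \<le> measure M A" "measure M C \<le> measure M ?C"
      if M: "M \<in> radon_measures" and CC: "C \<subseteq> ?C" "compact C" for M C
    proof -
      interpret finite_measure M by (rule radon_finite[OF M])
      have "?C \<in> sets M" unfolding sets_on_iff[OF radon_sets[OF M] closed_sphere]
        using cC CA AS by (auto intro: borel_compact)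
      then show "measure M ?C \<le> measure M A" "measure M C \<le> measure M ?C"
        using CA AM[OF M] CC(1) by (auto intro!: finite_measure_mono)
    qed
    have "measure M1 ?C + measure M2 ?C = measure M3 ?C + measure M4 ?C"
      by (rule closed[OF cC]) (use CA AS in blast)
    moreover have "measure M1 C1 \<le> measure M1 ?C" "measure M2 C2 \<le> measure M2 ?C"
      "measure M3 C3 \<le> measure M3 ?C" "measure M4 C4 \<le> measure M4 ?C"
      by (intro bounds(2) M C; blast)+
    moreover have "measure M1 ?C \<le> measure M1 A" "measure M2 ?C \<le> measure M2 A"
      "measure M3 ?C \<le> measure M3 A" "measure M4 ?C \<le> measure M4 A"
      by (intro bounds(1)[OF _ empty_subsetI compact_empty] M)+
    ultimately show ?thesis using C(3,6,9,12) by linarith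
  qed
  then have "\<bar>(measure M1 A + measure M2 A) - (measure M3 A + measure M4 A)\<bar> \<le> 0" by (rule field_le_epsilon)
  then have "measure M1 A + measure M2 A = measure M3 A + measure M4 A" by simp
  then show ?thesis
    using M[THEN radon_finite] by (simp add: finite_measure.emeasure_eq_measure flip: ennreal_plus)
qed

section \<open>The representation theorem\<close>

lemma has_bochner_integral_completion:
  fixes f :: "'a \<Rightarrow> real"
  assumes "has_bochner_integral M f v"
  shows "has_bochner_integral (completion M) f v"
proof -
  have "f \<in> borel_measurable M" using assms by (rule borel_measurable_has_bochner_integral)
  with assms show ?thesis
    by (simp add: has_bochner_integral_iff integrable_completion integral_completion)
qed

lemma representation_of_valuation:
  fixes Z :: "(real ^ 'n) set \<Rightarrow> (real ^ 'n) measure"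
  assumes Z: "\<And>L. star_body L \<Longrightarrow> Z L \<in> radon_measures"
    and wc: "weak_star_continuous Z" and val: "valuation Z" and zero: "Z {0} = null_measure sphere_borel"
  obtains \<mu> U where "\<mu> \<in> radon_measures" "\<forall>l\<ge>0. \<forall>s\<in>usphere. U l s \<in> radon_measures"
    "strong_caratheodory \<mu> U" "uniformly_controlled U" "AE s in \<mu>. U 0 s = null_measure sphere_borel"
    "represents \<mu> U Z"
proof -
  have rad: "Z (body_of f) \<in> radon_measures" if "f \<in> cpos usphere" for f
    by (rule Z[OF star_body_body_of[OF that]])
  interpret measure_valuation usphere "\<lambda>f. Z (body_of f)"
  proof (rule measure_valuation.intro)
    show "measure (Z (body_of (\<lambda>x. 0))) usphere = 0"
      unfolding body_of_zero zero by (simp add: measure_def)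
    show "Z (body_of f) = Z (body_of g)" if "\<And>x. x \<in> usphere \<Longrightarrow> f x = g x" for f g
      by (rule arg_cong[of _ _ Z], rule body_of_cong) (rule that)
    show "emeasure (Z (body_of (\<lambda>x. max (f x) (g x)))) A + emeasure (Z (body_of (\<lambda>x. min (f x) (g x)))) A =
      emeasure (Z (body_of f)) A + emeasure (Z (body_of g)) A"
      if "f \<in> cpos usphere" "g \<in> cpos usphere" "A \<in> sets sphere_borel" for f g A
      unfolding body_of_max body_of_min
      using val star_body_body_of[OF that(1)] star_body_body_of[OF that(2)] that(3) unfolding valuation_def by blast
  next
    fix f :: "real ^ 'n \<Rightarrow> real" and g :: "real ^ 'n \<Rightarrow> real" and e :: real
    assume f: "f \<in> cpos usphere" and g: "continuous_on usphere g" and e: "0 < e"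
    obtain d where d: "0 < d" "\<And>K. star_body K \<Longrightarrow> radial_dist K (body_of f) < d \<Longrightarrow>
        \<bar>pairing (Z K) g - pairing (Z (body_of f)) g\<bar> < e"
      using wc g star_body_body_of[OF f] e unfolding weak_star_continuous_def by meson
    show "\<exists>d>0. \<forall>h\<in>cpos usphere. (\<forall>x\<in>usphere. \<bar>h x - f x\<bar> < d) \<longrightarrow>
      \<bar>(\<integral>x. g x \<partial>Z (body_of h)) - (\<integral>x. g x \<partial>Z (body_of f))\<bar> < e"
    \<comment> \<open>Half of \<open>d\<close>, as strict pointwise bounds give only a non-strict
      bound on the supremum.\<close>
    proof (intro exI[of _ "d / 2"] conjI ballI impI)
      fix h assume h: "h \<in> cpos usphere" and hf: "\<forall>x\<in>usphere. \<bar>h x - f x\<bar> < d / 2"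
      have "radial_dist (body_of h) (body_of f) \<le> d / 2"
        unfolding radial_dist_def
      proof (rule sup_norm_least)
        fix s :: "real ^ 'n" assume s: "s \<in> usphere"
        then show "\<bar>radial (body_of h) s - radial (body_of f) s\<bar> \<le> d / 2"
          using hf radial_body_of[OF h s] radial_body_of[OF f s] by (simp add: less_imp_le)
      qed
      then show "\<bar>(\<integral>x. g x \<partial>Z (body_of h)) - (\<integral>x. g x \<partial>Z (body_of f))\<bar> < e"
        using d(2)[OF star_body_body_of[OF h]] d(1) by (simp add: pairing_def)
    qed (use d in simp)
  next
    show "sets (Z (body_of f)) = sets sphere_borel" if "f \<in> cpos usphere" for f
      by (rule radon_sets[OF rad[OF that]])
    show "finite_measure (Z (body_of f))" if "f \<in> cpos usphere" for f
      by (rule radon_finite[OF rad[OF that]])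
    show "compact (usphere :: (real ^ 'n) set)" by (rule compact_sphere)
    show "(usphere :: (real ^ 'n) set) \<noteq> {}" by (rule usphere_nonempty)
  qed
  obtain \<mu> :: "(real ^ 'n) measure" and U :: "real \<Rightarrow> real ^ 'n \<Rightarrow> (real ^ 'n) measure" and S0 \<zeta> where
    \<mu>: "sets \<mu> = sets sphere_borel" "finite_measure \<mu>" and
    Us: "\<And>l x. 0 \<le> l \<Longrightarrow> x \<in> usphere \<Longrightarrow> sets (U l x) = sets sphere_borel" and
    Uf: "\<And>l x. 0 \<le> l \<Longrightarrow> x \<in> usphere \<Longrightarrow> finite_measure (U l x)" and
    \<zeta>: "\<And>l. 0 \<le> \<zeta> l" and U\<zeta>: "\<And>l x. 0 \<le> l \<Longrightarrow> x \<in> usphere \<Longrightarrow> measure (U l x) usphere \<le> \<zeta> l" and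
    S0: "S0 \<in> sets \<mu>" "AE x in \<mu>. x \<in> S0" and
    Uc: "\<And>x (g :: real ^ 'n \<Rightarrow> real). x \<in> S0 \<Longrightarrow> continuous_on usphere g \<Longrightarrow> continuous_on {0..} (\<lambda>l. \<integral>y. g y \<partial>U l x)" and
    Um: "\<And>l (g :: real ^ 'n \<Rightarrow> real). 0 \<le> l \<Longrightarrow> continuous_on usphere g \<Longrightarrow> (\<lambda>x. \<integral>y. g y \<partial>U l x) \<in> borel_measurable \<mu>" and
    U0: "\<And>x. x \<in> S0 \<Longrightarrow> measure (U 0 x) usphere = 0" and
    rep: "\<And>f (g :: real ^ 'n \<Rightarrow> real). f \<in> cpos usphere \<Longrightarrow> continuous_on usphere g \<Longrightarrow>
      has_bochner_integral \<mu> (\<lambda>x. \<integral>y. g y \<partial>U (f x) x) (\<integral>y. g y \<partial>Z (body_of f))"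
    by (rule ex_representation) blast
  interpret finite_measure \<mu> by (rule \<mu>(2))
  have \<mu>R: "\<mu> \<in> radon_measures" using \<mu> by (simp add: radon_measures_iff)
  have sp: "space \<mu> = usphere" by (rule radon_space[OF \<mu>R])
  have UR: "U l s \<in> radon_measures" if "0 \<le> l" "s \<in> usphere" for l s
    using Us[OF that] Uf[OF that] by (simp add: radon_measures_iff)
  show ?thesis
  proof (rule that[OF \<mu>R])
    show "\<forall>l\<ge>0. \<forall>s\<in>usphere. U l s \<in> radon_measures" using UR by blast
    show "strong_caratheodory \<mu> U"
      unfolding strong_caratheodory_def strong_caratheodory_real_def pairing_def
    proof (intro allI impI conjI)
      fix g :: "real ^ 'n \<Rightarrow> real" assume g: "continuous_on usphere g"
      show "(\<lambda>s. \<integral>x. g x \<partial>U l s) \<in> borel_measurable sphere_borel" if "0 \<le> l" for l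
        using Um[OF that g] by (simp add: measurable_cong_sets[OF \<mu>(1) refl])
      have "emeasure \<mu> S0 = emeasure \<mu> usphere"
        using S0 sp sets.top[of \<mu>] by (intro emeasure_eq_AE) auto
      then show "\<exists>S0\<in>sets sphere_borel. emeasure \<mu> S0 = emeasure \<mu> usphere \<and>
        (\<forall>s\<in>S0. continuous_on {0..} (\<lambda>l. \<integral>x. g x \<partial>U l s))"
        using S0(1) \<mu>(1) Uc g by (intro bexI[of _ S0]) auto
    qed
    show "uniformly_controlled U"
      unfolding uniformly_controlled_def
    proof (intro exI[of _ \<zeta>] conjI allI impI ballI)
      fix l :: real and s :: "real ^ 'n" and g :: "real ^ 'n \<Rightarrow> real"
      assume l: "0 \<le> l" and s: "s \<in> usphere" and g: "continuous_on usphere g"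
      have "\<bar>pairing (U l s) g\<bar> \<le> sup_norm g * measure (U l s) usphere"
        unfolding pairing_def by (rule integral_bounded_on[OF Us[OF l s] Uf[OF l s] g]) (rule sup_norm_upper[OF g])
      also have "\<dots> \<le> sup_norm g * \<zeta> l"
        by (rule mult_left_mono[OF U\<zeta>[OF l s] sup_norm_nonneg[OF g]])
      finally show "\<bar>pairing (U l s) g\<bar> \<le> sup_norm g * \<zeta> l" .
    qed (rule \<zeta>)
    show "AE s in \<mu>. U 0 s = null_measure sphere_borel"
      using S0(2) AE_space
    proof eventually_elim
      case (elim s)
      then show ?case using U0[of s] UR[of 0 s] sp by (intro null_measureI) auto
    qed
    show "represents \<mu> U Z"
      unfolding represents_def
    proof (intro allI impI)
      fix L :: "(real ^ 'n) set" and g :: "real ^ 'n \<Rightarrow> real" assume L: "star_body L" and g: "continuous_on usphere g"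
      let ?f = "radial L"
      have f: "?f \<in> cpos usphere" by (rule radial_cpos[OF L])
      \<comment> \<open>\<open>L\<close> and \<open>body_of (radial L)\<close> may differ as sets,
        but at distance 0 weak-star continuity makes their pairings equal.\<close>
      have "radial_dist (body_of ?f) L \<le> 0"
        unfolding radial_dist_def by (rule sup_norm_least) (simp add: radial_body_of[OF f])
      then have "\<bar>pairing (Z (body_of ?f)) g - pairing (Z L) g\<bar> \<le> 0 + e" if "0 < e" for e
        using wc g L that star_body_body_of[OF f] unfolding weak_star_continuous_def
        by (smt (verit))
      then have "\<bar>pairing (Z (body_of ?f)) g - pairing (Z L) g\<bar> \<le> 0" by (rule field_le_epsilon)
      then have "pairing (Z L) g = (\<integral>y. g y \<partial>Z (body_of ?f))" by (simp add: pairing_def)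
      then show "has_bochner_integral (completion \<mu>) (\<lambda>s. pairing (U (radial L s) s) g) (pairing (Z L) g)"
        using has_bochner_integral_completion[OF rep[OF f g]] by (simp add: pairing_def)
    qed
  qed
qed

text \<open>In each direction the radial values of the union and the intersection are those of
  \<open>K\<close> and \<open>L\<close> in some order, so the sums of integrands agree
  pointwise.\<close>

lemma valuation_of_representation:
  fixes Z :: "(real ^ 'n) set \<Rightarrow> (real ^ 'n) measure"
  assumes Z: "\<And>L. star_body L \<Longrightarrow> Z L \<in> radon_measures" and \<mu>: "\<mu> \<in> radon_measures"
    and rep: "represents \<mu> U Z"
  shows "valuation Z"
  unfolding valuation_def
proof (intro allI impI ballI)
  have sp: "space \<mu> = usphere" by (rule radon_space[OF \<mu>])
  fix K L A :: "(real ^ 'n) set" assume K: "star_body K" and L: "star_body L" and A: "A \<in> sets sphere_borel"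
  note UI = star_body_Un[OF K L] star_body_Int[OF K L]
  show "emeasure (Z (K \<union> L)) A + emeasure (Z (K \<inter> L)) A = emeasure (Z K) A + emeasure (Z L) A"
  proof (rule radon_sum_eq[OF Z[OF UI(1)] Z[OF UI(2)] Z[OF K] Z[OF L] _ A])
    fix g :: "real ^ 'n \<Rightarrow> real" assume g: "continuous_on usphere g"
    have r: "has_bochner_integral (completion \<mu>) (\<lambda>s. pairing (U (radial M s) s) g) (pairing (Z M) g)"
      if "star_body M" for M
      using rep that g unfolding represents_def by blast
    have eq: "pairing (U (radial (K \<union> L) s) s) g + pairing (U (radial (K \<inter> L) s) s) g =
      pairing (U (radial K s) s) g + pairing (U (radial L s) s) g" if "s \<in> usphere" for s
      unfolding radial_Un[OF K L that] radial_Int[OF K L that] by (simp add: max_def min_def)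
    have "has_bochner_integral (completion \<mu>)
      (\<lambda>s. pairing (U (radial (K \<union> L) s) s) g + pairing (U (radial (K \<inter> L) s) s) g) (pairing (Z K) g + pairing (Z L) g)"
      using has_bochner_integral_add[OF r[OF K] r[OF L]] eq sp
      by (subst has_bochner_integral_cong[OF refl _ refl]) auto
    from has_bochner_integral_eq[OF this has_bochner_integral_add[OF r[OF UI(1)] r[OF UI(2)]]]
    show "pairing (Z (K \<union> L)) g + pairing (Z (K \<inter> L)) g = pairing (Z K) g + pairing (Z L) g" by simp
  qed
qed

text \<open>\<open>superposition_continuous\<close> is applied to the kernel of \<open>g\<close>,
  dominated by \<open>sup_norm g\<close> times the kernel of total mass. The latter has the acting
  property because every non-negative continuous function is a radial function, for which
  \<open>rep\<close> supplies integrability.\<close>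

lemma weak_star_continuous_of_representation:
  fixes Z :: "(real ^ 'n) set \<Rightarrow> (real ^ 'n) measure"
  assumes \<mu>: "\<mu> \<in> radon_measures" and UR: "\<forall>l\<ge>0. \<forall>s\<in>usphere. U l s \<in> radon_measures"
    and sc: "strong_caratheodory \<mu> U" and rep: "represents \<mu> U Z"
  shows "weak_star_continuous Z"
  unfolding weak_star_continuous_def
proof (intro allI impI)
  fix g :: "real ^ 'n \<Rightarrow> real" and L :: "(real ^ 'n) set" and e :: real
  assume g: "continuous_on usphere g" and L: "star_body L" and e: "0 < e"
  interpret \<mu>: finite_measure \<mu> by (rule radon_finite[OF \<mu>])
  note sets = radon_sets[OF \<mu>] and sp = radon_space[OF \<mu>]
  have one: "continuous_on usphere (\<lambda>s :: real ^ 'n. 1 :: real)" by simp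
  have "strong_caratheodory_real \<mu> (\<lambda>l s. pairing (U l s) h)" if "continuous_on usphere h" for h
    using sc that unfolding strong_caratheodory_def by blast
  from this[OF g] this[OF one] obtain S1 S2 where
    S1: "S1 \<in> sets sphere_borel" "emeasure \<mu> S1 = emeasure \<mu> usphere"
      "\<And>s. s \<in> S1 \<Longrightarrow> continuous_on {0..} (\<lambda>l. pairing (U l s) g)" and
    S2: "S2 \<in> sets sphere_borel" "emeasure \<mu> S2 = emeasure \<mu> usphere"
      "\<And>s. s \<in> S2 \<Longrightarrow> continuous_on {0..} (\<lambda>l. pairing (U l s) (\<lambda>x. 1))" and
    meas: "\<And>l. 0 \<le> l \<Longrightarrow> (\<lambda>s. pairing (U l s) g) \<in> borel_measurable sphere_borel"
      "\<And>l. 0 \<le> l \<Longrightarrow> (\<lambda>s. pairing (U l s) (\<lambda>x. 1)) \<in> borel_measurable sphere_borel"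
    unfolding strong_caratheodory_real_def by blast
  have AE1: "AE s in \<mu>. s \<in> T" if "T \<in> sets sphere_borel" "emeasure \<mu> T = emeasure \<mu> usphere" for T
  proof -
    have "emeasure \<mu> (space \<mu> - T) = 0"
      using that sets sp by (subst emeasure_compl) auto
    then show ?thesis using that(1) sets by (intro AE_I[of _ _ "space \<mu> - T"]) auto
  qed
  define S0 where "S0 = S1 \<inter> S2"
  have S0: "S0 \<in> sets \<mu>" using S1(1) S2(1) sets by (simp add: S0_def)
  have AE: "AE s in \<mu>. s \<in> S0"
    using AE1[OF S1(1,2)] AE1[OF S2(1,2)] by eventually_elim (simp add: S0_def)
  \<comment> \<open>Setting the kernels to 0 off \<open>S0\<close> makes them continuous in the
    level at every point while changing them on a null set only.\<close>
  define k where "k h l s = indicator S0 s * pairing (U l s) h" for h l s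
  have car: "caratheodory_on usphere \<mu> (k h)" if h: "h = g \<or> h = (\<lambda>x. 1)" for h
  proof
    show "sets \<mu> = sets sphere_borel" by (rule sets)
    show "k h l \<in> borel_measurable \<mu>" if "0 \<le> l" for l
      unfolding k_def measurable_cong_sets[OF sets refl]
      using h meas[OF that] S0[unfolded sets] by (auto intro!: borel_measurable_times borel_measurable_indicator)
    show "continuous_on {0..} (\<lambda>l. k h l x)" for x
    proof (cases "x \<in> S0")
      case True
      then show ?thesis using h S1(3)[of x] S2(3)[of x] by (auto simp: k_def S0_def)
    qed (simp add: k_def)
  qed (auto simp: \<mu>.finite_measure_axioms)
  have kAE: "AE s in completion \<mu>. pairing (U (f s) s) h = k h (f s) s" for h f
    using AE_completion[OF AE] by eventually_elim (simp add: k_def)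
  have km: "(\<lambda>s. k h (f s) s) \<in> borel_measurable \<mu>" if h: "h = g \<or> h = (\<lambda>x. 1)" and f: "f \<in> cpos usphere" for h f
    using caratheodory_on.superposition_measurable[OF car[OF h], of f] caratheodory_on.cont_measurable[OF car[OF h], of f] f
    by (auto simp: cpos_def)
  have int: "has_bochner_integral \<mu> (\<lambda>s. k h (radial M s) s) (pairing (Z M) h)"
    if M: "star_body M" and h: "h = g \<or> h = (\<lambda>x. 1)" for M h
  proof -
    have "continuous_on usphere h" using h g by auto
    then have 1: "has_bochner_integral (completion \<mu>) (\<lambda>s. pairing (U (radial M s) s) h) (pairing (Z M) h)"
      using rep M unfolding represents_def by blast
    have m: "(\<lambda>s. k h (radial M s) s) \<in> borel_measurable \<mu>" by (rule km[OF h radial_cpos[OF M]])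
    have mc: "(\<lambda>s. k h (radial M s) s) \<in> borel_measurable (completion \<mu>)" by (rule measurable_completion[OF m])
    have "has_bochner_integral (completion \<mu>) (\<lambda>s. k h (radial M s) s) (pairing (Z M) h)"
      using 1 has_bochner_integral_cong_AE[OF borel_measurable_has_bochner_integral[OF 1] mc kAE] by blast
    \<comment> \<open>The modified kernel is Borel along radial functions, so the integral returns
      from the completion to \<open>\<mu>\<close>.\<close>
    then show ?thesis using m
      by (simp add: has_bochner_integral_iff integrable_completion integral_completion)
  qed
  interpret one: nonneg_caratheodory_on usphere \<mu> "k (\<lambda>x. 1)"
  proof (intro nonneg_caratheodory_on.intro car nonneg_caratheodory_on_axioms.intro disjI2 refl)
    show "0 \<le> k (\<lambda>x. 1) l x" if "0 \<le> l" "x \<in> usphere" for l x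
      using pairing_one[of "U l x"] UR that by (simp add: k_def)
    show "integrable \<mu> (\<lambda>x. k (\<lambda>x. 1) (f x) x)" if f: "f \<in> cpos usphere" for f
    proof -
      have "integrable \<mu> (\<lambda>x. k (\<lambda>x. 1) (radial (body_of f) x) x)"
        using int[OF star_body_body_of[OF f], of "\<lambda>x. 1"] by (simp add: has_bochner_integral_iff)
      moreover have "integrable \<mu> (\<lambda>x. k (\<lambda>x. 1) (radial (body_of f) x) x) = integrable \<mu> (\<lambda>x. k (\<lambda>x. 1) (f x) x)"
        using sp radial_body_of[OF f] by (intro Bochner_Integration.integrable_cong) auto
      ultimately show ?thesis by simp
    qed
  qed
  have bound: "\<bar>k g l x\<bar> \<le> sup_norm g * k (\<lambda>x. 1) l x" if l: "0 \<le> l" and x: "x \<in> usphere" for l x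
  proof -
    have R: "U l x \<in> radon_measures" using UR l x by blast
    have "\<bar>pairing (U l x) g\<bar> \<le> sup_norm g * measure (U l x) usphere"
      unfolding pairing_def by (rule integral_bounded_on[OF radon_sets[OF R] radon_finite[OF R] g]) (rule sup_norm_upper[OF g])
    then show ?thesis using pairing_one[OF R] by (simp add: k_def indicator_def)
  qed
  show "\<exists>d>0. \<forall>K. star_body K \<longrightarrow> radial_dist K L < d \<longrightarrow> \<bar>pairing (Z K) g - pairing (Z L) g\<bar> < e"
  proof (rule ccontr)
    assume neg: "\<not> ?thesis"
    have "\<exists>K. star_body K \<and> radial_dist K L < 1 / real (Suc j) \<and> \<not> \<bar>pairing (Z K) g - pairing (Z L) g\<bar> < e" for j
      using neg by (metis of_nat_0_less_iff zero_less_Suc zero_less_divide_1_iff)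
    then obtain K where K: "\<And>j. star_body (K j)" "\<And>j. radial_dist (K j) L < 1 / real (Suc j)"
      "\<And>j. \<not> \<bar>pairing (Z (K j)) g - pairing (Z L) g\<bar> < e" by metis
    have ul: "uniform_limit usphere (\<lambda>j. radial (K j)) (radial L) sequentially"
      by (rule uniform_limit_one_over_Suc[where c = 1])
         (use radial_dist_upper[OF K(1) L] K(2) in \<open>auto intro: order_trans[OF _ less_imp_le] simp del: of_nat_Suc\<close>)
    have "(\<lambda>j. \<integral>x. k g (radial (K j) x) x \<partial>\<mu>) \<longlonglongrightarrow> (\<integral>x. k g (radial L x) x \<partial>\<mu>)"
      by (rule one.superposition_continuous[OF car bound radial_cpos[OF K(1)] radial_cpos[OF L] ul]) auto
    moreover have "(\<integral>x. k g (radial M x) x \<partial>\<mu>) = pairing (Z M) g" if "star_body M" for M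
      using int[OF that, of g] by (simp add: has_bochner_integral_iff)
    ultimately have "(\<lambda>j. pairing (Z (K j)) g) \<longlonglongrightarrow> pairing (Z L) g" using K(1) L by simp
    from LIMSEQ_D[OF this e] obtain N where "\<And>n. N \<le> n \<Longrightarrow> norm (pairing (Z (K n)) g - pairing (Z L) g) < e" by blast
    from this[of N] K(3)[of N] show False by simp
  qed
qed

text \<open>Pairing with 1 gives total mass, and a measure of mass 0 is the null measure.\<close>

lemma zero_of_representation:
  fixes Z :: "(real ^ 'n) set \<Rightarrow> (real ^ 'n) measure"
  assumes Z: "\<And>L. star_body L \<Longrightarrow> Z L \<in> radon_measures" and \<mu>: "\<mu> \<in> radon_measures"
    and U0: "AE s in \<mu>. U 0 s = null_measure sphere_borel" and rep: "represents \<mu> U Z"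
  shows "Z {0} = null_measure sphere_borel"
proof -
  have c: "(\<lambda>s :: real ^ 'n. 0) \<in> cpos usphere" by (simp add: cpos_def)
  have sb: "star_body ({0} :: (real ^ 'n) set)"
    using star_body_body_of[OF c] by (simp add: body_of_zero)
  have r0: "radial {0} s = 0" if "s \<in> usphere" for s :: "real ^ 'n"
    using radial_body_of[OF c that] by (simp add: body_of_zero)
  have hb: "has_bochner_integral (completion \<mu>) (\<lambda>s. pairing (U (radial {0} s) s) (\<lambda>x. 1)) (pairing (Z {0}) (\<lambda>x. 1))"
    using rep sb unfolding represents_def by simp
  have "AE s in completion \<mu>. pairing (U (radial {0} s) s) (\<lambda>x. 1) = 0"
    using AE_completion[OF U0] AE_space
  proof eventually_elim
    case (elim s)
    then have "s \<in> usphere" using radon_space[OF \<mu>] by simp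
    then have "U (radial {0} s) s = null_measure sphere_borel" using elim(1) r0 by simp
    then show ?case by (simp add: pairing_def integral_null_measure)
  qed
  then have "(\<integral>s. pairing (U (radial {0} s) s) (\<lambda>x. 1) \<partial>completion \<mu>) = 0" by (rule integral_eq_zero_AE)
  then have "pairing (Z {0}) (\<lambda>x. 1) = 0" using has_bochner_integral_integral_eq[OF hb] by simp
  then have "measure (Z {0}) usphere = 0" unfolding pairing_one[OF Z[OF sb]] .
  then show ?thesis by (rule null_measureI[OF Z[OF sb]])
qed

theorem theorem1p1:
  fixes Z :: "(real ^ 'n) set \<Rightarrow> (real ^ 'n) measure"
  assumes "\<And>L. star_body L \<Longrightarrow> Z L \<in> radon_measures"
  shows "(weak_star_continuous Z \<and> valuation Z \<and> Z {0} = null_measure sphere_borel) \<longleftrightarrow>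
    (\<exists>\<mu>\<in>radon_measures. \<exists>U :: real \<Rightarrow> real ^ 'n \<Rightarrow> (real ^ 'n) measure.
       (\<forall>l\<ge>0. \<forall>s\<in>usphere. U l s \<in> radon_measures) \<and>
       strong_caratheodory \<mu> U \<and> uniformly_controlled U \<and>
       (AE s in \<mu>. U 0 s = null_measure sphere_borel) \<and>
       represents \<mu> U Z)"
proof
  assume Z: "weak_star_continuous Z \<and> valuation Z \<and> Z {0} = null_measure sphere_borel"
  obtain \<mu> and U :: "real \<Rightarrow> real ^ 'n \<Rightarrow> (real ^ 'n) measure" where
    "\<mu> \<in> radon_measures" "\<forall>l\<ge>0. \<forall>s\<in>usphere. U l s \<in> radon_measures"
    "strong_caratheodory \<mu> U" "uniformly_controlled U" "AE s in \<mu>. U 0 s = null_measure sphere_borel"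
    "represents \<mu> U Z"
    by (rule representation_of_valuation[OF assms]) (use Z in auto)
  then show "\<exists>\<mu>\<in>radon_measures. \<exists>U :: real \<Rightarrow> real ^ 'n \<Rightarrow> (real ^ 'n) measure.
       (\<forall>l\<ge>0. \<forall>s\<in>usphere. U l s \<in> radon_measures) \<and>
       strong_caratheodory \<mu> U \<and> uniformly_controlled U \<and>
       (AE s in \<mu>. U 0 s = null_measure sphere_borel) \<and> represents \<mu> U Z"
    by (intro bexI[of _ \<mu>] exI[of _ U] conjI)
next
  assume "\<exists>\<mu>\<in>radon_measures. \<exists>U :: real \<Rightarrow> real ^ 'n \<Rightarrow> (real ^ 'n) measure.
       (\<forall>l\<ge>0. \<forall>s\<in>usphere. U l s \<in> radon_measures) \<and>
       strong_caratheodory \<mu> U \<and> uniformly_controlled U \<and>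
       (AE s in \<mu>. U 0 s = null_measure sphere_borel) \<and> represents \<mu> U Z"
  then show "weak_star_continuous Z \<and> valuation Z \<and> Z {0} = null_measure sphere_borel"
  proof (elim bexE exE conjE)
    fix \<mu> and U :: "real \<Rightarrow> real ^ 'n \<Rightarrow> (real ^ 'n) measure"
    assume \<mu>: "\<mu> \<in> radon_measures" and U: "\<forall>l\<ge>0. \<forall>s\<in>usphere. U l s \<in> radon_measures"
      "strong_caratheodory \<mu> U" and U0: "AE s in \<mu>. U 0 s = null_measure sphere_borel"
      and rep: "represents \<mu> U Z"
    show ?thesis
      using weak_star_continuous_of_representation[OF \<mu> U rep] valuation_of_representation[OF assms \<mu> rep]
        zero_of_representation[OF assms \<mu> U0 rep] by blast
  qed
qed

end
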